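(* Let $X$ be an infinite dimensional complex Banach space, let $T\in L(X)$, let $1\le i\le 12$, and suppose $0\in\partial\sigma_{\mathbf{R}_i}(T)$. Then: (i) $T$ admits a generalized Kato decomposition if and only if $T$ belongs to the class $\mathbf{gDR}_i$; (ii) $T$ is of Kato type if and only if $T$ belongs to the class $\mathbf{DR}_i$.
   Context: $\partial$ denotes topological boundary in $\mathbb{C}$. $L(Y)$ is the algebra of bounded linear operators on a Banach space $Y$; $T-\lambda$ means $T-\lambda I$. For a Banach space $Y$ (finite dimensional or zero spaces allowed) and $S\in L(Y)$, $N(S)$ and $R(S)$ are the kernel and range, $\alpha(S)=\dim N(S)$, $\beta(S)=\operatorname{codim}R(S)$, $\operatorname{asc}(S)=\inf\{n\ge0:N(S^n)=N(S^{n+1})\}$, $\operatorname{dsc}(S)=\inf\{n\ge0:R(S^n)=R(S^{n+1})\}$ ($\inf\emptyset=\infty$). Classes of operators on $Y$: $\Phi_+(Y)$: $R(S)$ closed and $\alpha(S)<\infty$; $\Phi_-(Y)$: $\beta(S)<\infty$; $\Phi(Y)$: $\alpha(S),\beta(S)<\infty$; for semi-Fredholm $S$, $\operatorname{ind}(S)=\alpha(S)-\beta(S)$; $\mathcal{W}_+(Y)=\{S\in\Phi_+(Y):\operatorname{ind}(S)\le0\}$; $\mathcal{W}_-(Y)=\{S\in\Phi_-(Y):\operatorname{ind}(S)\ge0\}$; $\mathcal{W}(Y)=\{S\in\Phi(Y):\operatorname{ind}(S)=0\}$; $\mathcal{B}_+(Y)=\{S\in\Phi_+(Y):\operatorname{asc}(S)<\infty\}$;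 $\mathcal{B}_-(Y)=\{S\in\Phi_-(Y):\operatorname{dsc}(S)<\infty\}$; $\mathcal{B}(Y)=\mathcal{B}_+(Y)\cap\mathcal{B}_-(Y)$; $\mathcal{M}(Y)$: bounded below operators ($c\|x\|\le\|Sx\|$ for some $c>0$ and all $x$); $\mathcal{Q}(Y)$: surjective operators; $L(Y)^{-1}$: invertible operators. $\mathbf{R}_1=\Phi_+$, $\mathbf{R}_2=\Phi_-$, $\mathbf{R}_3=\Phi$, $\mathbf{R}_4=\mathcal{W}_+$, $\mathbf{R}_5=\mathcal{W}_-$, $\mathbf{R}_6=\mathcal{W}$, $\mathbf{R}_7=\mathcal{B}_+$, $\mathbf{R}_8=\mathcal{B}_-$, $\mathbf{R}_9=\mathcal{B}$, $\mathbf{R}_{10}=\mathcal{M}$, $\mathbf{R}_{11}=\mathcal{Q}$, $\mathbf{R}_{12}=L(\cdot)^{-1}$, where membership of an operator in $\mathbf{R}_i$ refers to the class on the space on which it acts. $\sigma_{\mathbf{R}_i}(T)=\{\lambda\in\mathbb{C}:T-\lambda\notin\mathbf{R}_i\}$. $(M,N)\in Red(T)$ means that $M,N$ are closed $T$-invariant subspaces of $X$ with $X=M\oplus N$; $T_M\in L(M)$, $T_N\in L(N)$ are the restrictions of $T$. $\mathbf{gDR}_i$ (resp. $\mathbf{DR}_i$) is the class of $T\in L(X)$ for which there is $(M,N)\in Red(T)$ with $T_M\in\mathbf{R}_i$ and $T_N$ quasinilpotent (resp. nilpotent); $S$ is quasinilpotent if $\|S^n\|^{1/n}\to0$. $S\in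 L(Y)$ is Kato if $R(S)$ is closed and $N(S)\subset R(S^n)$ for all $n\ge 0$. $T$ admits a generalized Kato decomposition (resp. is of Kato type) if there is $(M,N)\in Red(T)$ such that $T_M$ is Kato and $T_N$ is quasinilpotent (resp. nilpotent). *)

theory Defs
  imports "HOL-Analysis.Analysis"
begin

class complex_normed_vector = real_normed_vector +
  fixes scaleC :: "complex \<Rightarrow> 'a \<Rightarrow> 'a"  (infixr \<open>*\<^sub>C\<close> 75)
  assumes scaleC_add_right: "a *\<^sub>C (x + y) = a *\<^sub>C x + a *\<^sub>C y"
    and scaleC_add_left: "(a + b) *\<^sub>C x = a *\<^sub>C x + b *\<^sub>C x"
    and scaleC_scaleC: "a *\<^sub>C b *\<^sub>C x = (a * b) *\<^sub>C x"
    and scaleC_of_real: "complex_of_real r *\<^sub>C x = r *\<^sub>R x"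
    and norm_scaleC: "norm (a *\<^sub>C x) = cmod a * norm x"

class complex_banach = complex_normed_vector + banach

global_interpretation complex_vector:
  vector_space "scaleC :: complex \<Rightarrow> 'a \<Rightarrow> 'a::complex_normed_vector"
  defines csubspace = complex_vector.subspace
    and cspan = complex_vector.span
    and cdependent = complex_vector.dependent
    and cdim = complex_vector.dim
proof
  show "1 *\<^sub>C x = x" for x :: 'a
    using scaleC_of_real[of 1 x] by simp
qed (simp_all add: scaleC_add_right scaleC_add_left scaleC_scaleC)

text \<open>
  A subspace need not be a type, so an operator on a closed subspace \<open>Y\<close> is represented by a
  function on the ambient type of which only the values on \<open>Y\<close> matter. In particular the
  restriction of \<open>T\<close> to an invariant subspace \<open>M\<close> is \<open>T\<close> itself, considered on the carrier \<open>M\<close>.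
  All notions below carry the space \<open>Y\<close> as a parameter; \<open>UNIV\<close> is the whole Banach space.
  The library's \<open>dim\<close> is a natural number, equal to 0 for spaces of infinite dimension,
  hence the extended version.
\<close>

definition ecdim :: "'a::complex_normed_vector set \<Rightarrow> enat" where
  "ecdim V = (if \<exists>B. finite B \<and> V \<subseteq> cspan B then enat (cdim V) else \<infinity>)"

text \<open>
  The dimension of the quotient of \<open>Y\<close> by \<open>R\<close>: the least number of vectors of \<open>Y\<close> whose
  cosets modulo \<open>R\<close> span the quotient.
\<close>

definition codim_in :: "'a::complex_normed_vector set \<Rightarrow> 'a set \<Rightarrow> enat" where
  "codim_in Y R = (INF F \<in> {F. finite F \<and> F \<subseteq> Y \<and> Y \<subseteq> cspan (R \<union> F)}. enat (card F))"

lemma codim_in_eq_ecdim_complement: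
  fixes R W :: "'a::complex_normed_vector set"
  assumes "csubspace R" "csubspace W" "R \<inter> W = {0}" "Y = {r + w | r w. r \<in> R \<and> w \<in> W}"
  shows "codim_in Y R = ecdim W"
proof (rule antisym)
  have WY: "W \<subseteq> Y"
    using assms(4) complex_vector.subspace_0[OF assms(1)] by force
  show "codim_in Y R \<le> ecdim W"
  proof (cases "\<exists>B. finite B \<and> W \<subseteq> cspan B")
    case True
    then obtain B0 where B0: "finite B0" "W \<subseteq> cspan B0" by blast
    obtain B where B: "B \<subseteq> W" "\<not> cdependent B" "W \<subseteq> cspan B" "card B = cdim W"
      using complex_vector.basis_exists by blast
    have fin: "finite B"
      using complex_vector.independent_span_bound[OF B0(1) B(2)] B(1) B0(2) by blast
    have "Y \<subseteq> cspan (R \<union> B)"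
    proof
      fix y assume "y \<in> Y"
      then obtain r w where y: "y = r + w" "r \<in> R" "w \<in> W" using assms(4) by blast
      have "r \<in> cspan (R \<union> B)" using y(2) by (simp add: complex_vector.span_base)
      moreover have "w \<in> cspan (R \<union> B)"
        using y(3) B(3) complex_vector.span_mono[of B "R \<union> B"] by blast
      ultimately show "y \<in> cspan (R \<union> B)" unfolding y(1) by (rule complex_vector.span_add)
    qed
    then have "codim_in Y R \<le> enat (card B)"
      unfolding codim_in_def using fin B(1) WY by (intro INF_lower) auto
    then show ?thesis using True B(4) by (simp add: ecdim_def)
  next
    case False
    then have "ecdim W = \<infinity>" unfolding ecdim_def by (rule if_not_P)
    then show ?thesis by simp
  qed
  show "ecdim W \<le> codim_in Y R"
    unfolding codim_in_def
  proof (rule INF_greatest, clarify)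
    fix F assume F: "finite F" "F \<subseteq> Y" "Y \<subseteq> cspan (R \<union> F)"
    have "\<forall>f\<in>F. \<exists>w. w \<in> W \<and> f - w \<in> R"
      using F(2) assms(4) by fastforce
    then obtain p where p: "\<And>f. f \<in> F \<Longrightarrow> p f \<in> W \<and> f - p f \<in> R" by metis
    have pW: "cspan (p ` F) \<subseteq> W"
      using p by (intro complex_vector.span_minimal assms) auto
    have "R \<union> F \<subseteq> cspan (R \<union> p ` F)"
    proof
      fix f assume "f \<in> R \<union> F"
      then show "f \<in> cspan (R \<union> p ` F)"
      proof
        assume "f \<in> F"
        then have "f - p f \<in> cspan (R \<union> p ` F)" "p f \<in> cspan (R \<union> p ` F)"
          using p by (simp_all add: complex_vector.span_base)
        from complex_vector.span_add[OF this] show ?thesis by simp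
      qed (simp add: complex_vector.span_base)
    qed
    then have Y: "Y \<subseteq> cspan (R \<union> p ` F)"
      using F(3) complex_vector.span_minimal[OF _ complex_vector.subspace_span] by blast
    have "W \<subseteq> cspan (p ` F)"
    proof
      fix w assume w: "w \<in> W"
      then have "w \<in> cspan (R \<union> p ` F)" using WY Y by blast
      then obtain r s where rs: "w = r + s" "r \<in> cspan R" "s \<in> cspan (p ` F)"
        unfolding complex_vector.span_Un by blast
      have "r \<in> R" using rs(2) assms(1) by (simp add: complex_vector.span_eq_iff[THEN iffD2])
      moreover have "r = w - s" using rs(1) by simp
      then have "r \<in> W" using w rs(3) pW assms(2) complex_vector.subspace_diff by blast
      ultimately have "r = 0" using assms(3) by blast
      then show "w \<in> cspan (p ` F)" using rs by simp
    qed
    moreover from this have "cdim W \<le> card (p ` F)"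
      using F(1) by (intro complex_vector.dim_le_card) auto
    ultimately show "ecdim W \<le> enat (card F)"
      using F(1) card_image_le[OF F(1), of p] unfolding ecdim_def by (auto intro: exI[of _ "p ` F"])
  qed
qed

definition bounded_ops :: "'a::complex_normed_vector set \<Rightarrow> ('a \<Rightarrow> 'a) set" where
  "bounded_ops Y = {S. S ` Y \<subseteq> Y \<and>
     (\<forall>x\<in>Y. \<forall>y\<in>Y. S (x + y) = S x + S y) \<and>
     (\<forall>c. \<forall>x\<in>Y. S (c *\<^sub>C x) = c *\<^sub>C S x) \<and>
     (\<exists>K. \<forall>x\<in>Y. norm (S x) \<le> K * norm x)}"

lemma bounded_ops_UNIV:
  "S \<in> bounded_ops UNIV \<longleftrightarrow> bounded_linear S \<and> (\<forall>c x. S (c *\<^sub>C x) = c *\<^sub>C S x)"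
  unfolding bounded_ops_def bounded_linear_def bounded_linear_axioms_def linear_iff
  by (auto simp: mult.commute simp flip: scaleC_of_real)

definition ker_on :: "'a::complex_normed_vector set \<Rightarrow> ('a \<Rightarrow> 'a) \<Rightarrow> 'a set" where
  "ker_on Y S = {x \<in> Y. S x = 0}"

definition nullity :: "'a::complex_normed_vector set \<Rightarrow> ('a \<Rightarrow> 'a) \<Rightarrow> enat" where
  "nullity Y S = ecdim (ker_on Y S)"

definition defect :: "'a::complex_normed_vector set \<Rightarrow> ('a \<Rightarrow> 'a) \<Rightarrow> enat" where
  "defect Y S = codim_in Y (S ` Y)"

definition ascent :: "'a::complex_normed_vector set \<Rightarrow> ('a \<Rightarrow> 'a) \<Rightarrow> enat" where
  "ascent Y S = Inf {enat n | n. ker_on Y (S ^^ n) = ker_on Y (S ^^ Suc n)}"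

definition descent :: "'a::complex_normed_vector set \<Rightarrow> ('a \<Rightarrow> 'a) \<Rightarrow> enat" where
  "descent Y S = Inf {enat n | n. (S ^^ n) ` Y = (S ^^ Suc n) ` Y}"

text \<open>Only meaningful (and only used) if the nullity or the defect is finite.\<close>

definition index_on :: "'a::complex_normed_vector set \<Rightarrow> ('a \<Rightarrow> 'a) \<Rightarrow> ereal" where
  "index_on Y S = ereal_of_enat (nullity Y S) - ereal_of_enat (defect Y S)"

text \<open>
  The carrier \<open>Y\<close> is always a closed subspace, so that being closed in \<open>Y\<close> and being closed in
  the ambient space coincide.
\<close>

definition Phi_plus :: "'a::complex_normed_vector set \<Rightarrow> ('a \<Rightarrow> 'a) set" where
  "Phi_plus Y = {S \<in> bounded_ops Y. closed (S ` Y) \<and> nullity Y S < \<infinity>}"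

definition Phi_minus :: "'a::complex_normed_vector set \<Rightarrow> ('a \<Rightarrow> 'a) set" where
  "Phi_minus Y = {S \<in> bounded_ops Y. defect Y S < \<infinity>}"

definition Phi :: "'a::complex_normed_vector set \<Rightarrow> ('a \<Rightarrow> 'a) set" where
  "Phi Y = {S \<in> bounded_ops Y. nullity Y S < \<infinity> \<and> defect Y S < \<infinity>}"

definition W_plus :: "'a::complex_normed_vector set \<Rightarrow> ('a \<Rightarrow> 'a) set" where
  "W_plus Y = {S \<in> Phi_plus Y. index_on Y S \<le> 0}"

definition W_minus :: "'a::complex_normed_vector set \<Rightarrow> ('a \<Rightarrow> 'a) set" where
  "W_minus Y = {S \<in> Phi_minus Y. index_on Y S \<ge> 0}"

definition Weyl :: "'a::complex_normed_vector set \<Rightarrow> ('a \<Rightarrow> 'a) set" where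
  "Weyl Y = {S \<in> Phi Y. index_on Y S = 0}"

definition B_plus :: "'a::complex_normed_vector set \<Rightarrow> ('a \<Rightarrow> 'a) set" where
  "B_plus Y = {S \<in> Phi_plus Y. ascent Y S < \<infinity>}"

definition B_minus :: "'a::complex_normed_vector set \<Rightarrow> ('a \<Rightarrow> 'a) set" where
  "B_minus Y = {S \<in> Phi_minus Y. descent Y S < \<infinity>}"

definition Browder :: "'a::complex_normed_vector set \<Rightarrow> ('a \<Rightarrow> 'a) set" where
  "Browder Y = B_plus Y \<inter> B_minus Y"

definition bounded_below_ops :: "'a::complex_normed_vector set \<Rightarrow> ('a \<Rightarrow> 'a) set" where
  "bounded_below_ops Y = {S \<in> bounded_ops Y. \<exists>c>0. \<forall>x\<in>Y. c * norm x \<le> norm (S x)}"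

definition surjective_ops :: "'a::complex_normed_vector set \<Rightarrow> ('a \<Rightarrow> 'a) set" where
  "surjective_ops Y = {S \<in> bounded_ops Y. S ` Y = Y}"

definition invertible_ops :: "'a::complex_normed_vector set \<Rightarrow> ('a \<Rightarrow> 'a) set" where
  "invertible_ops Y = {S \<in> bounded_ops Y. \<exists>U \<in> bounded_ops Y. \<forall>x\<in>Y. U (S x) = x \<and> S (U x) = x}"

text \<open>Meaningful for indices from 1 to 12.\<close>

definition R_class :: "nat \<Rightarrow> 'a::complex_normed_vector set \<Rightarrow> ('a \<Rightarrow> 'a) set" where
  "R_class i Y =
     [Phi_plus Y, Phi_minus Y, Phi Y,
      W_plus Y, W_minus Y, Weyl Y,
      B_plus Y, B_minus Y, Browder Y,
      bounded_below_ops Y, surjective_ops Y, invertible_ops Y] ! (i - 1)"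

definition spectrum_R :: "nat \<Rightarrow> ('a::complex_normed_vector \<Rightarrow> 'a) \<Rightarrow> complex set" where
  "spectrum_R i T = {\<mu>. (\<lambda>x. T x - \<mu> *\<^sub>C x) \<notin> R_class i UNIV}"

definition Red :: "('a::complex_normed_vector \<Rightarrow> 'a) \<Rightarrow> ('a set \<times> 'a set) set" where
  "Red T = {(M, N). csubspace M \<and> closed M \<and> T ` M \<subseteq> M \<and>
     csubspace N \<and> closed N \<and> T ` N \<subseteq> N \<and>
     M \<inter> N = {0} \<and> {m + n | m n. m \<in> M \<and> n \<in> N} = UNIV}"

text \<open>The operator norm on \<open>Y\<close>; for \<open>Y = UNIV\<close> this is the library's \<open>onorm\<close>.\<close>

definition onorm_on :: "'a::complex_normed_vector set \<Rightarrow> ('a \<Rightarrow> 'a) \<Rightarrow> real" where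
  "onorm_on Y S = (SUP x\<in>Y. norm (S x) / norm x)"

definition quasinilpotent_on :: "'a::complex_normed_vector set \<Rightarrow> ('a \<Rightarrow> 'a) \<Rightarrow> bool" where
  "quasinilpotent_on Y S \<longleftrightarrow>
     S \<in> bounded_ops Y \<and> (\<lambda>n. root n (onorm_on Y (S ^^ n))) \<longlonglongrightarrow> 0"

definition nilpotent_on :: "'a::complex_normed_vector set \<Rightarrow> ('a \<Rightarrow> 'a) \<Rightarrow> bool" where
  "nilpotent_on Y S \<longleftrightarrow> S \<in> bounded_ops Y \<and> (\<exists>n. \<forall>x\<in>Y. (S ^^ n) x = 0)"

definition Kato_on :: "'a::complex_normed_vector set \<Rightarrow> ('a \<Rightarrow> 'a) \<Rightarrow> bool" where
  "Kato_on Y S \<longleftrightarrow>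
     S \<in> bounded_ops Y \<and> closed (S ` Y) \<and> (\<forall>n. ker_on Y S \<subseteq> (S ^^ n) ` Y)"

definition gDR :: "nat \<Rightarrow> ('a::complex_normed_vector \<Rightarrow> 'a) set" where
  "gDR i = {T \<in> bounded_ops UNIV. \<exists>(M, N) \<in> Red T. T \<in> R_class i M \<and> quasinilpotent_on N T}"

definition DR :: "nat \<Rightarrow> ('a::complex_normed_vector \<Rightarrow> 'a) set" where
  "DR i = {T \<in> bounded_ops UNIV. \<exists>(M, N) \<in> Red T. T \<in> R_class i M \<and> nilpotent_on N T}"

definition generalized_Kato_decomposition :: "('a::complex_normed_vector \<Rightarrow> 'a) \<Rightarrow> bool" where
  "generalized_Kato_decomposition T \<longleftrightarrow>
     (\<exists>(M, N) \<in> Red T. Kato_on M T \<and> quasinilpotent_on N T)"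

definition Kato_type :: "('a::complex_normed_vector \<Rightarrow> 'a) \<Rightarrow> bool" where
  "Kato_type T \<longleftrightarrow> (\<exists>(M, N) \<in> Red T. Kato_on M T \<and> nilpotent_on N T)"

end

theory Submission
  imports Defs
begin

text \<open>
  Let \<open>T\<close> be Kato on \<open>M\<close>. On the core \<open>\<Inter>n. T\<^sup>n M\<close> the operators \<open>T - \<mu>\<close> are onto, and modulo the
  core they are bounded below, both with constants independent of \<open>\<mu>\<close> in a disc about \<open>0\<close>. Therefore
  the set of those \<open>\<mu>\<close> in the disc for which the nullity (or the defect) of \<open>T - \<mu>\<close> is at least
  \<open>m\<close> is both open and closed, and both numbers are constant on the disc. If \<open>0\<close> is a boundary
  point of the spectrum, the disc contains some \<open>\<mu>\<close> with \<open>T - \<mu>\<close> in the class. On a quasinilpotent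
  summand \<open>T - \<mu>\<close> is invertible, so membership in the class descends to the Kato summand, first at
  \<open>\<mu>\<close> and then at \<open>0\<close>; finite ascent (descent) at \<open>\<mu>\<close> even forces injectivity (surjectivity) there.

  Conversely all twelve classes consist of semi-Fredholm operators, and those have Kato's
  decomposition: a kernel vector outside some \<open>T\<^sup>n M\<close> ends a chain that splits off as a Jordan block,
  and each such block lowers the nullity and the defect. The nilpotent blocks are absorbed into the
  (quasi)nilpotent summand.
\<close>

subsection \<open>Open mappings, perturbation of surjections, sublinear functionals\<close>

text \<open>Nullity and defect may be infinite, and this is why constancy on the disc rests on
  connectedness: a lower bound \<open>m\<close> is stable on a radius that depends on
  \<open>m\<close>, so local stability at \<open>0\<close> gives no common radius at an infinite
  value. The point \<mu> has to be nonzero, for only then is \<open>T - \<mu>\<close> guaranteed to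
  be invertible on the quasinilpotent summand. It is nonzero as soon as \<open>T\<close> lies
  outside the class; if \<open>T\<close> lies in the class, the whole space and \<open>{0}\<close>
  already form the required pair. Subspaces are sets, not types, and no quotient by the core is
  formed. Being bounded below modulo the core becomes: every vector of \<open>M\<close> is
  congruent, modulo the core, to one whose norm is controlled by the image. In the same way bounded
  preimages stand in for inverses throughout, and all of them come from one iteration.\<close>

text \<open>Residuals shrink by the factor \<open>q\<close>, so the successive corrections form a
  geometrically bounded series in the closed subspace \<open>S\<close>, whose sum is an exact
  preimage. \<open>Y\<close> is any set stable under passing to residuals: the range in the open
  mapping theorem, the closure of the range when a range is shown to be closed.\<close>

lemma surj_by_approximation:
  fixes g :: "'b::banach \<Rightarrow> 'c::real_normed_vector"
  assumes g: "bounded_linear g" and S: "closed S" "subspace S"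
    and C: "0 \<le> C" and q: "0 \<le> q" "q < 1"
    and approx: "\<And>y. y \<in> Y \<Longrightarrow> \<exists>x\<in>S. norm x \<le> C * norm y \<and> y - g x \<in> Y \<and> norm (y - g x) \<le> q * norm y"
    and y: "y \<in> Y"
  shows "\<exists>x\<in>S. g x = y \<and> norm x \<le> C / (1 - q) * norm y"
proof -
  obtain h where h: "\<And>y. y \<in> Y \<Longrightarrow> h y \<in> S \<and> norm (h y) \<le> C * norm y \<and> y - g (h y) \<in> Y \<and> norm (y - g (h y)) \<le> q * norm y"
    using approx by metis
  define r where "r = rec_nat y (\<lambda>_ z. z - g (h z))"
  have r0: "r 0 = y" and rS: "r (Suc n) = r n - g (h (r n))" for n
    by (simp_all add: r_def)
  have rY: "r n \<in> Y \<and> norm (r n) \<le> q ^ n * norm y" for n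
  proof (induction n)
    case 0 then show ?case using y r0 by simp
  next
    case (Suc n)
    then have "norm (r (Suc n)) \<le> q * norm (r n)" "r (Suc n) \<in> Y" using h rS by auto
    moreover have "q * norm (r n) \<le> q * (q ^ n * norm y)"
      using Suc q(1) by (intro mult_left_mono) auto
    ultimately show ?case by (simp add: mult.assoc)
  qed
  define x where "x n = h (r n)" for n
  have xS: "x n \<in> S" for n using h rY by (simp add: x_def)
  have xn: "norm (x n) \<le> C * norm y * q ^ n" for n
  proof -
    have "norm (x n) \<le> C * norm (r n)" using h rY by (simp add: x_def)
    also have "\<dots> \<le> C * (q ^ n * norm y)" using rY C by (intro mult_left_mono) auto
    finally show ?thesis by (simp add: mult_ac)
  qed
  have sg: "(\<lambda>n. C * norm y * q ^ n) sums (C * norm y * (1 / (1 - q)))"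
    using q by (intro sums_mult[OF geometric_sums]) auto
  have sn: "summable (\<lambda>n. norm (x n))"
    by (rule summable_comparison_test'[OF sums_summable[OF sg], of 0]) (simp add: xn)
  have sx: "summable x" by (rule summable_norm_cancel[OF sn])
  have "norm (suminf x) \<le> (\<Sum>n. norm (x n))" by (rule summable_norm[OF sn])
  also have "\<dots> \<le> (\<Sum>n. C * norm y * q ^ n)"
    by (rule suminf_le[OF xn sn sums_summable[OF sg]])
  also have "\<dots> = C / (1 - q) * norm y" using sg by (simp add: sums_iff)
  finally have n: "norm (suminf x) \<le> C / (1 - q) * norm y" .
  have "suminf x \<in> S"
  proof (rule closed_sequentially[OF S(1)])
    show "(\<lambda>n. \<Sum>i<n. x i) \<longlonglongrightarrow> suminf x" using sx by (rule summable_LIMSEQ)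
    show "(\<Sum>i<n. x i) \<in> S" for n using xS S(2) by (intro subspace_sum) auto
  qed
  moreover have "g (suminf x) = y"
  proof (rule sums_unique2)
    show "(\<lambda>n. g (x n)) sums g (suminf x)"
      using bounded_linear.sums[OF g] sx by blast
    have "(\<lambda>n. q ^ n * norm y) \<longlonglongrightarrow> 0"
      by (rule tendsto_mult_left_zero[OF LIMSEQ_realpow_zero[OF q]])
    then have "r \<longlonglongrightarrow> 0" by (rule Lim_null_comparison[rotated]) (simp add: rY)
    from telescope_sums'[OF this] show "(\<lambda>n. g (x n)) sums y" by (simp add: rS r0 x_def)
  qed
  ultimately show ?thesis using n by blast
qed

text \<open>Baire's theorem in the closed, hence complete, image of \<open>S\<close> gives some
  \<open>A n\<close> interior points there; the approximate preimages so obtained are made exact by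
  the iteration.\<close>

lemma open_mapping_subspace:
  fixes f :: "'b::banach \<Rightarrow> 'c::banach"
  assumes f: "bounded_linear f" and S: "closed S" "subspace S" and cl: "closed (f ` S)"
  obtains C where "C > 0" "\<And>y. y \<in> f ` S \<Longrightarrow> \<exists>x\<in>S. f x = y \<and> norm x \<le> C * norm y"
proof -
  interpret f: bounded_linear f by fact
  define Y where "Y = f ` S"
  have Ysub: "subspace Y" unfolding Y_def using S(2) f.linear_axioms by (simp add: linear_subspace_image)
  define A where "A n = closure (f ` (S \<inter> cball 0 (real n)))" for n
  have AY: "A n \<subseteq> Y" for n unfolding A_def Y_def
    using cl by (intro closure_minimal) auto
  have "\<exists>n. (top_of_set Y) interior_of A n \<noteq> {}"
  proof (rule ccontr)
    assume "\<not> ?thesis"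
    then have e: "(top_of_set Y) interior_of A n = {}" for n by blast
    have c: "closedin (top_of_set Y) (A n)" for n
      using AY[of n] by (intro closed_subset) (auto simp: A_def)
    have "completely_metrizable_space (top_of_set Y)"
      using cl by (intro completely_metrizable_space_closedin[OF completely_metrizable_space_euclidean])
        (simp add: Y_def)
    then have "(top_of_set Y) interior_of \<Union>(range A) = {}"
      using e c by (intro Baire_category_alt disjI1) auto
    moreover have "\<Union>(range A) = Y"
    proof (intro antisym)
      show "\<Union>(range A) \<subseteq> Y" using AY by blast
      show "Y \<subseteq> \<Union>(range A)"
      proof
        fix y assume "y \<in> Y"
        then obtain x where x: "x \<in> S" "y = f x" unfolding Y_def by blast
        obtain n where "norm x \<le> real n" using real_arch_simple by blast
        then have "y \<in> A n" unfolding A_def using x closure_subset by force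
        then show "y \<in> \<Union>(range A)" by blast
      qed
    qed
    moreover have "0 \<in> Y" using Ysub by (rule subspace_0)
    ultimately show False using interior_of_topspace[of "top_of_set Y"] by simp
  qed
  then obtain n U y0 where U: "openin (top_of_set Y) U" "U \<subseteq> A n" "y0 \<in> U"
    unfolding interior_of_def by blast
  have "y0 \<in> Y" using U AY by blast
  obtain e where e: "e > 0" "ball y0 e \<inter> Y \<subseteq> U"
    using U(1,3) unfolding openin_contains_ball by blast
  \<comment> \<open>A small vector is the difference of \<open>y0 + y\<close> and \<open>y0\<close>,
    both limits of images of vectors of norm at most \<open>n\<close>; hence the radius
    \<open>2 * n\<close>.\<close>
  have small: "y \<in> closure (f ` (S \<inter> cball 0 (2 * real n)))" if y: "y \<in> Y" "norm y < e" for y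
  proof -
    have "y0 + y \<in> A n" "y0 \<in> A n"
      using U e y \<open>y0 \<in> Y\<close> subspace_add[OF Ysub] by (auto simp: dist_norm subset_iff)
    then obtain u v where u: "\<And>k. u k \<in> f ` (S \<inter> cball 0 (real n))" "u \<longlonglongrightarrow> y0 + y"
      and v: "\<And>k. v k \<in> f ` (S \<inter> cball 0 (real n))" "v \<longlonglongrightarrow> y0"
      unfolding A_def closure_sequential by blast
    have "u k - v k \<in> f ` (S \<inter> cball 0 (2 * real n))" for k
    proof -
      obtain a b where ab: "u k = f a" "v k = f b" "a \<in> S" "b \<in> S" "norm a \<le> n" "norm b \<le> n"
        using u(1)[of k] v(1)[of k] by auto
      have "norm (a - b) \<le> 2 * real n" using norm_triangle_ineq4[of a b] ab by linarith
      moreover have "u k - v k = f (a - b)" using ab by (simp add: f.diff)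
      ultimately show ?thesis using subspace_diff[OF S(2) ab(3,4)] by auto
    qed
    moreover have "(\<lambda>k. u k - v k) \<longlonglongrightarrow> (y0 + y) - y0" by (rule tendsto_diff[OF u(2) v(2)])
    ultimately show ?thesis unfolding closure_sequential by (intro exI[of _ "\<lambda>k. u k - v k"]) simp
  qed
  \<comment> \<open>Scaling by \<open>t\<close> gives \<open>y\<close> the norm
    \<open>e / 2\<close>. A preimage of norm at most \<open>2 * n\<close>, scaled back by
    \<open>1 / t = 2 * norm y / e\<close>, has norm at most \<open>4 * n / e * norm y\<close>, and
    the tolerance \<open>e / 4\<close> becomes \<open>norm y / 2\<close>.\<close>
  define C where "C = 4 * real n / e"
  have C0: "0 \<le> C" using e by (simp add: C_def)
  have approx: "\<exists>x\<in>S. norm x \<le> C * norm y \<and> y - f x \<in> Y \<and> norm (y - f x) \<le> 1 / 2 * norm y"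
    if y: "y \<in> Y" for y
  proof (cases "y = 0")
    case True
    then show ?thesis using subspace_0[OF S(2)] y by (intro bexI[of _ 0]) (auto simp: f.zero)
  next
    case False
    define t where "t = e / (2 * norm y)"
    have t: "t > 0" using e False by (simp add: t_def)
    have "t *\<^sub>R y \<in> closure (f ` (S \<inter> cball 0 (2 * real n)))"
      using e False y Ysub by (intro small) (auto simp: subspace_scale t_def)
    moreover have "e / 4 > 0" using e by simp
    ultimately have "\<exists>z\<in>f ` (S \<inter> cball 0 (2 * real n)). dist z (t *\<^sub>R y) < e / 4"
      unfolding closure_approachable by blast
    then obtain x where x: "x \<in> S" "norm x \<le> 2 * real n" "dist (f x) (t *\<^sub>R y) < e / 4" by auto
    show ?thesis
    proof (intro bexI[of _ "(1/t) *\<^sub>R x"] conjI)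
      show "(1/t) *\<^sub>R x \<in> S" using x S by (simp add: subspace_scale)
      then show "y - f ((1/t) *\<^sub>R x) \<in> Y" using y Ysub by (intro subspace_diff) (auto simp: Y_def)
      show "norm ((1/t) *\<^sub>R x) \<le> C * norm y"
        using x e t False by (simp add: C_def t_def field_simps)
      have "y - f ((1/t) *\<^sub>R x) = (1/t) *\<^sub>R (t *\<^sub>R y - f x)"
        using t by (simp add: f.scale scaleR_diff_right)
      then have "norm (y - f ((1/t) *\<^sub>R x)) = (1/t) * norm (t *\<^sub>R y - f x)" using t by simp
      also have "\<dots> \<le> (1/t) * (e / 4)"
        using x(3) t by (intro mult_left_mono) (auto simp: dist_norm norm_minus_commute)
      also have "\<dots> = 1 / 2 * norm y" using e False by (simp add: t_def field_simps)
      finally show "norm (y - f ((1/t) *\<^sub>R x)) \<le> 1 / 2 * norm y" .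
    qed
  qed
  \<comment> \<open>The contraction factor \<open>1 / 2\<close> doubles \<open>C\<close>; the
    summand \<open>1\<close> keeps the constant positive when \<open>n = 0\<close>.\<close>
  have "\<exists>x\<in>S. f x = y \<and> norm x \<le> (2 * C + 1) * norm y" if yS: "y \<in> f ` S" for y
  proof -
    obtain x where "x \<in> S" "f x = y" "norm x \<le> C / (1 - 1 / 2) * norm y"
      using surj_by_approximation[OF f S C0 _ _ approx, where y = y] yS[folded Y_def] by auto
    moreover have "C / (1 - 1 / 2) * norm y \<le> (2 * C + 1) * norm y" by (intro mult_right_mono) auto
    ultimately show ?thesis by (intro bexI[of _ x]) auto
  qed
  moreover have "2 * C + 1 > 0" using C0 by simp
  ultimately show ?thesis by (rule that[rotated])
qed

text \<open>A preimage under \<open>f\<close> is an approximate one under \<open>g\<close> with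
  relative error \<open>C * d\<close>, at most \<open>1 / 2\<close>; the geometric series then costs
  the factor \<open>2\<close>.\<close>

lemma surj_perturbation:
  fixes f g :: "'b::banach \<Rightarrow> 'c::real_normed_vector"
  assumes g: "bounded_linear g" and S: "closed S" "subspace S"
    and Y: "subspace Y" "g ` S \<subseteq> Y"
    and C: "0 \<le> C" "\<And>y. y \<in> Y \<Longrightarrow> \<exists>x\<in>S. f x = y \<and> norm x \<le> C * norm y"
    and d: "0 \<le> d" "C * d \<le> 1 / 2" "\<And>x. x \<in> S \<Longrightarrow> norm (f x - g x) \<le> d * norm x"
    and y: "y \<in> Y"
  shows "\<exists>x\<in>S. g x = y \<and> norm x \<le> 2 * C * norm y"
proof -
  have "\<exists>x\<in>S. norm x \<le> C * norm y \<and> y - g x \<in> Y \<and> norm (y - g x) \<le> 1 / 2 * norm y" if "y \<in> Y" for y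
  proof -
    obtain x where x: "x \<in> S" "f x = y" "norm x \<le> C * norm y" using C(2) \<open>y \<in> Y\<close> by blast
    have "norm (y - g x) \<le> d * norm x" using d(3) x by auto
    also have "\<dots> \<le> d * (C * norm y)" using x d by (intro mult_left_mono) auto
    also have "\<dots> = (C * d) * norm y" by simp
    also have "\<dots> \<le> 1 / 2 * norm y" using d by (intro mult_right_mono) auto
    finally show ?thesis using x Y \<open>y \<in> Y\<close> by (intro bexI[of _ x]) (auto intro: subspace_diff)
  qed
  from surj_by_approximation[OF g S C(1) _ _ this, where y = y] y show ?thesis by (auto simp: mult_ac)
qed

lemma subspace_closure:
  fixes S :: "'b::real_normed_vector set"
  assumes "subspace S"
  shows "subspace (closure S)"
proof (rule subspaceI)
  show "0 \<in> closure S" using subspace_0[OF assms] closure_subset by blast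
  fix x y assume "x \<in> closure S" "y \<in> closure S"
  then obtain u v where "\<And>k. u k \<in> S" "u \<longlonglongrightarrow> x" "\<And>k. v k \<in> S" "v \<longlonglongrightarrow> y"
    unfolding closure_sequential by blast
  then have "\<And>k. u k + v k \<in> S" "(\<lambda>k. u k + v k) \<longlonglongrightarrow> x + y"
    using subspace_add[OF assms] by (auto intro: tendsto_add)
  then show "x + y \<in> closure S" unfolding closure_sequential by (intro exI[of _ "\<lambda>k. u k + v k"]) auto
next
  fix c x assume "x \<in> closure S"
  then obtain u where "\<And>k. u k \<in> S" "u \<longlonglongrightarrow> x"
    unfolding closure_sequential by blast
  then have "\<And>k. c *\<^sub>R u k \<in> S" "(\<lambda>k. c *\<^sub>R u k) \<longlonglongrightarrow> c *\<^sub>R x"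
    using subspace_scale[OF assms] by (auto intro: tendsto_scaleR)
  then show "c *\<^sub>R x \<in> closure S" unfolding closure_sequential by (intro exI[of _ "\<lambda>k. c *\<^sub>R u k"]) auto
qed

text \<open>The iteration runs on the closure of the range: a point of the closure is approximated
  within half its norm by a point of the range, which has a preimage controlled by its norm. So
  every limit point acquires a genuine preimage.\<close>

lemma closed_range_if_bounded_preimages:
  fixes f :: "'b::banach \<Rightarrow> 'c::real_normed_vector"
  assumes f: "bounded_linear f" and S: "closed S" "subspace S"
    and C: "0 \<le> C" "\<And>x. x \<in> S \<Longrightarrow> \<exists>v\<in>S. f v = f x \<and> norm v \<le> C * norm (f x)"
  shows "closed (f ` S)"
proof -
  interpret f: bounded_linear f by fact
  have sub: "subspace (f ` S)" using S(2) f.linear_axioms by (simp add: linear_subspace_image)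
  have subc: "subspace (closure (f ` S))" by (rule subspace_closure[OF sub])
  \<comment> \<open>An approximation within \<open>norm y / 2\<close> has norm at most
    \<open>2 * norm y\<close>, whence \<open>2 * C\<close>.\<close>
  have approx: "\<exists>x\<in>S. norm x \<le> (2 * C) * norm y \<and> y - f x \<in> closure (f ` S) \<and> norm (y - f x) \<le> 1 / 2 * norm y"
    if y: "y \<in> closure (f ` S)" for y
  proof (cases "y = 0")
    case True
    then show ?thesis using subspace_0[OF S(2)] y by (intro bexI[of _ 0]) (auto simp: f.zero)
  next
    case False
    then obtain w where w: "w \<in> S" "dist (f w) y < norm y / 2"
      using y unfolding closure_approachable
      by (metis (no_types, lifting) half_gt_zero_iff imageE zero_less_norm_iff)
    then obtain v where v: "v \<in> S" "f v = f w" "norm v \<le> C * norm (f w)" using C by blast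
    have "norm (f w) \<le> 2 * norm y" using w(2) norm_triangle_sub[of "f w" y] norm_ge_zero[of y] unfolding dist_norm by linarith
    then have "C * norm (f w) \<le> C * (2 * norm y)" using C by (intro mult_left_mono)
    moreover have "f v \<in> closure (f ` S)" by (rule subsetD[OF closure_subset imageI[OF v(1)]])
    ultimately show ?thesis using v w y subc
      by (intro bexI[of _ v]) (auto simp: dist_norm norm_minus_commute intro: subspace_diff)
  qed
  have "y \<in> f ` S" if "y \<in> closure (f ` S)" for y
    using surj_by_approximation[OF f S _ _ _ approx, where y = y] that C(1) by auto
  then show ?thesis by (simp add: subsetI flip: closure_subset_eq)
qed

section \<open>Hahn-Banach by minimal sublinear functionals\<close>

text \<open>\<open>q'\<close> lowers \<open>q\<close> along the ray through \<open>a\<close> and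
  stays sublinear. A minimal sublinear functional must equal its own lowering, and the last
  inequality then reads as superadditivity.\<close>

lemma sublinear_directional_infimum:
  fixes q :: "'v::real_vector \<Rightarrow> real" and a :: 'v
  assumes add: "\<And>x y. q (x + y) \<le> q x + q y" and sc: "\<And>t x. t \<ge> 0 \<Longrightarrow> q (t *\<^sub>R x) \<le> t * q x"
  obtains q' where "\<And>x y. q' (x + y) \<le> q' x + q' y" "\<And>t x. t \<ge> 0 \<Longrightarrow> q' (t *\<^sub>R x) \<le> t * q' x"
    "\<And>y. q' y \<le> q y" "\<And>y. q' y \<le> q (y + a) - q a"
proof -
  define q' where "q' y = (INF t\<in>{0..}. q (y + t *\<^sub>R a) - t * q a)" for y
  have bdd: "bdd_below ((\<lambda>t. q (y + t *\<^sub>R a) - t * q a) ` {0..})" for y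
  proof (rule bdd_belowI2[of _ "- q (- y)"])
    fix t :: real assume t: "t \<in> {0..}"
    show "- q (- y) \<le> q (y + t *\<^sub>R a) - t * q a"
    proof (cases "t = 0")
      case True
      have "q 0 \<le> q y + q (- y)" using add[of y "-y"] by simp
      moreover have "0 \<le> q 0" using add[of 0 0] by simp
      ultimately show ?thesis using True by simp
    next
      case False
      then have "t > 0" using t by simp
      then have "q a \<le> (1 / t) * q (t *\<^sub>R a)" using sc[of "1/t" "t *\<^sub>R a"] by simp
      then have "t * q a \<le> q (t *\<^sub>R a)" using \<open>t > 0\<close> by (simp add: field_simps)
      also have "\<dots> \<le> q (y + t *\<^sub>R a) + q (- y)" using add[of "y + t *\<^sub>R a" "- y"] by simp
      finally show ?thesis by simp
    qed
  qed
  have low: "q' y \<le> q (y + t *\<^sub>R a) - t * q a" if "t \<ge> 0" for y t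
    unfolding q'_def using that by (intro cINF_lower[OF bdd]) auto
  have great: "c \<le> q' y" if "\<And>t. t \<ge> 0 \<Longrightarrow> c \<le> q (y + t *\<^sub>R a) - t * q a" for c y
    unfolding q'_def using that by (intro cINF_greatest) auto
  have 3: "q' y \<le> q y" for y using low[of 0 y] by simp
  have 4: "q' y \<le> q (y + a) - q a" for y using low[of 1 y] by simp
  have 1: "q' (x + y) \<le> q' x + q' y" for x y
  proof -
    have *: "q' (x + y) - (q (y + s *\<^sub>R a) - s * q a) \<le> q' x" if s: "s \<ge> 0" for s
    proof (rule great)
      fix t :: real assume t: "t \<ge> 0"
      have "q' (x + y) \<le> q (x + y + (t + s) *\<^sub>R a) - (t + s) * q a" using low s t by simp
      also have "q (x + y + (t + s) *\<^sub>R a) \<le> q (x + t *\<^sub>R a) + q (y + s *\<^sub>R a)"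
        using add[of "x + t *\<^sub>R a" "y + s *\<^sub>R a"] by (simp add: algebra_simps)
      finally show "q' (x + y) - (q (y + s *\<^sub>R a) - s * q a) \<le> q (x + t *\<^sub>R a) - t * q a"
        by (simp add: algebra_simps)
    qed
    have "q' (x + y) - q' x \<le> q' y" using * by (intro great) (simp add: algebra_simps)
    then show ?thesis by simp
  qed
  have 2: "q' (t *\<^sub>R x) \<le> t * q' x" if t: "t \<ge> 0" for t x
  proof (cases "t = 0")
    case True
    have "q 0 \<le> 0" using sc[of 0 0] by simp
    then show ?thesis using True low[of 0 0] by simp
  next
    case False
    then have t: "t > 0" using t by simp
    have "q' (t *\<^sub>R x) / t \<le> q' x"
    proof (rule great)
      fix s :: real assume s: "s \<ge> 0"
      have "q' (t *\<^sub>R x) \<le> q (t *\<^sub>R x + (t * s) *\<^sub>R a) - (t * s) * q a" using low s t by simp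
      also have "q (t *\<^sub>R x + (t * s) *\<^sub>R a) \<le> t * q (x + s *\<^sub>R a)"
        using sc[of t "x + s *\<^sub>R a"] t by (simp add: scaleR_add_right)
      finally show "q' (t *\<^sub>R x) / t \<le> q (x + s *\<^sub>R a) - s * q a"
        using t by (simp add: field_simps)
    qed
    then show ?thesis using t by (simp add: field_simps)
  qed
  from that[OF 1 2 3 4] show ?thesis .
qed

text \<open>No functional is extended from a subspace: Zorn's lemma gives a minimal sublinear
  functional below \<open>p1\<close>, and minimality forces additivity. Starting from the lowering
  \<open>p1\<close> of \<open>p\<close> along \<open>a\<close> secures the value at
  \<open>a\<close>, since everything below it satisfies \<open>f (- a) \<le> - p a\<close>.\<close>

lemma hahn_banach_sublinear:
  fixes p :: "'v::real_vector \<Rightarrow> real" and a :: 'v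
  assumes add: "\<And>x y. p (x + y) \<le> p x + p y" and sc: "\<And>t x. t \<ge> 0 \<Longrightarrow> p (t *\<^sub>R x) \<le> t * p x"
  obtains f where "linear f" "\<And>x. f x \<le> p x" "f a = p a"
proof -
  define sl where "sl q \<longleftrightarrow> (\<forall>x y. q (x + y) \<le> q x + q y) \<and> (\<forall>t\<ge>0. \<forall>x. q (t *\<^sub>R x) \<le> t * q x)"
    for q :: "'v \<Rightarrow> real"
  obtain p1 where p1: "\<And>x y. p1 (x + y) \<le> p1 x + p1 y" "\<And>t x. t \<ge> 0 \<Longrightarrow> p1 (t *\<^sub>R x) \<le> t * p1 x"
    "\<And>y. p1 y \<le> p y" "\<And>y. p1 y \<le> p (y + a) - p a"
    using sublinear_directional_infimum[of p a, OF add sc] by metis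
  define A where "A = {q. sl q \<and> q \<le> p1}"
  have slneg: "- p1 (- x) \<le> q x" if "q \<in> A" for q x
  proof -
    have "q (x + - x) \<le> q x + q (- x)" "q (0 + 0) \<le> q 0 + q 0" "q (- x) \<le> p1 (- x)"
      using that unfolding A_def sl_def le_fun_def by blast+
    then show ?thesis by simp
  qed
  \<comment> \<open>Minimal elements are maximal for the reversed order. A chain is bounded by its
    pointwise infimum, which is finite because all members lie above
    \<open>- p1 (- x)\<close>.\<close>
  have "\<exists>m\<in>A. \<forall>b\<in>A. b \<le> m \<longrightarrow> b = m"
  proof (rule predicate_Zorn[where P = "\<lambda>b c. c \<le> b"])
    show "partial_order_on A (relation_of (\<lambda>b c. c \<le> b) A)"
      by (rule partial_order_on_relation_ofI) auto
  next
    fix Ch assume Ch: "Ch \<in> Chains (relation_of (\<lambda>b c. c \<le> b) A)"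
    then have ChA: "Ch \<subseteq> A" and tot: "\<And>b c. b \<in> Ch \<Longrightarrow> c \<in> Ch \<Longrightarrow> b \<le> c \<or> c \<le> b"
      unfolding Chains_def relation_of_def by auto
    show "\<exists>u\<in>A. \<forall>b\<in>Ch. u \<le> b"
    proof (cases "Ch = {}")
      case True
      have "p1 \<in> A" using p1 by (simp add: A_def sl_def)
      then show ?thesis using True by blast
    next
      case False
      define u where "u x = (INF q\<in>Ch. q x)" for x
      have bdd: "bdd_below ((\<lambda>q. q x) ` Ch)" for x
        using slneg ChA by (intro bdd_belowI2[of _ "- p1 (- x)"]) auto
      have low: "u x \<le> q x" if "q \<in> Ch" for q x
        unfolding u_def using that by (intro cINF_lower[OF bdd])
      have great: "c \<le> u x" if "\<And>q. q \<in> Ch \<Longrightarrow> c \<le> q x" for c x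
        unfolding u_def using that False by (intro cINF_greatest) auto
      have "u (x + y) \<le> u x + u y" for x y
      proof -
        have "u (x + y) - q1 x \<le> q2 y" if q: "q1 \<in> Ch" "q2 \<in> Ch" for q1 q2
        proof -
          obtain q where q': "q \<in> Ch" "q \<le> q1" "q \<le> q2" using tot[OF q] q by auto
          have "u (x + y) \<le> q (x + y)" by (rule low[OF q'(1)])
          also have "\<dots> \<le> q x + q y" using q' ChA unfolding A_def sl_def by blast
          also have "\<dots> \<le> q1 x + q2 y" using q' by (intro add_mono) (auto simp: le_fun_def)
          finally show ?thesis by simp
        qed
        then have "u (x + y) - q1 x \<le> u y" if "q1 \<in> Ch" for q1 using that by (intro great)
        then have "u (x + y) - u y \<le> u x" by (intro great) (simp add: algebra_simps)
        then show ?thesis by simp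
      qed
      moreover have "u (t *\<^sub>R x) \<le> t * u x" if t: "t \<ge> 0" for t x
      proof (cases "t = 0")
        case True
        obtain q where q: "q \<in> Ch" using False by blast
        then have "q (0 *\<^sub>R 0) \<le> 0 * q 0" using ChA unfolding A_def sl_def by blast
        then show ?thesis using True low[OF q, of 0] by simp
      next
        case False
        then have t: "t > 0" using t by simp
        have "u (t *\<^sub>R x) / t \<le> u x"
        proof (rule great)
          fix q assume q: "q \<in> Ch"
          then have "q (t *\<^sub>R x) \<le> t * q x" using ChA t unfolding A_def sl_def by auto
          then show "u (t *\<^sub>R x) / t \<le> q x" using low[OF q, of "t *\<^sub>R x"] t by (simp add: field_simps)
        qed
        then show ?thesis using t by (simp add: field_simps)
      qed
      moreover have "u \<le> p1"
      proof -
        obtain q where q: "q \<in> Ch" using False by blast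
        then have "q \<le> p1" using ChA unfolding A_def by blast
        then show ?thesis using low[OF q] by (meson le_funI le_funD order_trans)
      qed
      ultimately have "u \<in> A" by (simp add: A_def sl_def)
      then show ?thesis using low by (auto simp: le_fun_def)
    qed
  qed
  then obtain f where fA: "f \<in> A" and fmin: "\<And>b. b \<in> A \<Longrightarrow> b \<le> f \<Longrightarrow> b = f" by blast
  have fadd: "f (x + y) \<le> f x + f y" and fsc: "t \<ge> 0 \<Longrightarrow> f (t *\<^sub>R x) \<le> t * f x" for x y t
    using fA unfolding A_def sl_def by blast+
  have fp1: "f x \<le> p1 x" for x using fA unfolding A_def le_fun_def by blast
  have f_add: "f (x + y) = f x + f y" for x y
  proof -
    obtain q where q: "\<And>x y. q (x + y) \<le> q x + q y" "\<And>t x. t \<ge> 0 \<Longrightarrow> q (t *\<^sub>R x) \<le> t * q x"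
      "\<And>z. q z \<le> f z" "\<And>z. q z \<le> f (z + y) - f y"
      using sublinear_directional_infimum[of f y, OF fadd fsc] by metis
    have "q \<le> f" using q(3) by (simp add: le_fun_def)
    moreover have "q \<le> p1" using q(3) fp1 order_trans unfolding le_fun_def by blast
    then have "q \<in> A" using q(1,2) by (simp add: A_def sl_def)
    ultimately have "q = f" using fmin by blast
    then have "f x \<le> f (x + y) - f y" using q(4) by blast
    then show ?thesis using fadd[of x y] by simp
  qed
  have f0: "f 0 = 0" using f_add[of 0 0] by simp
  have f_minus: "f (- x) = - f x" for x using f_add[of x "- x"] f0 by simp
  have f_pos: "f (t *\<^sub>R x) = t * f x" if "t \<ge> 0" for t x
    using fsc[OF that, of x] fsc[OF that, of "- x"] by (simp add: f_minus)
  have "f (t *\<^sub>R x) = t * f x" for t x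
  proof (cases "t \<ge> 0")
    case False
    then show ?thesis using f_pos[of "- t" x] f_minus[of "t *\<^sub>R x"] by simp
  qed (rule f_pos)
  then have lin: "linear f" using f_add by (intro linearI) auto
  have fp: "f x \<le> p x" for x using fp1 p1(3) order_trans by blast
  have "f (- a) \<le> p1 (- a)" by (rule fp1)
  also have "\<dots> \<le> p 0 - p a" using p1(4)[of "- a"] by simp
  also have "p 0 \<le> 0" using sc[of 0 0] by simp
  finally have "p a \<le> f a" by (simp add: f_minus)
  then show ?thesis using that[OF lin fp] fp[of a] by simp
qed

subsection \<open>Dual functionals and dimension counts\<close>

lemma csubspace_imp_subspace: "csubspace S \<Longrightarrow> subspace S"
  unfolding complex_vector.subspace_def subspace_def by (metis scaleC_of_real)

definition cfunctional :: "('a::complex_normed_vector \<Rightarrow> complex) \<Rightarrow> bool" where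
  "cfunctional \<phi> \<longleftrightarrow> bounded_linear \<phi> \<and> (\<forall>c x. \<phi> (c *\<^sub>C x) = c * \<phi> x)"

lemma cfunctional_simps:
  assumes "cfunctional \<phi>"
  shows "\<phi> 0 = 0" "\<phi> (x + y) = \<phi> x + \<phi> y" "\<phi> (x - y) = \<phi> x - \<phi> y" "\<phi> (c *\<^sub>C x) = c * \<phi> x"
    "\<phi> (sum h A) = (\<Sum>a\<in>A. \<phi> (h a))"
proof -
  interpret bounded_linear \<phi> using assms by (simp add: cfunctional_def)
  show "\<phi> 0 = 0" "\<phi> (x + y) = \<phi> x + \<phi> y" "\<phi> (x - y) = \<phi> x - \<phi> y"
    "\<phi> (sum h A) = (\<Sum>a\<in>A. \<phi> (h a))"
    by (rule zero add diff sum)+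
  show "\<phi> (c *\<^sub>C x) = c * \<phi> x" using assms by (simp add: cfunctional_def)
qed

text \<open>The distance to \<open>Z\<close> is the seminorm of the quotient by \<open>Z\<close>,
  pulled back to the whole space; it serves as the majorant for the separating functional.\<close>

lemma infdist_csubspace:
  fixes Z :: "'a::complex_normed_vector set"
  assumes Z: "csubspace Z"
  shows "infdist (x + y) Z \<le> infdist x Z + infdist y Z" "infdist (c *\<^sub>C x) Z \<le> cmod c * infdist x Z"
    "infdist x Z \<le> norm x"
proof -
  have 0: "0 \<in> Z" using Z by (rule complex_vector.subspace_0)
  then have ne: "Z \<noteq> {}" by blast
  have great: "t \<le> infdist w Z" if "\<And>z. z \<in> Z \<Longrightarrow> t \<le> dist w z" for t w
    using ne that by (simp add: infdist_notempty cINF_greatest)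
  have *: "infdist (x + y) Z - dist y z \<le> infdist x Z" if z: "z \<in> Z" for z
  proof (rule great)
    fix z' assume z': "z' \<in> Z"
    have "infdist (x + y) Z \<le> dist (x + y) (z' + z)"
      using complex_vector.subspace_add[OF Z z' z] by (rule infdist_le)
    also have "\<dots> \<le> dist x z' + dist y z" by (rule dist_triangle_add)
    finally show "infdist (x + y) Z - dist y z \<le> dist x z'" by simp
  qed
  have "infdist (x + y) Z - infdist x Z \<le> infdist y Z"
    using * by (intro great) (simp add: algebra_simps)
  then show "infdist (x + y) Z \<le> infdist x Z + infdist y Z" by simp
  show "infdist x Z \<le> norm x" using infdist_le[OF 0, of x] by simp
  show "infdist (c *\<^sub>C x) Z \<le> cmod c * infdist x Z"
  proof (cases "c = 0")
    case True
    then show ?thesis using 0 by simp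
  next
    case False
    have "infdist (c *\<^sub>C x) Z / cmod c \<le> infdist x Z"
    proof (rule great)
      fix z assume z: "z \<in> Z"
      have "infdist (c *\<^sub>C x) Z \<le> dist (c *\<^sub>C x) (c *\<^sub>C z)"
        using complex_vector.subspace_scale[OF Z z] by (rule infdist_le)
      also have "\<dots> = cmod c * dist x z"
        by (simp add: dist_norm norm_scaleC flip: complex_vector.scale_right_diff_distrib)
      finally show "infdist (c *\<^sub>C x) Z / cmod c \<le> dist x z"
        using False by (simp add: field_simps)
    qed
    then show ?thesis using False by (simp add: field_simps)
  qed
qed

text \<open>A real functional dominated by the distance to \<open>Z\<close>, with equality at
  \<open>x\<close>, vanishes on \<open>Z\<close> and is nonzero at \<open>x\<close>; it is
  complexified and normalised at \<open>x\<close>.\<close>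

lemma separating_cfunctional:
  fixes Z :: "'a::complex_normed_vector set"
  assumes Z: "closed Z" "csubspace Z" and x: "x \<notin> Z"
  obtains \<phi> where "cfunctional \<phi>" "\<And>z. z \<in> Z \<Longrightarrow> \<phi> z = 0" "\<phi> x = 1"
proof -
  define p where "p y = infdist y Z" for y
  have 0: "0 \<in> Z" using Z(2) by (rule complex_vector.subspace_0)
  have p0: "p z = 0" if "z \<in> Z" for z using that by (simp add: p_def)
  have pn: "p y \<le> norm y" for y unfolding p_def by (rule infdist_csubspace(3)[OF Z(2)])
  have pminus: "p (- y) \<le> p y" for y
    using infdist_csubspace(2)[OF Z(2), of "-1" y] by (simp add: p_def)
  have "p (t *\<^sub>R y) \<le> t * p y" if "t \<ge> 0" for t y
    using infdist_csubspace(2)[OF Z(2), of "complex_of_real t" y] that by (simp add: p_def scaleC_of_real)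
  moreover have "p (y + y') \<le> p y + p y'" for y y'
    unfolding p_def by (rule infdist_csubspace(1)[OF Z(2)])
  ultimately obtain f where f: "linear f" "\<And>y. f y \<le> p y" "f x = p x"
    using hahn_banach_sublinear[of p x] by metis
  interpret f: linear f by fact
  have fabs: "\<bar>f y\<bar> \<le> p y" for y
    using f(2)[of y] f(2)[of "- y"] pminus[of y] f.neg[of y] by linarith
  \<comment> \<open>The usual complexification: \<open>f y\<close> minus \<i> times the value of
    \<open>f\<close> at \<i> times \<open>y\<close>.\<close>
  define g where "g y = Complex (f y) (- f (\<i> *\<^sub>C y))" for y
  have g_add: "g (y + y') = g y + g y'" for y y'
    by (simp add: g_def complex_eq_iff f.add complex_vector.scale_right_distrib)
  have g_scale: "g (c *\<^sub>C y) = c * g y" for c y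
  proof -
    have c: "f (c *\<^sub>C y) = Re c * f y + Im c * f (\<i> *\<^sub>C y)" for c y
    proof -
      have "c *\<^sub>C y = complex_of_real (Re c) *\<^sub>C y + complex_of_real (Im c) *\<^sub>C \<i> *\<^sub>C y"
        using complex_eq[of c]
        by (metis complex_vector.scale_left_distrib complex_vector.scale_scale mult.commute)
      then show ?thesis by (simp add: scaleC_of_real f.add f.scale del: complex_vector.scale_scale)
    qed
    show ?thesis unfolding g_def complex_vector.scale_scale
      by (simp add: complex_eq_iff c[of c] c[of "\<i> * c"])
  qed
  have g_bd: "norm (g y) \<le> norm y * 2" for y
  proof -
    have "norm (g y) \<le> \<bar>f y\<bar> + \<bar>f (\<i> *\<^sub>C y)\<bar>" unfolding g_def using cmod_le[of "Complex (f y) (- f (\<i> *\<^sub>C y))"] by simp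
    also have "\<dots> \<le> norm y + norm (\<i> *\<^sub>C y)" using fabs pn order_trans by (intro add_mono) blast+
    finally show ?thesis by (simp add: norm_scaleC)
  qed
  have g: "cfunctional g"
    unfolding cfunctional_def
  proof (intro conjI allI g_scale)
    show "bounded_linear g"
    proof (rule bounded_linear_intro[OF g_add _ g_bd])
      show "g (r *\<^sub>R y) = r *\<^sub>R g y" for r y
        using g_scale[of "complex_of_real r" y] by (simp add: scaleC_of_real scaleR_conv_of_real)
    qed
  qed
  have "p x \<noteq> 0" using in_closed_iff_infdist_zero[OF Z(1), of x] 0 x unfolding p_def by blast
  then have gx: "g x \<noteq> 0" using f(3) by (simp add: g_def complex_eq_iff)
  have gz: "g z = 0" if "z \<in> Z" for z
    using fabs[of z] fabs[of "\<i> *\<^sub>C z"] p0[OF that] p0[OF complex_vector.subspace_scale[OF Z(2) that, of \<i>]]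
    by (simp add: g_def complex_eq_iff)
  show ?thesis
  proof (rule that[of "\<lambda>y. g y / g x"])
    show "cfunctional (\<lambda>y. g y / g x)"
      using g unfolding cfunctional_def by (auto intro: bounded_linear_compose[OF bounded_linear_divide])
  qed (use gx gz in auto)
qed

text \<open>One vector \<open>x\<close> at a time: a functional vanishing on the closed span with
  value \<open>1\<close> at \<open>x\<close> reads off the coefficient of \<open>x\<close>, so the
  larger span is the preimage of the smaller one under a continuous map.\<close>

lemma closed_cspan_Un_finite:
  fixes Z :: "'a::complex_normed_vector set"
  assumes Z: "closed Z" "csubspace Z" and "finite F"
  shows "closed (cspan (Z \<union> F))"
  using \<open>finite F\<close>
proof (induction F rule: finite_induct)
  case empty
  then show ?case using Z by (simp add: complex_vector.span_eq_iff[THEN iffD2])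
next
  case (insert x F)
  let ?Z = "cspan (Z \<union> F)"
  show ?case
  proof (cases "x \<in> ?Z")
    case True
    then show ?thesis using insert.IH by (simp add: complex_vector.span_redundant)
  next
    case False
    obtain \<phi> where \<phi>: "cfunctional \<phi>" "\<And>z. z \<in> ?Z \<Longrightarrow> \<phi> z = 0" "\<phi> x = 1"
      using separating_cfunctional[OF insert.IH complex_vector.subspace_span False] by blast
    have "y - \<phi> y *\<^sub>C x \<in> ?Z" if "y - k *\<^sub>C x \<in> ?Z" for y k
      using \<phi>(2)[OF that] that \<phi>(1,3) by (simp add: cfunctional_simps)
    then have "cspan (Z \<union> insert x F) = (\<lambda>y. y - \<phi> y *\<^sub>C x) -` ?Z"
      by (auto simp: complex_vector.span_insert)
    moreover have "continuous_on UNIV (\<lambda>y. y - \<phi> y *\<^sub>C x)"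
    proof (intro continuous_on_diff continuous_on_id)
      have "bounded_linear (\<lambda>c. c *\<^sub>C x)"
        by (rule bounded_linear_intro[of _ "norm x"])
          (auto simp: complex_vector.scale_left_distrib norm_scaleC scaleC_of_real[symmetric]
            complex_vector.scale_scale scaleR_conv_of_real)
      moreover have "bounded_linear \<phi>" using \<phi>(1) by (simp add: cfunctional_def)
      ultimately show "continuous_on UNIV (\<lambda>y. \<phi> y *\<^sub>C x)"
        using bounded_linear_compose linear_continuous_on by blast
    qed
    ultimately show ?thesis using insert.IH by (simp add: closed_vimage)
  qed
qed

lemma closed_cspan_finite: "finite F \<Longrightarrow> closed (cspan (F :: 'a::complex_normed_vector set))"
  using closed_cspan_Un_finite[of "{0}" F] by (simp add: complex_vector.subspace_single_0)

text \<open>For a subspace \<open>Z\<close> this says that the cosets of the members of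
  \<open>B\<close> are distinct and independent in the quotient, so codimensions can be bounded from
  below without forming it.\<close>

definition indep_mod :: "'a::complex_normed_vector set \<Rightarrow> 'a set \<Rightarrow> bool" where
  "indep_mod Z B \<longleftrightarrow> (\<forall>b\<in>B. b \<notin> cspan (Z \<union> (B - {b})))"

lemma indep_mod_0: "indep_mod {0} B \<longleftrightarrow> \<not> cdependent B"
  by (simp add: indep_mod_def complex_vector.dependent_def)

lemma indep_mod_mono: "indep_mod Z B \<Longrightarrow> Z' \<subseteq> Z \<Longrightarrow> B' \<subseteq> B \<Longrightarrow> indep_mod Z' B'"
  unfolding indep_mod_def
  by (meson Diff_mono Un_mono complex_vector.span_mono order_refl subsetD)

lemma indep_mod_insert:
  assumes "indep_mod Z B" "x \<notin> cspan (Z \<union> B)"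
  shows "indep_mod Z (insert x B)"
  unfolding indep_mod_def
proof
  fix b assume b: "b \<in> insert x B"
  have xB: "x \<notin> B" using assms(2) complex_vector.span_base by blast
  show "b \<notin> cspan (Z \<union> (insert x B - {b}))"
  proof (cases "b = x")
    case True
    then show ?thesis using assms(2) xB by (simp add: insert_Diff_if)
  next
    case False
    then have bB: "b \<in> B" using b by blast
    show ?thesis
    proof
      assume "b \<in> cspan (Z \<union> (insert x B - {b}))"
      moreover have "Z \<union> (insert x B - {b}) = insert x (Z \<union> (B - {b}))" using False by blast
      ultimately have "b \<in> cspan (insert x (Z \<union> (B - {b})))" by simp
      moreover have "b \<notin> cspan (Z \<union> (B - {b}))" using assms(1) bB by (simp add: indep_mod_def)
      ultimately have "x \<in> cspan (insert b (Z \<union> (B - {b})))" by (rule complex_vector.in_span_insert)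
      moreover have "insert b (Z \<union> (B - {b})) = Z \<union> B" using bB by blast
      ultimately show False using assms(2) by simp
    qed
  qed
qed

lemma indep_modI:
  assumes R: "csubspace R" and B: "finite B"
    and c: "\<And>c. (\<Sum>b\<in>B. c b *\<^sub>C b) \<in> R \<Longrightarrow> \<forall>b\<in>B. c b = 0"
  shows "indep_mod R B"
  unfolding indep_mod_def
proof (intro ballI notI)
  fix b assume b: "b \<in> B" "b \<in> cspan (R \<union> (B - {b}))"
  then obtain r s where rs: "b = r + s" "r \<in> cspan R" "s \<in> cspan (B - {b})"
    unfolding complex_vector.span_Un by blast
  have r: "r \<in> R" using rs(2) R by (simp add: complex_vector.span_eq_iff[THEN iffD2])
  obtain u where u: "s = (\<Sum>a\<in>B - {b}. u a *\<^sub>C a)"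
    using rs(3) B by (auto simp: complex_vector.span_finite)
  define c where "c a = (if a = b then 1 else - u a)" for a
  have "(\<Sum>a\<in>B. c a *\<^sub>C a) = b + (\<Sum>a\<in>B - {b}. c a *\<^sub>C a)"
    using b B by (simp add: sum.remove c_def)
  also have "(\<Sum>a\<in>B - {b}. c a *\<^sub>C a) = - s"
    unfolding u sum_negf[symmetric] by (intro sum.cong) (auto simp: c_def)
  also have "b + - s = r" using rs(1) by simp
  finally have "\<forall>b\<in>B. c b = 0" using c r by simp
  then show False using b by (auto simp: c_def)
qed

text \<open>The span of \<open>Z\<close> and the other members of \<open>B\<close> is closed because
  \<open>B\<close> is finite, so each \<open>b\<close> can be separated from it. One bound
  \<open>K\<close> is shared by all functionals to make later estimates uniform over
  \<open>B\<close>.\<close>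

lemma dual_functionals:
  fixes Z :: "'a::complex_normed_vector set"
  assumes Z: "closed Z" "csubspace Z" and B: "finite B" "indep_mod Z B"
  obtains \<phi> K where "\<And>b. b \<in> B \<Longrightarrow> cfunctional (\<phi> b)" "\<And>b z. b \<in> B \<Longrightarrow> z \<in> Z \<Longrightarrow> \<phi> b z = 0"
    "\<And>a b. a \<in> B \<Longrightarrow> b \<in> B \<Longrightarrow> \<phi> a b = (if a = b then 1 else 0)"
    "K > 0" "\<And>b x. b \<in> B \<Longrightarrow> cmod (\<phi> b x) \<le> K * norm x"
proof -
  have "\<exists>\<phi>. cfunctional \<phi> \<and> (\<forall>z\<in>cspan (Z \<union> (B - {b})). \<phi> z = 0) \<and> \<phi> b = 1" if "b \<in> B" for b
  proof -
    have "closed (cspan (Z \<union> (B - {b})))" using Z B by (intro closed_cspan_Un_finite) auto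
    moreover have "b \<notin> cspan (Z \<union> (B - {b}))" using B that by (simp add: indep_mod_def)
    ultimately show ?thesis using separating_cfunctional complex_vector.subspace_span by metis
  qed
  then obtain \<phi> where \<phi>: "\<And>b. b \<in> B \<Longrightarrow> cfunctional (\<phi> b)" "\<And>b. b \<in> B \<Longrightarrow> \<phi> b b = 1"
    "\<And>b z. b \<in> B \<Longrightarrow> z \<in> cspan (Z \<union> (B - {b})) \<Longrightarrow> \<phi> b z = 0"
    by metis
  define K where "K = (\<Sum>b\<in>B. onorm (\<phi> b)) + 1"
  have bl: "bounded_linear (\<phi> b)" if "b \<in> B" for b using \<phi>(1)[OF that] by (simp add: cfunctional_def)
  have nn: "0 \<le> onorm (\<phi> b)" if "b \<in> B" for b using onorm_pos_le[OF bl[OF that]] .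
  have le: "onorm (\<phi> b) \<le> K" if "b \<in> B" for b
    using member_le_sum[OF that, of "\<lambda>b. onorm (\<phi> b)"] nn B by (simp add: K_def)
  show ?thesis
  proof (rule that[of \<phi> K])
    show "\<phi> b z = 0" if "b \<in> B" "z \<in> Z" for b z
      using that by (intro \<phi>(3)) (auto intro: complex_vector.span_base)
    show "\<phi> a b = (if a = b then 1 else 0)" if "a \<in> B" "b \<in> B" for a b
      using that \<phi>(2) by (auto intro!: \<phi>(3) complex_vector.span_base)
    show "K > 0" using sum_nonneg[of B "\<lambda>b. onorm (\<phi> b)"] nn by (simp add: K_def)
    show "cmod (\<phi> b x) \<le> K * norm x" if "b \<in> B" for b x
      using onorm[OF bl[OF that], of x] mult_right_mono[OF le[OF that], of "norm x"] by simp
  qed (rule \<phi>(1))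
qed

text \<open>Injectivity is part of the conclusion so that the image keeps the cardinality of
  \<open>B\<close>, which is what dimension counts compare.\<close>

lemma independent_family:
  assumes B: "finite B" and c: "\<And>c. (\<Sum>b\<in>B. c b *\<^sub>C g b) = 0 \<Longrightarrow> \<forall>b\<in>B. c b = 0"
  shows "inj_on g B" "\<not> cdependent (g ` B)"
proof -
  show inj: "inj_on g B"
  proof (rule inj_onI, rule ccontr)
    fix a b assume ab: "a \<in> B" "b \<in> B" "g a = g b" "a \<noteq> b"
    define c where "c x = (if x = a then 1 else if x = b then - 1 else 0 :: complex)" for x
    have "(\<Sum>x\<in>B. c x *\<^sub>C g x) = (\<Sum>x\<in>{a,b}. c x *\<^sub>C g x)"
      using ab B by (intro sum.mono_neutral_right) (auto simp: c_def)
    also have "\<dots> = 0" using ab by (simp add: c_def)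
    finally have "c a = 0" using c ab by blast
    then show False by (simp add: c_def)
  qed
  show "\<not> cdependent (g ` B)"
  proof (rule complex_vector.independent_if_scalars_zero)
    fix f x assume *: "(\<Sum>x\<in>g ` B. f x *\<^sub>C x) = 0" "x \<in> g ` B"
    have "(\<Sum>b\<in>B. f (g b) *\<^sub>C g b) = 0" using * inj by (simp add: sum.reindex)
    then have "\<forall>b\<in>B. f (g b) = 0" by (rule c[of "\<lambda>b. f (g b)"])
    then show "f x = 0" using * by blast
  qed (use B in simp)
qed

lemma finite_max_coefficient:
  fixes c :: "'b \<Rightarrow> complex"
  assumes "finite B" "\<not> (\<forall>b\<in>B. c b = 0)"
  obtains b where "b \<in> B" "c b \<noteq> 0" "\<And>a. a \<in> B \<Longrightarrow> cmod (c a) \<le> cmod (c b)"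
proof -
  have ne: "(cmod \<circ> c) ` B \<noteq> {}" using assms by auto
  then have "Max ((cmod \<circ> c) ` B) \<in> (cmod \<circ> c) ` B" using assms by (intro Max_in) auto
  then obtain b where b: "b \<in> B" "cmod (c b) = Max ((cmod \<circ> c) ` B)" by auto
  have max: "cmod (c a) \<le> cmod (c b)" if "a \<in> B" for a
    unfolding b(2) using that assms(1) by (intro Max_ge) auto
  moreover have "c b \<noteq> 0" using assms(2) max by force
  ultimately show ?thesis using b(1) that by blast
qed

section \<open>Dimension and codimension counted by finite independent families\<close>

text \<open>Lower bounds witnessed by finite families treat finite and infinite dimension alike, and
  a finite family can be perturbed.\<close>

lemma ecdim_ge_iff:
  assumes V: "csubspace V"
  shows "enat m \<le> ecdim V \<longleftrightarrow> (\<exists>B\<subseteq>V. finite B \<and> \<not> cdependent B \<and> card B = m)"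
proof -
  obtain D where D: "D \<subseteq> V" "\<not> cdependent D" "V \<subseteq> cspan D" "card D = cdim V"
    using complex_vector.basis_exists by blast
  show ?thesis
  proof (cases "finite D")
    case True
    then have e: "ecdim V = enat (card D)" using D unfolding ecdim_def by auto
    show ?thesis
    proof
      assume "enat m \<le> ecdim V"
      then obtain B where "B \<subseteq> D" "card B = m" "finite B"
        using obtain_subset_with_card_n[of m D] e by auto
      then show "\<exists>B\<subseteq>V. finite B \<and> \<not> cdependent B \<and> card B = m"
        using D complex_vector.independent_mono by blast
    next
      assume "\<exists>B\<subseteq>V. finite B \<and> \<not> cdependent B \<and> card B = m"
      then obtain B where B: "B \<subseteq> V" "\<not> cdependent B" "card B = m" by blast
      have "B \<subseteq> cspan D" using B D by blast
      from complex_vector.independent_span_bound[OF True B(2) this]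
      show "enat m \<le> ecdim V" using B e by simp
    qed
  next
    case False
    have "ecdim V = \<infinity>" unfolding ecdim_def
      using complex_vector.independent_span_bound[OF _ D(2)] D(1) False by (meson order_trans)
    moreover obtain B where "finite B" "card B = m" "B \<subseteq> D"
      using infinite_arbitrarily_large[OF False] by blast
    ultimately show ?thesis using D complex_vector.independent_mono by (metis enat_ord_code(3) order_trans)
  qed
qed

lemma span_Int_independent:
  assumes E: "\<not> cdependent E" and D: "D \<subseteq> E" and x: "x \<in> cspan D" "x \<in> cspan (E - D)"
  shows "x = 0"
proof -
  have xE: "x \<in> cspan E" using x(1) complex_vector.span_mono[OF D] by blast
  have 1: "complex_vector.representation E x = complex_vector.representation D x"
    by (rule complex_vector.representation_extend[OF E x(1) D])
  have 2: "complex_vector.representation E x = complex_vector.representation (E - D) x"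
    by (rule complex_vector.representation_extend[OF E x(2)]) blast
  have "complex_vector.representation E x b = 0" for b
    using complex_vector.representation_ne_zero[of D x b] complex_vector.representation_ne_zero[of "E - D" x b]
    unfolding 1[symmetric] 2[symmetric] by blast
  then show ?thesis using complex_vector.sum_nonzero_representation_eq[OF E xE] by simp
qed

text \<open>Purely algebraic: a basis \<open>D\<close> of \<open>R\<close> together with
  \<open>B\<close> is independent and extends to a basis \<open>E\<close> of \<open>Y\<close>;
  \<open>W\<close> is the span of \<open>E - D\<close>. Prescribing \<open>B\<close> inside
  \<open>W\<close> turns independence modulo \<open>R\<close> into independence within a
  complement.\<close>

lemma complement_extends:
  fixes R Y :: "'a::complex_normed_vector set"
  assumes R: "csubspace R" "R \<subseteq> Y" and Y: "csubspace Y" and B: "finite B" "B \<subseteq> Y" "indep_mod R B"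
  obtains W where "csubspace W" "R \<inter> W = {0}" "Y = {r + w |r w. r \<in> R \<and> w \<in> W}" "B \<subseteq> W"
proof -
  obtain D where D: "D \<subseteq> R" "\<not> cdependent D" "R \<subseteq> cspan D"
    using complex_vector.maximal_independent_subset by blast
  have Rs: "R = cspan D" using D R(1) complex_vector.span_minimal by blast
  have "\<not> cdependent (D \<union> B)" using B(1,3)
  proof (induction B rule: finite_induct)
    case empty then show ?case using D by simp
  next
    case (insert b B)
    have "b \<notin> cspan (R \<union> B)" using insert by (auto simp: indep_mod_def)
    then have "b \<notin> cspan (D \<union> B)" using complex_vector.span_mono[of "D \<union> B" "R \<union> B"] D(1) by blast
    moreover have "\<not> cdependent (D \<union> B)" using insert indep_mod_mono by blast
    ultimately show ?case using complex_vector.independent_insertI by simp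
  qed
  moreover have "D \<union> B \<subseteq> Y" using D R B by blast
  ultimately obtain E where E: "D \<union> B \<subseteq> E" "E \<subseteq> Y" "\<not> cdependent E" "Y \<subseteq> cspan E"
    using complex_vector.maximal_independent_subset_extend by blast
  define W where "W = cspan (E - D)"
  have W: "csubspace W" unfolding W_def by (rule complex_vector.subspace_span)
  have WY: "W \<subseteq> Y" unfolding W_def using E Y by (intro complex_vector.span_minimal) auto
  show ?thesis
  proof (rule that[OF W])
    show "R \<inter> W = {0}"
      using span_Int_independent[OF E(3), of D] E(1) W R(1) complex_vector.subspace_0
      unfolding Rs W_def by blast
    have "Y \<subseteq> {r + w |r w. r \<in> R \<and> w \<in> W}"
    proof
      fix y assume "y \<in> Y"
      moreover have "D \<union> (E - D) = E" using E(1) by blast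
      ultimately have "y \<in> cspan (D \<union> (E - D))" using E(4) by auto
      then show "y \<in> {r + w |r w. r \<in> R \<and> w \<in> W}"
        unfolding complex_vector.span_Un Rs W_def by blast
    qed
    then show "Y = {r + w |r w. r \<in> R \<and> w \<in> W}"
      using R(2) WY complex_vector.subspace_add[OF Y] by blast
    have "b \<notin> R" if "b \<in> B" for b
      using B(3) that complex_vector.span_base unfolding indep_mod_def by blast
    then show "B \<subseteq> W" using E(1) D(1) complex_vector.span_base unfolding W_def by blast
  qed
qed

lemma codim_ge_iff:
  assumes R: "csubspace R" "R \<subseteq> Y" and Y: "csubspace Y"
  shows "enat m \<le> codim_in Y R \<longleftrightarrow> (\<exists>B\<subseteq>Y. finite B \<and> indep_mod R B \<and> card B = m)"
proof
  assume m: "enat m \<le> codim_in Y R"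
  obtain W where W: "csubspace W" "R \<inter> W = {0}" "Y = {r + w |r w. r \<in> R \<and> w \<in> W}"
    using complement_extends[OF R Y, of "{}"] by (auto simp: indep_mod_def)
  have WY: "W \<subseteq> Y" using W(3) complex_vector.subspace_0[OF R(1)] by force
  obtain B where B: "B \<subseteq> W" "finite B" "\<not> cdependent B" "card B = m"
    using m unfolding codim_in_eq_ecdim_complement[OF R(1) W] ecdim_ge_iff[OF W(1)] by blast
  have "indep_mod R B"
  proof (rule indep_modI[OF R(1) B(2)])
    fix c assume "(\<Sum>b\<in>B. c b *\<^sub>C b) \<in> R"
    moreover have "(\<Sum>b\<in>B. c b *\<^sub>C b) \<in> W"
      using W(1) B(1) by (intro complex_vector.subspace_sum complex_vector.subspace_scale) auto
    ultimately have "(\<Sum>b\<in>B. c b *\<^sub>C b) = 0" using W(2) by blast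
    then show "\<forall>b\<in>B. c b = 0" using B complex_vector.independent_explicit_finite_subsets[of B] by blast
  qed
  then show "\<exists>B\<subseteq>Y. finite B \<and> indep_mod R B \<and> card B = m" using B WY by blast
next
  assume "\<exists>B\<subseteq>Y. finite B \<and> indep_mod R B \<and> card B = m"
  then obtain B where B: "B \<subseteq> Y" "finite B" "indep_mod R B" "card B = m" by blast
  obtain W where W: "csubspace W" "R \<inter> W = {0}" "Y = {r + w |r w. r \<in> R \<and> w \<in> W}" "B \<subseteq> W"
    using complement_extends[OF R Y B(2,1,3)] by blast
  have "indep_mod {0} B"
    by (rule indep_mod_mono[OF B(3)]) (simp_all add: complex_vector.subspace_0[OF R(1)])
  then have "\<not> cdependent B" by (rule indep_mod_0[THEN iffD1])
  then have "enat m \<le> ecdim W"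
    unfolding ecdim_ge_iff[OF W(1)] using B(2,4) W(4) by blast
  then show "enat m \<le> codim_in Y R"
    by (simp only: codim_in_eq_ecdim_complement[OF R(1) W(1-3)])
qed

lemma codim_less_iff:
  "codim_in Y R < enat m \<longleftrightarrow> (\<exists>F\<subseteq>Y. finite F \<and> Y \<subseteq> cspan (R \<union> F) \<and> card F < m)"
  unfolding codim_in_def INF_less_iff by auto

lemma enat_eqI_le:
  assumes "\<And>m. enat m \<le> a \<longleftrightarrow> enat m \<le> b"
  shows "a = b"
proof (rule antisym)
  have *: "x \<le> y" if "\<And>m. enat m \<le> x \<Longrightarrow> enat m \<le> y" for x y :: enat
  proof (cases x)
    case (enat n)
    then show ?thesis using that by blast
  next
    case infinity
    show ?thesis
    proof (cases y)
      case (enat n)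
      then show ?thesis using that[of "Suc n"] infinity by simp
    qed simp
  qed
  show "a \<le> b" "b \<le> a" using * assms by blast+
qed

subsection \<open>Kato operators\<close>

lemma bounded_ops_UNIV_simps:
  assumes "S \<in> bounded_ops UNIV"
  shows "S 0 = 0" "S (x + y) = S x + S y" "S (x - y) = S x - S y" "S (c *\<^sub>C x) = c *\<^sub>C S x"
    "S (sum h A) = (\<Sum>a\<in>A. S (h a))"
proof -
  interpret bounded_linear S using assms by (simp add: bounded_ops_UNIV)
  show "S 0 = 0" "S (x + y) = S x + S y" "S (x - y) = S x - S y" "S (sum h A) = (\<Sum>a\<in>A. S (h a))"
    by (rule zero add diff sum)+
  show "S (c *\<^sub>C x) = c *\<^sub>C S x" using assms by (simp add: bounded_ops_UNIV)
qed

lemma bounded_ops_UNIV_linear: "S \<in> bounded_ops UNIV \<Longrightarrow> bounded_linear S"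
  by (simp add: bounded_ops_UNIV)

lemma bounded_linear_scaleC: "bounded_linear (scaleC c :: 'a::complex_normed_vector \<Rightarrow> 'a)"
proof (rule bounded_linear_intro[of _ "cmod c"])
  show "c *\<^sub>C r *\<^sub>R x = r *\<^sub>R c *\<^sub>C x" for r and x :: 'a
    by (simp add: scaleC_of_real[symmetric] mult.commute)
qed (simp_all add: complex_vector.scale_right_distrib norm_scaleC mult.commute)

lemma shift_in_bounded_ops:
  assumes "T \<in> bounded_ops UNIV"
  shows "(\<lambda>x. T x - \<mu> *\<^sub>C x) \<in> bounded_ops UNIV"
  using assms bounded_linear_sub[OF _ bounded_linear_scaleC]
  by (auto simp: bounded_ops_UNIV complex_vector.scale_right_diff_distrib mult.commute)

lemma funpow_in_bounded_ops: "T \<in> bounded_ops UNIV \<Longrightarrow> (T ^^ n) \<in> bounded_ops UNIV"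
proof (induction n)
  case 0
  then show ?case by (simp add: bounded_ops_UNIV id_def bounded_linear_ident)
next
  case (Suc n)
  then show ?case
    by (auto simp: bounded_ops_UNIV o_def intro: bounded_linear_compose[of T "T ^^ n"])
qed

lemma bounded_ops_restrict:
  assumes "T \<in> bounded_ops UNIV" "T ` M \<subseteq> M"
  shows "T \<in> bounded_ops M"
  using assms unfolding bounded_ops_def by auto

lemma csubspace_image:
  assumes T: "T \<in> bounded_ops UNIV" and M: "csubspace M"
  shows "csubspace (T ` M)"
  unfolding complex_vector.subspace_def
proof (intro conjI ballI allI)
  show "0 \<in> T ` M" using complex_vector.subspace_0[OF M] bounded_ops_UNIV_simps(1)[OF T] by force
  show "x + y \<in> T ` M" if "x \<in> T ` M" "y \<in> T ` M" for x y
    using that complex_vector.subspace_add[OF M] by (auto simp flip: bounded_ops_UNIV_simps(2)[OF T])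
  show "c *\<^sub>C x \<in> T ` M" if "x \<in> T ` M" for x c
    using that complex_vector.subspace_scale[OF M] by (auto simp flip: bounded_ops_UNIV_simps(4)[OF T])
qed

lemma csubspace_vimage:
  assumes T: "T \<in> bounded_ops UNIV" and M: "csubspace M"
  shows "csubspace (T -` M)"
  using M by (auto simp: complex_vector.subspace_def bounded_ops_UNIV_simps[OF T])

lemma csubspace_ker_on:
  assumes T: "T \<in> bounded_ops UNIV" and M: "csubspace M"
  shows "csubspace (ker_on M T)"
  using M unfolding ker_on_def complex_vector.subspace_def by (auto simp: bounded_ops_UNIV_simps[OF T])

lemma funpow_image_subset: "T ` M \<subseteq> M \<Longrightarrow> (T ^^ n) ` M \<subseteq> M"
  by (induction n) auto

text \<open>Preimages chosen in \<open>M\<close> with bounded norm lie in \<open>Z\<close>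
  automatically: they differ from a preimage in \<open>Z\<close> by a kernel vector.\<close>

lemma closed_image_supset_ker:
  fixes T :: "'a::complex_banach \<Rightarrow> 'a"
  assumes T: "T \<in> bounded_ops UNIV" and M: "closed M" "csubspace M" "closed (T ` M)"
    and Z: "closed Z" "csubspace Z" "Z \<subseteq> M" "ker_on M T \<subseteq> Z"
  shows "closed (T ` Z)"
proof -
  note bl = bounded_ops_UNIV_linear[OF T]
  obtain C where C: "C > 0" "\<And>y. y \<in> T ` M \<Longrightarrow> \<exists>x\<in>M. T x = y \<and> norm x \<le> C * norm y"
    using open_mapping_subspace[OF bl M(1) csubspace_imp_subspace[OF M(2)] M(3)] by blast
  show ?thesis
  proof (rule closed_range_if_bounded_preimages[OF bl Z(1) csubspace_imp_subspace[OF Z(2)]])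
    show "0 \<le> C" using C(1) by simp
    fix x assume x: "x \<in> Z"
    then obtain v where v: "v \<in> M" "T v = T x" "norm v \<le> C * norm (T x)" using C(2) Z(3) by blast
    have "v - x \<in> ker_on M T"
      using v x Z(3) complex_vector.subspace_diff[OF M(2)]
      by (auto simp: ker_on_def bounded_ops_UNIV_simps[OF T])
    then have "(v - x) + x \<in> Z" using Z(4) x complex_vector.subspace_add[OF Z(2)] by blast
    then show "\<exists>v\<in>Z. T v = T x \<and> norm v \<le> C * norm (T x)" using v by auto
  qed
qed

text \<open>A nearest point need not exist; the factor \<open>2\<close> buys an approximate one, and
  at distance zero the vector itself belongs to \<open>K\<close>.\<close>

lemma infdist_almost_attained:
  fixes K :: "'a::real_normed_vector set"
  assumes "closed K" "K \<noteq> {}"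
  obtains k where "k \<in> K" "norm (x - k) \<le> 2 * infdist x K"
proof (cases "infdist x K = 0")
  case True
  then have "x \<in> K" using in_closed_iff_infdist_zero[OF assms] by blast
  then show ?thesis using that[of x] True by simp
next
  case False
  then have "infdist x K > 0" using infdist_nonneg[of x K] by linarith
  then have "Inf (dist x ` K) < 2 * infdist x K" using assms(2) by (simp add: infdist_notempty)
  then obtain k where "k \<in> K" "dist x k < 2 * infdist x K"
    using cInf_lessD[of "dist x ` K"] assms(2) by auto
  then show ?thesis using that[of k] by (simp add: dist_norm)
qed

section \<open>The core of a Kato operator\<close>

locale kato_operator =
  fixes T :: "'a::complex_banach \<Rightarrow> 'a" and M :: "'a set"
  assumes T: "T \<in> bounded_ops UNIV" and M: "closed M" "csubspace M" "T ` M \<subseteq> M"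
    and kato: "Kato_on M T"
begin

lemmas T_simps = bounded_ops_UNIV_simps[OF T]
lemmas T_linear = bounded_ops_UNIV_linear[OF T]

lemma ker_subset: "x \<in> M \<Longrightarrow> T x = 0 \<Longrightarrow> x \<in> (T ^^ n) ` M"
  using kato unfolding Kato_on_def ker_on_def by blast

text \<open>Known as the generalized range, or hyperrange, of \<open>T\<close> on \<open>M\<close>.
  The Kato condition places the whole kernel inside it.\<close>

definition core :: "'a set" where "core = (\<Inter>n. (T ^^ n) ` M)"

text \<open>Every power range contains the kernel, which is exactly what keeps the next image
  closed.\<close>

lemma closed_power_range: "closed ((T ^^ n) ` M)"
proof (induction n)
  case 0 then show ?case using M by simp
next
  case (Suc n)
  have "(T ^^ Suc n) ` M = T ` ((T ^^ n) ` M)" by (simp add: image_comp)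
  moreover have "closed (T ` ((T ^^ n) ` M))"
  proof (rule closed_image_supset_ker[OF T M(1,2) _ Suc.IH])
    show "closed (T ` M)" using kato by (simp add: Kato_on_def)
    show "csubspace ((T ^^ n) ` M)" by (rule csubspace_image[OF funpow_in_bounded_ops[OF T] M(2)])
    show "(T ^^ n) ` M \<subseteq> M" by (rule funpow_image_subset[OF M(3)])
    show "ker_on M T \<subseteq> (T ^^ n) ` M" using kato by (simp add: Kato_on_def)
  qed
  ultimately show ?case by simp
qed

lemma closed_core: "closed core"
  unfolding core_def using closed_power_range by blast

lemma csubspace_core: "csubspace core"
  unfolding core_def
  using csubspace_image[OF funpow_in_bounded_ops[OF T] M(2)] by (intro complex_vector.subspace_Inter) blast

lemma core_subset: "core \<subseteq> M"
proof
  fix x assume "x \<in> core"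
  then have "x \<in> (T ^^ 0) ` M" unfolding core_def by blast
  then show "x \<in> M" by simp
qed

text \<open>A preimage in \<open>M\<close> of a core vector differs from one of the form
  \<open>(T ^^ n) z\<close> by a kernel vector, and kernel vectors lie in the same range. Thus
  \<open>T\<close> is injective modulo the core.\<close>

lemma core_preimage:
  assumes x: "x \<in> M" "T x \<in> core"
  shows "x \<in> core"
  unfolding core_def
proof
  fix n
  have "T x \<in> (T ^^ Suc n) ` M" using x unfolding core_def by blast
  then obtain z where z: "z \<in> M" "T x = T ((T ^^ n) z)" by auto
  have zM: "(T ^^ n) z \<in> M" using funpow_image_subset[OF M(3)] z by blast
  have "x - (T ^^ n) z \<in> (T ^^ n) ` M"
    using z zM x complex_vector.subspace_diff[OF M(2)] by (intro ker_subset) (auto simp: T_simps)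
  then have "(x - (T ^^ n) z) + (T ^^ n) z \<in> (T ^^ n) ` M"
    using z complex_vector.subspace_add[OF csubspace_image[OF funpow_in_bounded_ops[OF T] M(2)]] by blast
  then show "x \<in> (T ^^ n) ` M" by simp
qed

lemma image_core: "T ` core = core"
proof
  show "T ` core \<subseteq> core"
  proof
    fix y assume "y \<in> T ` core"
    then obtain x where x: "x \<in> core" "y = T x" by blast
    have "T x \<in> (T ^^ n) ` M" for n
    proof -
      have "x \<in> (T ^^ n) ` M" using x unfolding core_def by blast
      then obtain z where "z \<in> M" "x = (T ^^ n) z" by blast
      then have "T x = (T ^^ n) (T z)" by (simp add: funpow_swap1)
      then show ?thesis using M(3) \<open>z \<in> M\<close> by blast
    qed
    then show "y \<in> core" using x unfolding core_def by blast
  qed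
  show "core \<subseteq> T ` core"
  proof
    fix y assume y: "y \<in> core"
    then have "y \<in> (T ^^ Suc 0) ` M" unfolding core_def by blast
    then obtain x where "x \<in> M" "y = T x" by auto
    then show "y \<in> T ` core" using core_preimage y by blast
  qed
qed

text \<open>Surjectivity on the core perturbs directly. Injectivity modulo the core and the bounded
  liftings come from \<open>red\<close>, which plays the part of a lower bound in the quotient of
  \<open>M\<close> by the core; a lifting is then corrected inside the core.\<close>

lemma uniform_estimates:
  obtains \<epsilon> C where "\<epsilon> > 0" "C > 0"
    "\<And>\<mu> y. cmod \<mu> < \<epsilon> \<Longrightarrow> y \<in> core \<Longrightarrow> \<exists>x\<in>core. T x - \<mu> *\<^sub>C x = y \<and> norm x \<le> C * norm y"
    "\<And>\<mu> x. cmod \<mu> < \<epsilon> \<Longrightarrow> x \<in> M \<Longrightarrow> T x - \<mu> *\<^sub>C x \<in> core \<Longrightarrow> x \<in> core"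
    "\<And>\<mu> x. cmod \<mu> < \<epsilon> \<Longrightarrow> x \<in> M \<Longrightarrow>
       \<exists>v\<in>M. T v - \<mu> *\<^sub>C v = T x - \<mu> *\<^sub>C x \<and> norm v \<le> C * norm (T x - \<mu> *\<^sub>C x)"
proof -
  have Msub: "subspace M" and Ksub: "subspace core"
    using M csubspace_core csubspace_imp_subspace by auto
  have clTM: "closed (T ` M)" using kato by (simp add: Kato_on_def)
  obtain C0 where C0: "C0 > 0" "\<And>y. y \<in> T ` M \<Longrightarrow> \<exists>x\<in>M. T x = y \<and> norm x \<le> C0 * norm y"
    using open_mapping_subspace[OF T_linear M(1) Msub clTM] by blast
  obtain C1 where C1: "C1 > 0" "\<And>y. y \<in> core \<Longrightarrow> \<exists>x\<in>core. T x = y \<and> norm x \<le> C1 * norm y"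
    using open_mapping_subspace[OF T_linear closed_core Ksub] image_core closed_core by metis
  obtain B where B: "B > 0" "\<And>x. norm (T x) \<le> norm x * B"
    using bounded_linear.pos_bounded[OF T_linear] by blast
  \<comment> \<open>The first radius makes the perturbation on the core contract by
    \<open>1 / 2\<close>; the second lets the error \<open>2 * C0 * cmod \<mu> * d\<close> in
    \<open>red\<close> be absorbed as \<open>d / 2\<close>.\<close>
  define \<epsilon> where "\<epsilon> = min (1 / (2 * C1)) (1 / (4 * C0))"
  have e0: "\<epsilon> > 0" using C0 C1 by (simp add: \<epsilon>_def)
  have e1: "C1 * cmod \<mu> \<le> 1 / 2" "2 * C0 * cmod \<mu> \<le> 1 / 2" if "cmod \<mu> < \<epsilon>" for \<mu>
    using that C0(1) C1(1) by (simp_all add: \<epsilon>_def field_simps)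
  \<comment> \<open>\<open>2 * C0\<close> bounds the representative \<open>u\<close>, the other
    summand bounds its correction \<open>k'\<close> in the core; the latter exceeds
    \<open>2 * C1\<close>, which is the constant for surjectivity on the core.\<close>
  define C where "C = 2 * C0 + 2 * C1 * (1 + (B + \<epsilon>) * (2 * C0))"
  have C: "C > 0" "2 * C1 \<le> C" using C0(1) C1(1) B(1) e0 by (simp_all add: C_def algebra_simps add_pos_pos)
  have shift_core: "T x - \<mu> *\<^sub>C x \<in> core" if "x \<in> core" for x \<mu>
    using that image_core csubspace_core by (auto intro!: complex_vector.subspace_diff complex_vector.subspace_scale)
  have surj: "\<exists>x\<in>core. T x - \<mu> *\<^sub>C x = y \<and> norm x \<le> 2 * C1 * norm y" if \<mu>: "cmod \<mu> < \<epsilon>" and y: "y \<in> core" for \<mu> y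
  proof (rule surj_perturbation[OF _ closed_core Ksub Ksub _ _ C1(2) _ _ _ y])
    show "bounded_linear (\<lambda>x. T x - \<mu> *\<^sub>C x)" by (rule bounded_ops_UNIV_linear[OF shift_in_bounded_ops[OF T]])
    show "(\<lambda>x. T x - \<mu> *\<^sub>C x) ` core \<subseteq> core" using shift_core by blast
    show "C1 * cmod \<mu> \<le> 1 / 2" by (rule e1(1)[OF \<mu>])
    show "norm (T x - (T x - \<mu> *\<^sub>C x)) \<le> cmod \<mu> * norm x" for x by (simp add: norm_scaleC)
  qed (use C1 in auto)
  \<comment> \<open>\<open>u\<close> represents the coset of \<open>x\<close> modulo the core, with
    norm controlled by the image of \<open>x\<close>. A nearly minimal representative
    \<open>x - k\<close> is used so that the term with \<mu> costs only a multiple of the distance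
    \<open>d\<close>.\<close>
  have red: "\<exists>u\<in>M. x - u \<in> core \<and> norm u \<le> 2 * C0 * norm (T x - \<mu> *\<^sub>C x)" if \<mu>: "cmod \<mu> < \<epsilon>" and x: "x \<in> M" for \<mu> x
  proof -
    define d where "d = infdist x core"
    define y where "y = T x - \<mu> *\<^sub>C x"
    obtain k where k: "k \<in> core" "norm (x - k) \<le> 2 * d"
      using infdist_almost_attained[OF closed_core, of x] complex_vector.subspace_0[OF csubspace_core] unfolding d_def by blast
    \<comment> \<open>Modulo the core \<open>w\<close> equals \<open>T (x - k)\<close>; hence it
      lies in the range of \<open>T\<close> on \<open>M\<close>, and any preimage of it in
      \<open>M\<close> stays in the coset of \<open>x\<close>.\<close>
    define w where "w = y + \<mu> *\<^sub>C (x - k)"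
    have w: "T (x - k) - w = - (T k - \<mu> *\<^sub>C k)"
      by (simp add: w_def y_def T_simps complex_vector.scale_right_diff_distrib)
    have "- (T k - \<mu> *\<^sub>C k) \<in> core"
      using shift_core[OF k(1)] complex_vector.subspace_neg[OF csubspace_core] by blast
    then obtain k' where k': "k' \<in> core" "T k' = - (T k - \<mu> *\<^sub>C k)" using image_core by (metis imageE)
    have "w = T (x - k - k')" using w k' by (simp add: T_simps algebra_simps)
    moreover have "x - k - k' \<in> M" using x k k' core_subset M(2) by (intro complex_vector.subspace_diff) auto
    ultimately obtain u where u: "u \<in> M" "T u = w" "norm u \<le> C0 * norm w" using C0(2) by blast
    have "x - k - k' - u \<in> core"
    proof (rule core_preimage)
      show "x - k - k' - u \<in> M" by (rule complex_vector.subspace_diff[OF M(2) \<open>x - k - k' \<in> M\<close> u(1)])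
      show "T (x - k - k' - u) \<in> core"
        using \<open>w = T (x - k - k')\<close> u(2) complex_vector.subspace_0[OF csubspace_core]
        by (simp add: T_simps(3)[of "x - k - k'" u])
    qed
    then have "(x - k - k' - u) + k' + k \<in> core" using k k' csubspace_core
      by (intro complex_vector.subspace_add) auto
    then have xu: "x - u \<in> core" by (simp add: algebra_simps)
    \<comment> \<open>\<open>u\<close> represents the same coset, so its norm is at least
      \<open>d\<close>; the bound for \<open>norm u\<close> will contain only \<open>d / 2\<close>,
      and therefore bounds \<open>d\<close> itself.\<close>
    have "d \<le> norm u" unfolding d_def using infdist_le[OF xu, of x] by (simp add: dist_norm)
    have d0: "0 \<le> d" by (simp add: d_def infdist_nonneg)
    have "norm w \<le> norm y + cmod \<mu> * norm (x - k)"
      unfolding w_def by (metis norm_scaleC norm_triangle_ineq)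
    also have "\<dots> \<le> norm y + cmod \<mu> * (2 * d)" using k by (intro add_left_mono mult_left_mono) auto
    finally have nw: "C0 * norm w \<le> C0 * (norm y + cmod \<mu> * (2 * d))" using C0(1) by (intro mult_left_mono) auto
    have "(2 * C0 * cmod \<mu>) * d \<le> 1 / 2 * d" using e1(2)[OF \<mu>] d0 by (intro mult_right_mono) auto
    then have nu: "norm u \<le> C0 * norm y + d / 2" using u(3) nw by (simp add: algebra_simps)
    then have "d \<le> 2 * (C0 * norm y)" using \<open>d \<le> norm u\<close> by linarith
    then have "norm u \<le> 2 * C0 * norm y" using nu by simp
    then show ?thesis using u xu unfolding y_def by blast
  qed
  show ?thesis
  proof (rule that[OF e0 C(1)])
    fix \<mu> y assume \<mu>: "cmod \<mu> < \<epsilon>" and y: "y \<in> core"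
    obtain x where "x \<in> core" "T x - \<mu> *\<^sub>C x = y" "norm x \<le> 2 * C1 * norm y"
      using surj[OF \<mu> y] by blast
    moreover have "2 * C1 * norm y \<le> C * norm y" using C by (intro mult_right_mono) auto
    ultimately show "\<exists>x\<in>core. T x - \<mu> *\<^sub>C x = y \<and> norm x \<le> C * norm y" by (intro bexI[of _ x]) auto
  next
    fix \<mu> x assume \<mu>: "cmod \<mu> < \<epsilon>" and x: "x \<in> M" "T x - \<mu> *\<^sub>C x \<in> core"
    obtain k where k: "k \<in> core" "T k - \<mu> *\<^sub>C k = T x - \<mu> *\<^sub>C x" using surj[OF \<mu> x(2)] by blast
    have xk: "x - k \<in> M" using x k core_subset M(2) by (intro complex_vector.subspace_diff) auto
    have "T (x - k) - \<mu> *\<^sub>C (x - k) = (T x - \<mu> *\<^sub>C x) - (T k - \<mu> *\<^sub>C k)"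
      by (simp add: T_simps complex_vector.scale_right_diff_distrib)
    then have "T (x - k) - \<mu> *\<^sub>C (x - k) = 0" using k(2) by simp
    then have "x - k \<in> core" using red[OF \<mu> xk] by auto
    from complex_vector.subspace_add[OF csubspace_core this k(1)] show "x \<in> core" by simp
  next
    fix \<mu> x assume \<mu>: "cmod \<mu> < \<epsilon>" and x: "x \<in> M"
    define y where "y = T x - \<mu> *\<^sub>C x"
    obtain u where u: "u \<in> M" "x - u \<in> core" "norm u \<le> 2 * C0 * norm y"
      using red[OF \<mu> x] unfolding y_def by blast
    define k where "k = T (x - u) - \<mu> *\<^sub>C (x - u)"
    have "k \<in> core" unfolding k_def by (rule shift_core[OF u(2)])
    then obtain k' where k': "k' \<in> core" "T k' - \<mu> *\<^sub>C k' = k" "norm k' \<le> 2 * C1 * norm k"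
      using surj[OF \<mu>] by blast
    have keq: "k = y - (T u - \<mu> *\<^sub>C u)"
      by (simp add: k_def y_def T_simps complex_vector.scale_right_diff_distrib)
    have "norm k \<le> norm y + norm (T u - \<mu> *\<^sub>C u)" unfolding keq by (rule norm_triangle_ineq4)
    also have "norm (T u - \<mu> *\<^sub>C u) \<le> norm (T u) + cmod \<mu> * norm u"
      by (metis norm_scaleC norm_triangle_ineq4)
    also have "\<dots> \<le> norm u * B + \<epsilon> * norm u"
      using B(2) \<mu> by (intro add_mono mult_right_mono) auto
    also have "\<dots> = (B + \<epsilon>) * norm u" by (simp add: algebra_simps)
    also have "\<dots> \<le> (B + \<epsilon>) * (2 * C0 * norm y)" using u(3) B(1) e0 by (intro mult_left_mono) auto
    finally have "norm k \<le> (1 + (B + \<epsilon>) * (2 * C0)) * norm y" by (simp add: algebra_simps)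
    then have "2 * C1 * norm k \<le> 2 * C1 * ((1 + (B + \<epsilon>) * (2 * C0)) * norm y)"
      using C1(1) by (intro mult_left_mono) auto
    then have nk: "norm k' \<le> 2 * C1 * (1 + (B + \<epsilon>) * (2 * C0)) * norm y" using k'(3) by (simp add: mult.assoc)
    have "norm (u + k') \<le> norm u + norm k'" by (rule norm_triangle_ineq)
    also have "\<dots> \<le> C * norm y" unfolding C_def using u(3) nk by (simp only: distrib_right)
    finally have "norm (u + k') \<le> C * norm y" .
    moreover have "u + k' \<in> M" using u k' core_subset M(2) by (intro complex_vector.subspace_add) auto
    moreover have "T (u + k') - \<mu> *\<^sub>C (u + k') = y"
      using k'(2) keq by (simp add: T_simps complex_vector.scale_right_distrib algebra_simps)
    ultimately show "\<exists>v\<in>M. T v - \<mu> *\<^sub>C v = T x - \<mu> *\<^sub>C x \<and> norm v \<le> C * norm (T x - \<mu> *\<^sub>C x)"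
      unfolding y_def by blast
  qed
qed

end

subsection \<open>Constancy of nullity and defect near a Kato operator\<close>

lemma locally_constant_on_ball:
  fixes P :: "complex \<Rightarrow> bool"
  assumes loc: "\<And>a. cmod a < \<epsilon> \<Longrightarrow> \<exists>\<delta>>0. \<forall>z. cmod z < \<epsilon> \<and> cmod (z - a) < \<delta> \<longrightarrow> P z = P a"
    and z: "cmod z < \<epsilon>" "cmod w < \<epsilon>"
  shows "P z = P w"
proof -
  have "connected (ball (0::complex) \<epsilon>)" by (rule connected_ball)
  moreover have "w \<in> ball 0 \<epsilon>" "z \<in> ball 0 \<epsilon>" using z by auto
  moreover have "P w = P w" by simp
  moreover have "\<exists>U. openin (top_of_set (ball 0 \<epsilon>)) U \<and> a \<in> U \<and> (\<forall>x\<in>U. \<forall>y\<in>U. P x = P w \<longrightarrow> P y = P w)"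
    if a: "a \<in> ball 0 \<epsilon>" for a
  proof -
    obtain \<delta> where \<delta>: "\<delta> > 0" "\<And>z. cmod z < \<epsilon> \<Longrightarrow> cmod (z - a) < \<delta> \<Longrightarrow> P z = P a"
      using loc[of a] a by auto
    have "openin (top_of_set (ball 0 \<epsilon>)) (ball 0 \<epsilon> \<inter> ball a \<delta>)" by (intro openin_open_Int) simp
    moreover have c: "P x = P a" if "x \<in> ball 0 \<epsilon> \<inter> ball a \<delta>" for x
      using that by (intro \<delta>(2)) (auto simp: dist_norm norm_minus_commute)
    have "P y = P w" if "x \<in> ball 0 \<epsilon> \<inter> ball a \<delta>" "y \<in> ball 0 \<epsilon> \<inter> ball a \<delta>" "P x = P w" for x y
      using c[OF that(1)] c[OF that(2)] that(3) by simp
    moreover have "a \<in> ball 0 \<epsilon> \<inter> ball a \<delta>" using a \<delta>(1) by simp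
    ultimately show ?thesis by blast
  qed
  ultimately show ?thesis by (rule connected_induction_simple[where P = "\<lambda>x. P x = P w"])
qed

text \<open>Independent vectors \<open>b\<close> of the kernel can be moved into the kernel of a nearby operator by a
  small correction, and diagonal dominance of the dual functionals keeps them independent.\<close>

lemma nullity_lower_stable:
  fixes S :: "complex \<Rightarrow> 'a::complex_banach \<Rightarrow> 'a"
  assumes S: "\<And>\<mu>. S \<mu> \<in> bounded_ops UNIV" "\<And>\<mu> \<nu> x. S \<mu> x - S \<nu> x = (\<nu> - \<mu>) *\<^sub>C x"
    and K: "csubspace K"
    and C: "C > 0" "\<And>\<mu> y. cmod \<mu> < \<epsilon> \<Longrightarrow> y \<in> K \<Longrightarrow> \<exists>x\<in>K. S \<mu> x = y \<and> norm x \<le> C * norm y"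
    and a: "enat m \<le> nullity K (S a)"
  shows "\<exists>\<delta>>0. \<forall>z. cmod z < \<epsilon> \<and> cmod (z - a) < \<delta> \<longrightarrow> enat m \<le> nullity K (S z)"
proof -
  obtain B where B: "B \<subseteq> ker_on K (S a)" "finite B" "\<not> cdependent B" "card B = m"
    using a unfolding nullity_def ecdim_ge_iff[OF csubspace_ker_on[OF S(1) K]] by blast
  obtain \<phi> L where \<phi>: "\<And>b. b \<in> B \<Longrightarrow> cfunctional (\<phi> b)"
    "\<And>a b. a \<in> B \<Longrightarrow> b \<in> B \<Longrightarrow> \<phi> a b = (if a = b then 1 else 0)"
    "L > 0" "\<And>b x. b \<in> B \<Longrightarrow> cmod (\<phi> b x) \<le> L * norm x"
    using dual_functionals[of "{0}" B] B(2,3) by (metis closed_singleton complex_vector.subspace_single_0 indep_mod_0)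
  define N where "N = (\<Sum>b\<in>B. norm b) + 1"
  have N: "N > 0" unfolding N_def using sum_nonneg[of B norm] by simp
  have bN: "norm b \<le> N" if "b \<in> B" for b
    using member_le_sum[OF that, of norm] B(2) by (simp add: N_def)
  \<comment> \<open>Each entry of the perturbed pairing is off by at most
    \<open>cmod (z - a) * (L * C * N)\<close> and a row has \<open>m\<close> entries;
    \<open>m + 1\<close> keeps \<open>D\<close> positive when \<open>m = 0\<close>.\<close>
  define D where "D = L * C * N * (real m + 1)"
  have D: "D > 0" using \<phi>(3) C(1) N by (simp add: D_def)
  show ?thesis
  proof (intro exI[of _ "1 / D"] conjI allI impI)
    show "1 / D > 0" using D by simp
    fix z assume z: "cmod z < \<epsilon> \<and> cmod (z - a) < 1 / D"
    have "\<exists>x\<in>K. S z x = (a - z) *\<^sub>C b \<and> norm x \<le> C * norm ((a - z) *\<^sub>C b)" if "b \<in> B" for b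
    proof (rule C(2))
      show "(a - z) *\<^sub>C b \<in> K" using that B(1) complex_vector.subspace_scale[OF K] by (auto simp: ker_on_def)
    qed (use z in simp)
    then obtain h where h: "\<And>b. b \<in> B \<Longrightarrow> h b \<in> K" "\<And>b. b \<in> B \<Longrightarrow> S z (h b) = (a - z) *\<^sub>C b"
      "\<And>b. b \<in> B \<Longrightarrow> norm (h b) \<le> C * norm ((a - z) *\<^sub>C b)" by metis
    \<comment> \<open>On the kernel of \<open>S a\<close> the operator \<open>S z\<close> is
      multiplication by \<open>a - z\<close>, so subtracting the solution \<open>h b\<close> of the
      same equation lands in the kernel of \<open>S z\<close>.\<close>
    define g where "g b = b - h b" for b
    have gK: "g b \<in> ker_on K (S z)" if b: "b \<in> B" for b
    proof -
      have "b \<in> K" "S a b = 0" using b B(1) by (auto simp: ker_on_def)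
      then have "S z b = (a - z) *\<^sub>C b" using S(2)[of z b a] by simp
      then show ?thesis using h[OF b] \<open>b \<in> K\<close> K
        by (simp add: ker_on_def g_def bounded_ops_UNIV_simps[OF S(1)] complex_vector.subspace_diff)
    qed
    have hs: "cmod (\<phi> a' (h b)) \<le> cmod (z - a) * (L * C * N)" if "a' \<in> B" "b \<in> B" for a' b
    proof -
      have "cmod (\<phi> a' (h b)) \<le> L * norm (h b)" using \<phi>(4) that by blast
      also have "\<dots> \<le> L * (C * (cmod (z - a) * N))"
      proof -
        have "norm (h b) \<le> C * (cmod (z - a) * norm b)"
          using h(3)[OF that(2)] by (simp add: norm_scaleC norm_minus_commute)
        also have "\<dots> \<le> C * (cmod (z - a) * N)" using C(1) bN[OF that(2)] by (intro mult_left_mono) auto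
        finally show ?thesis using \<phi>(3) by (intro mult_left_mono) auto
      qed
      finally show ?thesis by (simp add: mult_ac)
    qed
    have indep: "\<forall>b\<in>B. c b = 0" if c0: "(\<Sum>b\<in>B. c b *\<^sub>C g b) = 0" for c
    proof (rule ccontr)
      assume "\<not> (\<forall>b\<in>B. c b = 0)"
      then obtain b where b: "b \<in> B" "c b \<noteq> 0" "\<And>a. a \<in> B \<Longrightarrow> cmod (c a) \<le> cmod (c b)"
        using finite_max_coefficient[OF B(2)] by blast
      note ph = cfunctional_simps[OF \<phi>(1)[OF b(1)]]
      have "0 = \<phi> b (\<Sum>x\<in>B. c x *\<^sub>C g x)" using c0 ph(1) by simp
      also have "\<dots> = (\<Sum>x\<in>B. c x * \<phi> b x) - (\<Sum>x\<in>B. c x * \<phi> b (h x))"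
        by (simp add: ph g_def algebra_simps sum_subtractf)
      also have "(\<Sum>x\<in>B. c x * \<phi> b x) = (\<Sum>x\<in>B. if x = b then c b else 0)"
        using \<phi>(2) b(1) by (intro sum.cong) auto
      also have "\<dots> = c b" using B(2) b(1) by simp
      finally have "cmod (c b) = cmod (\<Sum>x\<in>B. c x * \<phi> b (h x))" by simp
      also have "\<dots> \<le> (\<Sum>x\<in>B. cmod (c b) * (cmod (z - a) * (L * C * N)))"
        by (rule sum_norm_le) (auto simp: norm_mult intro!: mult_mono b hs)
      also have "\<dots> = cmod (c b) * (cmod (z - a) * (L * C * N * m))" using B(4) by (simp add: mult_ac)
      finally have "1 \<le> cmod (z - a) * (L * C * N * m)" using b(2) by simp
      also have "\<dots> \<le> cmod (z - a) * D" unfolding D_def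
        using \<phi>(3) C(1) N by (intro mult_left_mono) auto
      also have "\<dots> < 1" using z D by (simp add: field_simps)
      finally show False by simp
    qed
    have "card (g ` B) = m" "\<not> cdependent (g ` B)" "finite (g ` B)" "g ` B \<subseteq> ker_on K (S z)"
      using independent_family[of B g] B gK indep by (auto simp: card_image)
    then show "enat m \<le> nullity K (S z)"
      unfolding nullity_def ecdim_ge_iff[OF csubspace_ker_on[OF S(1) K]] by blast
  qed
qed

lemma linear_scaleC_image_independent:
  fixes P :: "'a::complex_normed_vector \<Rightarrow> 'a"
  assumes P: "Vector_Spaces.linear scaleC scaleC P" and B: "finite B" "\<not> cdependent B"
    and inj: "\<And>x. x \<in> cspan B \<Longrightarrow> P x = 0 \<Longrightarrow> x = 0" and F: "finite F" "P ` B \<subseteq> cspan F"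
  shows "card B \<le> card F"
proof -
  interpret P: Vector_Spaces.linear scaleC scaleC P by fact
  have "\<forall>b\<in>B. c b = 0" if c: "(\<Sum>b\<in>B. c b *\<^sub>C P b) = 0" for c
  proof -
    have "P (\<Sum>b\<in>B. c b *\<^sub>C b) = 0" using c by (simp add: P.sum P.scale)
    moreover have "(\<Sum>b\<in>B. c b *\<^sub>C b) \<in> cspan B"
      by (intro complex_vector.span_sum complex_vector.span_scale complex_vector.span_base)
    ultimately have "(\<Sum>b\<in>B. c b *\<^sub>C b) = 0" by (rule inj[rotated])
    then show ?thesis using B complex_vector.independent_explicit_finite_subsets[of B] by blast
  qed
  then have i: "inj_on P B" "\<not> cdependent (P ` B)" using independent_family[OF B(1), of P] by blast+
  have "card (P ` B) \<le> card F" using complex_vector.independent_span_bound[OF F(1) i(2) F(2)] by blast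
  then show ?thesis using i(1) by (simp add: card_image)
qed

text \<open>On the complement of a finite-dimensional kernel cut out by dual functionals the operator is
  bounded below, and this persists for nearby operators.\<close>

lemma nullity_upper_stable:
  fixes S :: "complex \<Rightarrow> 'a::complex_banach \<Rightarrow> 'a"
  assumes S: "\<And>\<mu>. S \<mu> \<in> bounded_ops UNIV" "\<And>\<mu> \<nu> x. S \<mu> x - S \<nu> x = (\<nu> - \<mu>) *\<^sub>C x"
    and K: "csubspace K" "S a ` K \<subseteq> K"
    and C: "C > 0" "\<And>y. y \<in> K \<Longrightarrow> \<exists>x\<in>K. S a x = y \<and> norm x \<le> C * norm y"
    and a: "nullity K (S a) < enat m"
  shows "\<exists>\<delta>>0. \<forall>z. cmod (z - a) < \<delta> \<longrightarrow> nullity K (S z) < enat m"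
proof -
  note ker = csubspace_ker_on[OF S(1) K(1)]
  have "\<exists>F. finite F \<and> ker_on K (S a) \<subseteq> cspan F" using a unfolding nullity_def ecdim_def by (auto split: if_splits)
  then obtain F where F: "finite F" "ker_on K (S a) \<subseteq> cspan F" by blast
  obtain B where B: "B \<subseteq> ker_on K (S a)" "\<not> cdependent B" "ker_on K (S a) \<subseteq> cspan B"
    using complex_vector.maximal_independent_subset by blast
  have finB: "finite B" using complex_vector.independent_span_bound[OF F(1) B(2)] B(1) F(2) by blast
  have cardB: "card B < m"
  proof (rule ccontr)
    assume "\<not> card B < m"
    then have "enat m \<le> enat (card B)" by simp
    also have "\<dots> \<le> nullity K (S a)" unfolding nullity_def ecdim_ge_iff[OF ker] using B finB by blast
    finally show False using a by simp
  qed
  obtain \<phi> L where \<phi>: "\<And>b. b \<in> B \<Longrightarrow> cfunctional (\<phi> b)"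
    "\<And>a b. a \<in> B \<Longrightarrow> b \<in> B \<Longrightarrow> \<phi> a b = (if a = b then 1 else 0)"
    "L > 0" "\<And>b x. b \<in> B \<Longrightarrow> cmod (\<phi> b x) \<le> L * norm x"
    using dual_functionals[of "{0}" B] finB B(2) by (metis closed_singleton complex_vector.subspace_single_0 indep_mod_0)
  \<comment> \<open>\<open>P\<close> projects onto the kernel of \<open>S a\<close> on
    \<open>K\<close>, along the common kernel of the functionals.\<close>
  define P where "P x = (\<Sum>b\<in>B. \<phi> b x *\<^sub>C b)" for x
  have P_lin: "Vector_Spaces.linear scaleC scaleC P"
    using \<phi>(1) by unfold_locales
      (auto simp: P_def cfunctional_simps complex_vector.scale_left_distrib sum.distrib complex_vector.scale_sum_right
        complex_vector.scale_right_distrib intro!: sum.cong)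
  have phP: "\<phi> b (P x) = \<phi> b x" if b: "b \<in> B" for b x
  proof -
    have "\<phi> b (P x) = (\<Sum>b'\<in>B. \<phi> b' x * \<phi> b b')" by (simp add: P_def cfunctional_simps[OF \<phi>(1)[OF b]])
    also have "\<dots> = (\<Sum>b'\<in>B. if b' = b then \<phi> b x else 0)" using \<phi>(2) b by (intro sum.cong) auto
    finally show ?thesis using finB b by simp
  qed
  have P_ker: "P x \<in> ker_on K (S a)" for x
    unfolding P_def using B(1) ker by (intro complex_vector.subspace_sum complex_vector.subspace_scale) auto
  have P_id: "P x = x" if x: "x \<in> ker_on K (S a)" for x
  proof -
    obtain u where u: "x = (\<Sum>b\<in>B. u b *\<^sub>C b)" using x B(3) finB by (auto simp: complex_vector.span_finite)
    have "\<phi> b x = u b" if b: "b \<in> B" for b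
    proof -
      have "\<phi> b x = (\<Sum>b'\<in>B. u b' * \<phi> b b')" by (simp add: u cfunctional_simps[OF \<phi>(1)[OF b]])
      also have "\<dots> = (\<Sum>b'\<in>B. if b' = b then u b else 0)" using \<phi>(2) b by (intro sum.cong) auto
      finally show ?thesis using finB b by simp
    qed
    then have "P x = (\<Sum>b\<in>B. u b *\<^sub>C b)" unfolding P_def by (intro sum.cong) auto
    then show ?thesis using u by simp
  qed
  define N where "N = (\<Sum>b\<in>B. L * norm b)"
  have N: "0 \<le> N" unfolding N_def using \<phi>(3) by (intro sum_nonneg) auto
  have P_bd: "norm (P x) \<le> N * norm x" for x
    unfolding P_def N_def sum_distrib_right
  proof (rule sum_norm_le)
    fix b assume "b \<in> B"
    then have "cmod (\<phi> b x) * norm b \<le> (L * norm x) * norm b" using \<phi>(4) by (intro mult_right_mono) auto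
    then show "norm (\<phi> b x *\<^sub>C b) \<le> L * norm b * norm x" by (simp add: norm_scaleC mult_ac)
  qed
  interpret P: Vector_Spaces.linear scaleC scaleC P by (rule P_lin)
  \<comment> \<open>If \<open>P x = 0\<close>, a bounded preimage \<open>v\<close> of
    \<open>S a x\<close> gives \<open>x = v - P v\<close>, and
    \<open>norm (P v) \<le> N * norm v\<close>.\<close>
  define C' where "C' = (1 + N) * C"
  have C': "C' > 0" using N C(1) by (simp add: C'_def)
  have below: "norm x \<le> C' * norm (S a x)" if x: "x \<in> K" "P x = 0" for x
  proof -
    obtain v where v: "v \<in> K" "S a v = S a x" "norm v \<le> C * norm (S a x)" using C(2) x(1) K(2) by blast
    have "v - x \<in> ker_on K (S a)"
      using v x K(1) by (simp add: ker_on_def complex_vector.subspace_diff bounded_ops_UNIV_simps[OF S(1)])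
    then have "v - x = P v" using P_id[of "v - x"] P.diff[of v x] x(2) by simp
    then have "x = v - P v" by (simp add: algebra_simps)
    then have "norm x \<le> norm v + norm (P v)" by (metis norm_triangle_ineq4)
    also have "\<dots> \<le> (1 + N) * norm v" using P_bd[of v] by (simp add: algebra_simps)
    also have "\<dots> \<le> (1 + N) * (C * norm (S a x))" using v(3) N by (intro mult_left_mono) auto
    finally show ?thesis by (simp add: C'_def mult.assoc)
  qed
  show ?thesis
  proof (intro exI[of _ "1 / C'"] conjI allI impI)
    show "1 / C' > 0" using C' by simp
    fix z assume z: "cmod (z - a) < 1 / C'"
    \<comment> \<open>So \<open>P\<close> embeds the kernel of \<open>S z\<close> into that of
      \<open>S a\<close>, which bounds its dimension by \<open>card B\<close>.\<close>
    have inj: "x = 0" if x: "x \<in> ker_on K (S z)" "P x = 0" for x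
    proof (rule ccontr)
      assume "x \<noteq> 0"
      have xK: "x \<in> K" "S z x = 0" using x(1) by (auto simp: ker_on_def)
      then have "S a x = (z - a) *\<^sub>C x" using S(2)[of a x z] by simp
      then have "norm x \<le> C' * (cmod (z - a) * norm x)" using below[OF xK(1) x(2)] by (simp add: norm_scaleC)
      then have "1 \<le> C' * cmod (z - a)" using \<open>x \<noteq> 0\<close> by simp
      then show False using z C' by (simp add: field_simps)
    qed
    show "nullity K (S z) < enat m"
    proof (rule ccontr)
      assume "\<not> nullity K (S z) < enat m"
      then have "enat m \<le> nullity K (S z)" by simp
      then obtain D where D: "D \<subseteq> ker_on K (S z)" "finite D" "\<not> cdependent D" "card D = m"
        unfolding nullity_def ecdim_ge_iff[OF csubspace_ker_on[OF S(1) K(1)]] by blast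
      have "cspan D \<subseteq> ker_on K (S z)"
        using D(1) by (intro complex_vector.span_minimal csubspace_ker_on[OF S(1) K(1)])
      then have "card D \<le> card B"
        using inj P_ker B(3) finB D by (intro linear_scaleC_image_independent[OF P_lin]) auto
      then show False using D(4) cardB by simp
    qed
  qed
qed

text \<open>Functionals annihilating the range of \<open>S a\<close> and dual to \<open>B\<close>
  are small on the range of \<open>S z\<close>: \<open>S z v\<close> differs from
  \<open>S a v\<close> by a multiple \<open>a - z\<close> of \<open>v\<close>, and \<open>v\<close>
  can be chosen bounded by its image. A nontrivial combination of \<open>B\<close> in that range
  contradicts this at its largest coefficient.\<close>

lemma defect_lower_stable:
  fixes S :: "complex \<Rightarrow> 'a::complex_banach \<Rightarrow> 'a"
  assumes S: "\<And>\<mu>. S \<mu> \<in> bounded_ops UNIV" "\<And>\<mu> \<nu> x. S \<mu> x - S \<nu> x = (\<nu> - \<mu>) *\<^sub>C x"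
    and M: "csubspace M" "\<And>\<mu>. S \<mu> ` M \<subseteq> M" "closed (S a ` M)"
    and C: "C > 0" "\<And>\<mu> x. cmod \<mu> < \<epsilon> \<Longrightarrow> x \<in> M \<Longrightarrow> \<exists>v\<in>M. S \<mu> v = S \<mu> x \<and> norm v \<le> C * norm (S \<mu> x)"
    and a: "enat m \<le> defect M (S a)"
  shows "\<exists>\<delta>>0. \<forall>z. cmod z < \<epsilon> \<and> cmod (z - a) < \<delta> \<longrightarrow> enat m \<le> defect M (S z)"
proof -
  have R: "csubspace (S \<mu> ` M)" for \<mu> by (rule csubspace_image[OF S(1) M(1)])
  obtain B where B: "B \<subseteq> M" "finite B" "indep_mod (S a ` M) B" "card B = m"
    using a unfolding defect_def codim_ge_iff[OF R M(2,1)] by blast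
  obtain \<phi> L where \<phi>: "\<And>b. b \<in> B \<Longrightarrow> cfunctional (\<phi> b)" "\<And>b y. b \<in> B \<Longrightarrow> y \<in> S a ` M \<Longrightarrow> \<phi> b y = 0"
    "\<And>a b. a \<in> B \<Longrightarrow> b \<in> B \<Longrightarrow> \<phi> a b = (if a = b then 1 else 0)"
    "L > 0" "\<And>b x. b \<in> B \<Longrightarrow> cmod (\<phi> b x) \<le> L * norm x"
    by (rule dual_functionals[OF M(3) R B(2,3)]) (rule that; blast)
  define N where "N = (\<Sum>b\<in>B. norm b) + 1"
  have N: "N > 0" unfolding N_def using sum_nonneg[of B norm] by simp
  \<comment> \<open>\<open>N\<close> already sums the norms of all members of \<open>B\<close>, so
    no factor \<open>m\<close> appears here.\<close>
  define D where "D = L * C * N"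
  have D: "D > 0" using \<phi>(4) C(1) N by (simp add: D_def)
  show ?thesis
  proof (intro exI[of _ "1 / D"] conjI allI impI)
    show "1 / D > 0" using D by simp
    fix z assume z: "cmod z < \<epsilon> \<and> cmod (z - a) < 1 / D"
    have "indep_mod (S z ` M) B"
    proof (rule indep_modI[OF R B(2)], rule ccontr)
      fix c assume "(\<Sum>b\<in>B. c b *\<^sub>C b) \<in> S z ` M"
      then obtain x where x: "x \<in> M" "S z x = (\<Sum>b\<in>B. c b *\<^sub>C b)" by auto
      assume "\<not> (\<forall>b\<in>B. c b = 0)"
      then obtain b where b: "b \<in> B" "c b \<noteq> 0" "\<And>a. a \<in> B \<Longrightarrow> cmod (c a) \<le> cmod (c b)"
        using finite_max_coefficient[OF B(2)] by blast
      note ph = cfunctional_simps[OF \<phi>(1)[OF b(1)]]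
      obtain v where v: "v \<in> M" "S z v = (\<Sum>b\<in>B. c b *\<^sub>C b)" "norm v \<le> C * norm (\<Sum>b\<in>B. c b *\<^sub>C b)"
        using C(2)[of z x] z x by auto
      have "norm (\<Sum>b\<in>B. c b *\<^sub>C b) \<le> (\<Sum>x\<in>B. cmod (c b) * norm x)"
        by (rule sum_norm_le) (auto simp: norm_scaleC intro!: mult_right_mono b)
      also have "\<dots> \<le> cmod (c b) * N" by (simp add: N_def distrib_left flip: sum_distrib_left)
      finally have "C * norm (\<Sum>b\<in>B. c b *\<^sub>C b) \<le> C * (cmod (c b) * N)" using C(1) by (intro mult_left_mono) auto
      then have nv: "norm v \<le> C * (cmod (c b) * N)" using v(3) by linarith
      have "c b = (\<Sum>x\<in>B. if x = b then c b else 0)" using B(2) b(1) by simp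
      also have "\<dots> = (\<Sum>x\<in>B. c x * \<phi> b x)" using \<phi>(3) b(1) by (intro sum.cong) auto
      also have "\<dots> = \<phi> b (S z v)" by (simp add: v(2) ph)
      also have "S z v = S a v + (a - z) *\<^sub>C v" using S(2)[of z v a] by (simp add: algebra_simps)
      also have "\<phi> b (S a v + (a - z) *\<^sub>C v) = (a - z) * \<phi> b v" using \<phi>(2)[OF b(1)] v(1) by (simp add: ph)
      finally have "cmod (c b) = cmod (z - a) * cmod (\<phi> b v)" by (metis norm_minus_commute norm_mult)
      also have "\<dots> \<le> cmod (z - a) * (L * (C * (cmod (c b) * N)))"
        using order_trans[OF \<phi>(5)[OF b(1), of v] mult_left_mono[OF nv]] \<phi>(4) by (intro mult_left_mono) auto
      also have "\<dots> = cmod (c b) * (cmod (z - a) * D)" by (simp add: D_def mult_ac)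
      finally have "1 \<le> cmod (z - a) * D" using b(2) by simp
      then show False using z D by (simp add: field_simps)
    qed
    then show "enat m \<le> defect M (S z)"
      unfolding defect_def codim_ge_iff[OF R M(2,1)] using B by blast
  qed
qed

text \<open>Finite defect is surjectivity onto \<open>M\<close> of the map taking
  \<open>(x, w)\<close> to \<open>S a x + w\<close>, with \<open>w\<close> in the span of a finite
  \<open>F\<close>. Surjectivity survives small perturbations, so the same \<open>F\<close>
  supplements the range of every nearby \<open>S z\<close>.\<close>

lemma defect_upper_stable:
  fixes S :: "complex \<Rightarrow> 'a::complex_banach \<Rightarrow> 'a"
  assumes S: "\<And>\<mu>. S \<mu> \<in> bounded_ops UNIV" "\<And>\<mu> \<nu> x. S \<mu> x - S \<nu> x = (\<nu> - \<mu>) *\<^sub>C x"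
    and M: "closed M" "csubspace M" "\<And>\<mu>. S \<mu> ` M \<subseteq> M"
    and a: "defect M (S a) < enat m"
  shows "\<exists>\<delta>>0. \<forall>z. cmod (z - a) < \<delta> \<longrightarrow> defect M (S z) < enat m"
proof -
  obtain F where F: "F \<subseteq> M" "finite F" "M \<subseteq> cspan (S a ` M \<union> F)" "card F < m"
    using a unfolding defect_def codim_less_iff by blast
  define Z where "Z = M \<times> cspan F"
  define f where "f \<mu> p = S \<mu> (fst p) + snd p" for \<mu> and p :: "'a \<times> 'a"
  have bl: "bounded_linear (f \<mu>)" for \<mu> unfolding f_def
    using bounded_linear_add bounded_linear_compose[OF bounded_ops_UNIV_linear[OF S(1)[of \<mu>]] bounded_linear_fst]
      bounded_linear_snd by blast
  have FM: "cspan F \<subseteq> M" using F(1) M(2) by (rule complex_vector.span_minimal)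
  have Z: "closed Z" "subspace Z"
    using M closed_cspan_finite[OF F(2)] unfolding Z_def
    by (auto intro!: closed_Times subspace_Times csubspace_imp_subspace complex_vector.subspace_span)
  have fZ: "f \<mu> ` Z \<subseteq> M" for \<mu>
  proof -
    have "S \<mu> x + y \<in> M" if "x \<in> M" "y \<in> cspan F" for x y
      using that M(3)[of \<mu>] FM by (intro complex_vector.subspace_add[OF M(2)]) auto
    then show ?thesis by (auto simp: Z_def f_def)
  qed
  have "M \<subseteq> f a ` Z"
  proof
    fix y assume "y \<in> M"
    then obtain r s where rs: "y = r + s" "r \<in> cspan (S a ` M)" "s \<in> cspan F"
      using F(3) unfolding complex_vector.span_Un by blast
    moreover have "r \<in> S a ` M"
      using rs(2) csubspace_image[OF S(1) M(2)] by (simp add: complex_vector.span_eq_iff[THEN iffD2])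
    ultimately show "y \<in> f a ` Z" by (force simp: Z_def f_def)
  qed
  then have fa: "f a ` Z = M" using fZ by blast
  obtain C where C: "C > 0" "\<And>y. y \<in> M \<Longrightarrow> \<exists>x\<in>Z. f a x = y \<and> norm x \<le> C * norm y"
    using open_mapping_subspace[OF bl[of a] Z] M(1) unfolding fa by blast
  show ?thesis
  proof (intro exI[of _ "1 / (2 * C)"] conjI allI impI)
    show "1 / (2 * C) > 0" using C by simp
    fix z assume z: "cmod (z - a) < 1 / (2 * C)"
    have "y \<in> cspan (S z ` M \<union> F)" if y: "y \<in> M" for y
    proof -
      have "\<exists>p\<in>Z. f z p = y \<and> norm p \<le> 2 * C * norm y"
      proof (rule surj_perturbation[OF bl Z _ _ _ C(2) _ _ _ y])
        show "C * cmod (z - a) \<le> 1 / 2" using z C(1) by (simp add: field_simps)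
        show "norm (f a p - f z p) \<le> cmod (z - a) * norm p" for p
        proof -
          have "f a p - f z p = (z - a) *\<^sub>C fst p" using S(2)[of a "fst p" z] by (simp add: f_def)
          then show ?thesis using norm_fst_le[of "fst p" "snd p"] by (simp add: norm_scaleC mult_left_mono)
        qed
      qed (use M fZ C csubspace_imp_subspace in auto)
      then obtain p where p: "fst p \<in> M" "snd p \<in> cspan F" "S z (fst p) + snd p = y"
        by (auto simp: Z_def f_def)
      have "S z (fst p) \<in> cspan (S z ` M \<union> F)" using p(1) by (intro complex_vector.span_base) blast
      moreover have "snd p \<in> cspan (S z ` M \<union> F)" using p(2) complex_vector.span_mono[of F "S z ` M \<union> F"] by blast
      ultimately show ?thesis using p(3) complex_vector.span_add by metis
    qed
    then show "defect M (S z) < enat m" unfolding defect_def codim_less_iff using F by blast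
  qed
qed

context kato_operator
begin

text \<open>The kernel of \<open>T - \<mu>\<close> in \<open>M\<close> lies in the core because
  \<open>0\<close> does, so nullity is counted there, where the operators are onto with a uniform
  bound. Defect is counted on \<open>M\<close>, where the bounded liftings supply closed ranges and
  the stability of lower bounds.\<close>

theorem punctured_neighbourhood:
  obtains \<epsilon> where "\<epsilon> > 0"
    "\<And>\<mu>. cmod \<mu> < \<epsilon> \<Longrightarrow> nullity M (\<lambda>x. T x - \<mu> *\<^sub>C x) = nullity M T"
    "\<And>\<mu>. cmod \<mu> < \<epsilon> \<Longrightarrow> defect M (\<lambda>x. T x - \<mu> *\<^sub>C x) = defect M T"
    "\<And>\<mu> x. cmod \<mu> < \<epsilon> \<Longrightarrow> x \<in> M \<Longrightarrow> T x - \<mu> *\<^sub>C x \<in> core \<Longrightarrow> x \<in> core"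
    "\<And>\<mu>. cmod \<mu> < \<epsilon> \<Longrightarrow> (\<lambda>x. T x - \<mu> *\<^sub>C x) ` core = core"
proof -
  obtain \<epsilon> C where e: "\<epsilon> > 0" "C > 0"
    and surj: "\<And>\<mu> y. cmod \<mu> < \<epsilon> \<Longrightarrow> y \<in> core \<Longrightarrow> \<exists>x\<in>core. T x - \<mu> *\<^sub>C x = y \<and> norm x \<le> C * norm y"
    and pre: "\<And>\<mu> x. cmod \<mu> < \<epsilon> \<Longrightarrow> x \<in> M \<Longrightarrow> T x - \<mu> *\<^sub>C x \<in> core \<Longrightarrow> x \<in> core"
    and lift: "\<And>\<mu> x. cmod \<mu> < \<epsilon> \<Longrightarrow> x \<in> M \<Longrightarrow>
       \<exists>v\<in>M. T v - \<mu> *\<^sub>C v = T x - \<mu> *\<^sub>C x \<and> norm v \<le> C * norm (T x - \<mu> *\<^sub>C x)"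
    using uniform_estimates by metis
  define S where "S \<mu> x = T x - \<mu> *\<^sub>C x" for \<mu> x
  have S: "S \<mu> \<in> bounded_ops UNIV" "S \<mu> x - S \<nu> x = (\<nu> - \<mu>) *\<^sub>C x" for \<mu> \<nu> x
    unfolding S_def using shift_in_bounded_ops[OF T] by (auto simp: complex_vector.scale_left_diff_distrib)
  have surj': "\<exists>x\<in>core. S \<mu> x = y \<and> norm x \<le> C * norm y" if "cmod \<mu> < \<epsilon>" "y \<in> core" for \<mu> y
    using surj[OF that] by (simp add: S_def)
  have lift': "\<exists>v\<in>M. S \<mu> v = S \<mu> x \<and> norm v \<le> C * norm (S \<mu> x)" if "cmod \<mu> < \<epsilon>" "x \<in> M" for \<mu> x
    using lift[OF that] by (simp add: S_def)
  have S0: "S 0 = T" by (simp add: S_def fun_eq_iff)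
  have SM: "S \<mu> ` M \<subseteq> M" for \<mu>
    using M by (auto simp: S_def intro!: complex_vector.subspace_diff complex_vector.subspace_scale)
  have Score: "S \<mu> ` core \<subseteq> core" for \<mu>
    using image_core csubspace_core by (auto simp: S_def intro!: complex_vector.subspace_diff complex_vector.subspace_scale)
  have clSM: "closed (S \<mu> ` M)" if "cmod \<mu> < \<epsilon>" for \<mu>
    using lift'[OF that] e(2)
    by (intro closed_range_if_bounded_preimages[OF bounded_ops_UNIV_linear[OF S(1)] M(1) csubspace_imp_subspace[OF M(2)], of C])
       auto
  have ker: "nullity M (S \<mu>) = nullity core (S \<mu>)" if \<mu>: "cmod \<mu> < \<epsilon>" for \<mu>
  proof -
    have "ker_on M (S \<mu>) = ker_on core (S \<mu>)"
      using pre[OF \<mu>] core_subset complex_vector.subspace_0[OF csubspace_core] by (auto simp: ker_on_def S_def)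
    then show ?thesis by (simp add: nullity_def)
  qed
  have null: "nullity core (S \<mu>) = nullity core (S 0)" if \<mu>: "cmod \<mu> < \<epsilon>" for \<mu>
  proof (rule enat_eqI_le)
    fix m
    show "(enat m \<le> nullity core (S \<mu>)) = (enat m \<le> nullity core (S 0))"
    proof (rule locally_constant_on_ball[where P = "\<lambda>\<mu>. enat m \<le> nullity core (S \<mu>)", OF _ \<mu>])
      fix a assume a: "cmod a < \<epsilon>"
      show "\<exists>\<delta>>0. \<forall>z. cmod z < \<epsilon> \<and> cmod (z - a) < \<delta> \<longrightarrow>
        (enat m \<le> nullity core (S z)) = (enat m \<le> nullity core (S a))"
      proof (cases "enat m \<le> nullity core (S a)")
        case True
        then show ?thesis
          using nullity_lower_stable[OF S csubspace_core e(2) surj' True] by simp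
      next
        case False
        then have "nullity core (S a) < enat m" by simp
        from nullity_upper_stable[OF S csubspace_core Score e(2) surj'[OF a] this]
        obtain \<delta> where "\<delta> > 0" "\<And>z. cmod (z - a) < \<delta> \<Longrightarrow> nullity core (S z) < enat m"
          by blast
        then show ?thesis using False by (intro exI[of _ \<delta>]) (auto simp flip: not_less)
      qed
    qed (use e in simp)
  qed
  have def: "defect M (S \<mu>) = defect M (S 0)" if \<mu>: "cmod \<mu> < \<epsilon>" for \<mu>
  proof (rule enat_eqI_le)
    fix m
    show "(enat m \<le> defect M (S \<mu>)) = (enat m \<le> defect M (S 0))"
    proof (rule locally_constant_on_ball[where P = "\<lambda>\<mu>. enat m \<le> defect M (S \<mu>)", OF _ \<mu>])
      fix a assume a: "cmod a < \<epsilon>"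
      show "\<exists>\<delta>>0. \<forall>z. cmod z < \<epsilon> \<and> cmod (z - a) < \<delta> \<longrightarrow>
        (enat m \<le> defect M (S z)) = (enat m \<le> defect M (S a))"
      proof (cases "enat m \<le> defect M (S a)")
        case True
        then show ?thesis
          using defect_lower_stable[OF S M(2) SM clSM[OF a] e(2) lift' True] by simp
      next
        case False
        then have "defect M (S a) < enat m" by simp
        from defect_upper_stable[OF S M(1,2) SM this]
        obtain \<delta> where "\<delta> > 0" "\<And>z. cmod (z - a) < \<delta> \<Longrightarrow> defect M (S z) < enat m" by blast
        then show ?thesis using False by (intro exI[of _ \<delta>]) (auto simp flip: not_less)
      qed
    qed (use e in simp)
  qed
  show ?thesis
  proof (rule that[OF e(1)])
    fix \<mu> assume \<mu>: "cmod \<mu> < \<epsilon>"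
    have S_eq: "(\<lambda>x. T x - \<mu> *\<^sub>C x) = S \<mu>" by (simp add: S_def fun_eq_iff)
    show "nullity M (\<lambda>x. T x - \<mu> *\<^sub>C x) = nullity M T"
      using null[OF \<mu>] ker[OF \<mu>] ker[of 0] e(1) unfolding S0 S_eq by simp
    show "defect M (\<lambda>x. T x - \<mu> *\<^sub>C x) = defect M T"
      using def[OF \<mu>] unfolding S0 S_eq by simp
    show "x \<in> core" if "x \<in> M" "T x - \<mu> *\<^sub>C x \<in> core" for x using pre[OF \<mu> that] .
    show "(\<lambda>x. T x - \<mu> *\<^sub>C x) ` core = core"
      using Score[of \<mu>] surj[OF \<mu>] unfolding S_def by blast
  qed
qed

end

subsection \<open>Kato's decomposition of semi-Fredholm operators\<close>

lemma codim_finite_iff: "codim_in Y R < \<infinity> \<longleftrightarrow> (\<exists>F\<subseteq>Y. finite F \<and> Y \<subseteq> cspan (R \<union> F))"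
  unfolding codim_in_def INF_less_iff by auto

lemma ecdim_finite_iff: "ecdim V < \<infinity> \<longleftrightarrow> (\<exists>B. finite B \<and> V \<subseteq> cspan B)"
  by (simp add: ecdim_def)

lemma finite_basis_exists:
  assumes V: "csubspace V" "ecdim V < \<infinity>"
  obtains B where "finite B" "B \<subseteq> V" "V = cspan B"
proof -
  obtain F where F: "finite F" "V \<subseteq> cspan F" using V(2) unfolding ecdim_finite_iff by blast
  obtain B where B: "B \<subseteq> V" "\<not> cdependent B" "V \<subseteq> cspan B"
    using complex_vector.maximal_independent_subset by blast
  have "finite B" using complex_vector.independent_span_bound[OF F(1) B(2)] B(1) F(2) by blast
  moreover have "V = cspan B" using B complex_vector.span_minimal[OF B(1) V(1)] by blast
  ultimately show ?thesis using that B(1) by blast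
qed

text \<open>With a finite-dimensional complement \<open>W\<close> of the range, the map taking
  \<open>(x, w)\<close> to \<open>S x + w\<close> has bounded preimages. They bound the
  \<open>W\<close>-component of \<open>y\<close> by the distance from \<open>y\<close> to the range,
  so this component vanishes for \<open>y\<close> in the closure.\<close>

lemma closed_range_finite_codim:
  fixes S :: "'a::complex_banach \<Rightarrow> 'a"
  assumes S: "S \<in> bounded_ops UNIV" and M: "closed M" "csubspace M" "S ` M \<subseteq> M"
    and fin: "codim_in M (S ` M) < \<infinity>"
  shows "closed (S ` M)"
proof -
  note R = csubspace_image[OF S M(2)]
  note S_simps = bounded_ops_UNIV_simps[OF S]
  obtain W where W: "csubspace W" "S ` M \<inter> W = {0}" "M = {r + w |r w. r \<in> S ` M \<and> w \<in> W}"
    using complement_extends[OF R M(3,2), of "{}"] by (auto simp: indep_mod_def)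
  have WM: "W \<subseteq> M" using W(3) complex_vector.subspace_0[OF R] by force
  have "ecdim W < \<infinity>" using fin unfolding codim_in_eq_ecdim_complement[OF R W] .
  then have clW: "closed W" using finite_basis_exists[OF W(1)] closed_cspan_finite by metis
  define f where "f p = S (fst p) + snd p" for p :: "'a \<times> 'a"
  have bl: "bounded_linear f" unfolding f_def
    using bounded_linear_add bounded_linear_compose[OF bounded_ops_UNIV_linear[OF S] bounded_linear_fst]
      bounded_linear_snd by blast
  have fM: "f ` (M \<times> W) = M"
  proof (intro antisym subsetI)
    fix y assume "y \<in> f ` (M \<times> W)"
    then obtain a b where ab: "a \<in> M" "b \<in> W" "y = S a + b" by (auto simp: f_def)
    then have "S a \<in> M" "b \<in> M" using M(3) WM by auto
    then show "y \<in> M" unfolding ab(3) by (rule complex_vector.subspace_add[OF M(2)])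
  next
    fix y assume "y \<in> M"
    then obtain x w where "x \<in> M" "w \<in> W" "y = S x + w" using W(3) by blast
    then show "y \<in> f ` (M \<times> W)" by (force simp: f_def)
  qed
  have "closed (M \<times> W)" "subspace (M \<times> W)"
    using M clW W(1) by (auto intro!: closed_Times subspace_Times csubspace_imp_subspace)
  then obtain C where C: "C > 0" "\<And>y. y \<in> M \<Longrightarrow> \<exists>p\<in>M \<times> W. f p = y \<and> norm p \<le> C * norm y"
    using open_mapping_subspace[OF bl, of "M \<times> W"] M(1) unfolding fM by blast
  have "y \<in> S ` M" if y: "y \<in> closure (S ` M)" for y
  proof -
    have "y \<in> M" using y closure_minimal[OF M(3,1)] by blast
    then obtain a w where aw: "a \<in> M" "w \<in> W" "y = S a + w" using W(3) by blast
    \<comment> \<open>The \<open>W\<close>-component of \<open>y - S x\<close> is again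
      \<open>w\<close>, whichever \<open>x\<close> is chosen.\<close>
    have le: "norm w \<le> C * dist (S x) y" if x: "x \<in> M" for x
    proof -
      have "y - S x \<in> M" using \<open>y \<in> M\<close> x M by (intro complex_vector.subspace_diff) auto
      then obtain u v where uv: "u \<in> M" "v \<in> W" "S u + v = y - S x" "norm (u, v) \<le> C * norm (y - S x)"
        using C(2)[of "y - S x"] by (auto simp: f_def)
      have "S (x + u - a) = S x + (y - S x - v) - (y - w)"
        using uv(3) aw(3) by (simp add: S_simps algebra_simps)
      then have "w - v = S (x + u - a)" by simp
      moreover have "x + u - a \<in> M" using x uv(1) aw(1) M(2)
        by (intro complex_vector.subspace_diff complex_vector.subspace_add)
      moreover have "w - v \<in> W" using aw(2) uv(2) W(1) by (intro complex_vector.subspace_diff)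
      ultimately have "w - v \<in> S ` M \<inter> W" by blast
      then have "w = v" using W(2) by simp
      then show ?thesis using uv(4) norm_snd_le[of v u] by (simp add: dist_norm norm_minus_commute)
    qed
    have "w = 0"
    proof (rule ccontr)
      assume "w \<noteq> 0"
      then have "norm w / C > 0" using C(1) by simp
      then obtain x where "x \<in> M" "dist (S x) y < norm w / C"
        using y unfolding closure_approachable by blast
      then show False using le[of x] C(1) by (simp add: field_simps)
    qed
    then show ?thesis using aw by simp
  qed
  then show ?thesis by (simp add: subsetI flip: closure_subset_eq)
qed

text \<open>The image of a finite supplement \<open>F\<close> of one power range supplements the
  next power range within the range of \<open>T\<close>, and \<open>G\<close> supplements the latter
  in \<open>M\<close>.\<close>

lemma codim_power_finite:
  assumes T: "T \<in> bounded_ops UNIV" and M: "T ` M \<subseteq> M"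
    and fin: "codim_in M (T ` M) < \<infinity>"
  shows "codim_in M ((T ^^ n) ` M) < \<infinity>"
proof (induction n)
  case 0
  show ?case unfolding codim_finite_iff using complex_vector.span_base by (intro exI[of _ "{}"]) auto
next
  case (Suc n)
  obtain F where F: "F \<subseteq> M" "finite F" "M \<subseteq> cspan ((T ^^ n) ` M \<union> F)" using Suc unfolding codim_finite_iff by blast
  obtain G where G: "G \<subseteq> M" "finite G" "M \<subseteq> cspan (T ` M \<union> G)" using fin unfolding codim_finite_iff by blast
  let ?H = "cspan ((T ^^ Suc n) ` M \<union> (T ` F \<union> G))"
  have "cspan ((T ^^ n) ` M \<union> F) \<subseteq> T -` ?H"
  proof (rule complex_vector.span_minimal)
    show "csubspace (T -` ?H)" by (rule csubspace_vimage[OF T complex_vector.subspace_span])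
    show "(T ^^ n) ` M \<union> F \<subseteq> T -` ?H" by (auto intro!: complex_vector.span_base)
  qed
  then have "T ` M \<union> G \<subseteq> ?H" using F(3) by (auto intro: complex_vector.span_base)
  then have "cspan (T ` M \<union> G) \<subseteq> ?H" by (intro complex_vector.span_minimal complex_vector.subspace_span)
  then have "M \<subseteq> ?H" using G(3) by blast
  moreover have "T ` F \<union> G \<subseteq> M" using F(1) G(1) M by blast
  moreover have "finite (T ` F \<union> G)" using F(2) G(2) by simp
  ultimately show ?case unfolding codim_finite_iff by blast
qed

text \<open>The power ranges need not contain the kernel, but the kernel is finite dimensional:
  adding it keeps them closed and leaves their images under \<open>T\<close> unchanged.\<close>

lemma closed_power_range_finite_nullity:
  fixes T :: "'a::complex_banach \<Rightarrow> 'a"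
  assumes T: "T \<in> bounded_ops UNIV" and M: "closed M" "csubspace M" "T ` M \<subseteq> M"
    and cl: "closed (T ` M)" and fin: "ecdim (ker_on M T) < \<infinity>"
  shows "closed ((T ^^ n) ` M)"
proof (induction n)
  case 0 then show ?case using M by simp
next
  case (Suc n)
  note ker = csubspace_ker_on[OF T M(2)]
  define Z where "Z = (T ^^ n) ` M"
  have Z: "csubspace Z" "Z \<subseteq> M" unfolding Z_def
    using csubspace_image[OF funpow_in_bounded_ops[OF T] M(2)] funpow_image_subset[OF M(3)] by auto
  obtain B where B: "finite B" "B \<subseteq> ker_on M T" "ker_on M T = cspan B" by (rule finite_basis_exists[OF ker fin])
  define V where "V = cspan (Z \<union> B)"
  have "closed (T ` V)"
  proof (rule closed_image_supset_ker[OF T M(1,2) cl])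
    show "closed V" unfolding V_def using Suc Z(1) B(1) by (intro closed_cspan_Un_finite) (auto simp: Z_def)
    show "csubspace V" unfolding V_def by (rule complex_vector.subspace_span)
    show "V \<subseteq> M" unfolding V_def using Z B(2) by (intro complex_vector.span_minimal M(2)) (auto simp: ker_on_def)
    show "ker_on M T \<subseteq> V" unfolding V_def B(3) by (rule complex_vector.span_mono) blast
  qed
  moreover have "T ` V = T ` Z"
  proof (intro antisym subsetI)
    fix y assume "y \<in> T ` V"
    then obtain r s where rs: "y = T (r + s)" "r \<in> cspan Z" "s \<in> cspan B"
      unfolding V_def complex_vector.span_Un by blast
    have "r \<in> Z" using rs(2) Z(1) by (simp add: complex_vector.span_eq_iff[THEN iffD2])
    moreover have "T s = 0" using rs(3) B(3) by (auto simp: ker_on_def)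
    ultimately show "y \<in> T ` Z" using rs(1) by (simp add: bounded_ops_UNIV_simps[OF T])
  next
    fix y assume "y \<in> T ` Z"
    then show "y \<in> T ` V" unfolding V_def using complex_vector.span_base by blast
  qed
  moreover have "(T ^^ Suc n) ` M = T ` Z" by (simp add: Z_def image_comp)
  ultimately show ?case by simp
qed

section \<open>Reducing pairs and Jordan blocks\<close>

lemma Red_D:
  assumes "(M, N) \<in> Red T"
  shows "csubspace M" "closed M" "T ` M \<subseteq> M" "csubspace N" "closed N" "T ` N \<subseteq> N" "M \<inter> N = {0}"
    "\<exists>m\<in>M. \<exists>n\<in>N. x = m + n"
proof -
  have "x \<in> {m + n | m n. m \<in> M \<and> n \<in> N}" using assms unfolding Red_def by blast
  then show "\<exists>m\<in>M. \<exists>n\<in>N. x = m + n" by blast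
qed (use assms in \<open>auto simp: Red_def\<close>)

text \<open>A chain \<open>y, T y, \<dots>, T\<^sup>q y\<close> ending in the kernel but outside the range of the next power splits
  off as a Jordan block: if \<open>f\<close> vanishes on that range and is dual to the end of the chain, the
  functionals \<open>f \<circ> T\<^sup>j\<close> are dual to the chain in reversed order.\<close>

lemma split_off_Jordan_block:
  fixes T :: "'a::complex_banach \<Rightarrow> 'a"
  assumes T: "T \<in> bounded_ops UNIV" and red: "(M, N) \<in> Red T"
    and cl: "closed ((T ^^ Suc q) ` M)"
    and y: "y \<in> M" "(T ^^ Suc q) y = 0" "(T ^^ q) y \<notin> (T ^^ Suc q) ` M"
  obtains M' N' where "(M', N') \<in> Red T" "M' \<subseteq> M" "(T ^^ Suc q) ` N' \<subseteq> N"
    "\<And>m. m \<in> M \<Longrightarrow> T m \<in> M' \<Longrightarrow> T m \<in> T ` M'"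
    "(T ^^ q) y \<notin> M'" "y \<notin> cspan (T ` M \<union> M')"
proof -
  note M = Red_D(1-3)[OF red] and N = Red_D(4-6)[OF red]
  note pow = funpow_in_bounded_ops[OF T]
  note T_simps = bounded_ops_UNIV_simps[OF T] and pow_simps = bounded_ops_UNIV_simps[OF pow]
  define R where "R = (T ^^ Suc q) ` M"
  have R: "csubspace R" unfolding R_def by (rule csubspace_image[OF pow M(1)])
  define e where "e j = (T ^^ j) y" for j
  have pow_e: "(T ^^ i) (e j) = e (i + j)" for i j by (simp add: e_def funpow_add)
  have T_e: "T (e j) = e (Suc j)" for j by (simp add: e_def)
  have e0: "e j = 0" if "j > q" for j
  proof -
    have "e (Suc q) = 0" using y(2) by (simp add: e_def)
    moreover have "e j = (T ^^ (j - Suc q)) (e (Suc q))" using that by (simp add: pow_e)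
    ultimately show ?thesis by (simp add: pow_simps)
  qed
  have eM: "e j \<in> M" for j unfolding e_def using funpow_image_subset[OF M(3)] y(1) by blast
  have pow_R: "(T ^^ i) x \<in> R" if xR: "x \<in> R" for i x
  proof -
    obtain z where z: "z \<in> M" "x = (T ^^ Suc q) z" using xR unfolding R_def by blast
    have "(T ^^ i) x = (T ^^ Suc q) ((T ^^ i) z)"
      unfolding z(2) by (metis add.commute comp_apply funpow_add)
    then show ?thesis unfolding R_def using z(1) funpow_image_subset[OF M(3), of i] by blast
  qed
  have "e q \<notin> cspan (R \<union> e ` {q - k..<q})" if "k \<le> q" for k
    using that
  proof (induction k)
    case 0
    then show ?case using y(3) R by (simp add: complex_vector.span_eq_iff[THEN iffD2] e_def R_def)
  next
    case (Suc k)
    define j where "j = q - Suc k"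
    have j: "j < q" "q - k = Suc j" "{q - Suc k..<q} = insert j {Suc j..<q}"
      using Suc.prems by (auto simp: j_def)
    show ?case
    proof
      assume "e q \<in> cspan (R \<union> e ` {q - Suc k..<q})"
      then obtain c where c: "e q - c *\<^sub>C e j \<in> cspan (R \<union> e ` {Suc j..<q})"
        unfolding j(3) by (auto simp: complex_vector.span_insert)
      show False
      proof (cases "c = 0")
        case True
        then show False using c Suc j by simp
      next
        case False
        \<comment> \<open>\<open>T ^^ (q - j)\<close> sends \<open>e j\<close> to
          \<open>e q\<close>, kills all later members of the chain and preserves \<open>R\<close>,
          so a nonzero coefficient \<open>c\<close> would put \<open>e q\<close> into
          \<open>R\<close>.\<close>
        have "cspan (R \<union> e ` {Suc j..<q}) \<subseteq> (T ^^ (q - j)) -` R"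
        proof (rule complex_vector.span_minimal[OF _ csubspace_vimage[OF pow R]])
          show "R \<union> e ` {Suc j..<q} \<subseteq> (T ^^ (q - j)) -` R"
            using pow_R complex_vector.subspace_0[OF R] by (auto simp: pow_e e0)
        qed
        then have "(T ^^ (q - j)) (e q - c *\<^sub>C e j) \<in> R" using c by blast
        then have "- (c *\<^sub>C e q) \<in> R" using j(1) by (simp add: pow_simps pow_e e0)
        then have "(- 1 / c) *\<^sub>C (- (c *\<^sub>C e q)) \<in> R" by (rule complex_vector.subspace_scale[OF R])
        then have "e q \<in> R" using False by simp
        then show False using y(3) by (simp add: e_def R_def)
      qed
    qed
  qed
  from this[of q] have "e q \<notin> cspan (R \<union> e ` {..<q})" by (simp add: lessThan_atLeast0)
  moreover have "closed (cspan (R \<union> e ` {..<q}))"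
    using cl R by (intro closed_cspan_Un_finite) (auto simp: R_def)
  ultimately obtain f where f: "cfunctional f" "\<And>z. z \<in> cspan (R \<union> e ` {..<q}) \<Longrightarrow> f z = 0" "f (e q) = 1"
    using separating_cfunctional complex_vector.subspace_span by metis
  note f_simps = cfunctional_simps[OF f(1)]
  have fR: "f z = 0" if "z \<in> R" for z using that by (intro f(2) complex_vector.span_base) blast
  have fe: "f (e k) = (if k = q then 1 else 0)" for k
  proof -
    consider "k < q" | "k = q" | "k > q" by linarith
    then show ?thesis
    proof cases
      case 1
      then have "f (e k) = 0" by (intro f(2) complex_vector.span_base) blast
      then show ?thesis using 1 by simp
    qed (use f(3) f_simps e0 in auto)
  qed
  \<comment> \<open>\<open>M'\<close> is the part of \<open>M\<close> on which the functionals
    \<open>f \<circ> T ^^ j\<close> vanish. On \<open>M\<close>, \<open>P\<close> projects onto the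
    span of the chain along \<open>M'\<close>; the functional with \<open>q - j\<close> iterations
    is the one dual to \<open>e j\<close>.\<close>
  define M' where "M' = {x \<in> M. \<forall>j\<le>q. f ((T ^^ j) x) = 0}"
  define N' where "N' = cspan (N \<union> e ` {..q})"
  define P where "P x = (\<Sum>j\<le>q. f ((T ^^ (q - j)) x) *\<^sub>C e j)" for x
  have M'_sub: "csubspace M'"
    using M(1) unfolding M'_def complex_vector.subspace_def by (auto simp: pow_simps f_simps)
  have fpow_P: "f ((T ^^ i) (P x)) = f ((T ^^ i) x)" if i: "i \<le> q" for i x
  proof -
    have "f ((T ^^ i) (P x)) = (\<Sum>j\<le>q. f ((T ^^ (q - j)) x) * f (e (i + j)))"
      by (simp add: P_def pow_simps f_simps pow_e)
    also have "\<dots> = (\<Sum>j\<le>q. if j = q - i then f ((T ^^ i) x) else 0)"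
      using i by (intro sum.cong) (auto simp: fe)
    finally show ?thesis by simp
  qed
  have PM: "P x \<in> M" for x unfolding P_def using eM M(1)
    by (intro complex_vector.subspace_sum complex_vector.subspace_scale)
  have PN': "P x \<in> N'" for x unfolding P_def N'_def
    by (intro complex_vector.span_sum complex_vector.span_scale complex_vector.span_base) auto
  have P_e: "P (e k) = e k" if k: "k \<le> q" for k
  proof -
    have "P (e k) = (\<Sum>j\<le>q. if j = k then e k else 0)"
      unfolding P_def using k by (intro sum.cong) (auto simp: pow_e fe)
    then show ?thesis using k by simp
  qed
  have P_span: "P s = s" if s: "s \<in> cspan (e ` {..q})" for s
  proof -
    have "csubspace {s. P s = s}"
      by (auto simp: complex_vector.subspace_def P_def pow_simps f_simps complex_vector.scale_left_distrib
          sum.distrib complex_vector.scale_sum_right)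
         (metis (no_types, lifting) complex_vector.scale_scale complex_vector.scale_sum_right sum.cong)
    then have "cspan (e ` {..q}) \<subseteq> {s. P s = s}" using P_e by (intro complex_vector.span_minimal) auto
    then show ?thesis using s by blast
  qed
  have diff_P: "m - P m \<in> M'" if "m \<in> M" for m
    using that PM M(1) fpow_P by (auto simp: M'_def pow_simps f_simps intro: complex_vector.subspace_diff)
  show ?thesis
  proof (rule that[of M' N'])
    show "M' \<subseteq> M" by (auto simp: M'_def)
    show "(T ^^ q) y \<notin> M'" using f(3) by (auto simp: M'_def e_def[symmetric] intro!: exI[of _ 0])
    show "(T ^^ Suc q) ` N' \<subseteq> N"
    proof -
      have "N' \<subseteq> (T ^^ Suc q) -` N" unfolding N'_def
      proof (rule complex_vector.span_minimal[OF _ csubspace_vimage[OF pow N(1)]])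
        show "N \<union> e ` {..q} \<subseteq> (T ^^ Suc q) -` N"
          using funpow_image_subset[OF N(3), of "Suc q"] complex_vector.subspace_0[OF N(1)]
          by (auto simp: pow_e e0 simp del: funpow.simps)
      qed
      then show ?thesis by blast
    qed
    show "T m \<in> T ` M'" if m: "m \<in> M" "T m \<in> M'" for m
    proof -
      \<comment> \<open>\<open>e q\<close> lies in the kernel, so the correction does not change
        \<open>T m\<close>. It repairs the one condition, \<open>j = 0\<close>, that is not
        inherited from \<open>T m\<close>.\<close>
      define m' where "m' = m - f m *\<^sub>C e q"
      have "f ((T ^^ j) m') = 0" if "j \<le> q" for j
      proof (cases j)
        case 0
        then show ?thesis by (simp add: m'_def f_simps f(3))
      next
        case (Suc i)
        then have "f ((T ^^ i) (T m)) = 0" using m(2) that by (simp add: M'_def)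
        then have "f ((T ^^ j) m) = 0" using Suc by (simp add: funpow_swap1)
        then show ?thesis using Suc by (simp add: m'_def pow_simps f_simps pow_e fe del: funpow.simps)
      qed
      moreover have "m' \<in> M" unfolding m'_def using m(1) eM M(1)
        by (intro complex_vector.subspace_diff complex_vector.subspace_scale)
      ultimately have "m' \<in> M'" by (simp add: M'_def)
      moreover have "T m' = T m" by (simp add: m'_def T_simps T_e e0)
      ultimately show ?thesis by (metis imageI)
    qed
    \<comment> \<open>\<open>f \<circ> T ^^ q\<close> vanishes on the range of \<open>T\<close> on
      \<open>M\<close> and on \<open>M'\<close> but is \<open>1\<close> at \<open>y\<close>; this
      extra vector modulo the range is what lowers the defect.\<close>
    show "y \<notin> cspan (T ` M \<union> M')"
    proof
      assume "y \<in> cspan (T ` M \<union> M')"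
      moreover have "cspan (T ` M \<union> M') \<subseteq> {x. f ((T ^^ q) x) = 0}"
      proof (rule complex_vector.span_minimal)
        have "f ((T ^^ q) (T m)) = 0" if "m \<in> M" for m
          using that by (intro fR) (auto simp: R_def funpow_swap1)
        then show "T ` M \<union> M' \<subseteq> {x. f ((T ^^ q) x) = 0}" by (auto simp: M'_def)
        show "csubspace {x. f ((T ^^ q) x) = 0}" by (auto simp: complex_vector.subspace_def pow_simps f_simps)
      qed
      ultimately have "f ((T ^^ q) y) = 0" by blast
      then show False using f(3) by (simp add: e_def)
    qed
    show "(M', N') \<in> Red T"
      unfolding Red_def
    proof (intro CollectI case_prodI conjI)
      show "csubspace M'" by (rule M'_sub)
      show "closed M'"
      proof -
        have "M' = M \<inter> (\<Inter>j\<in>{..q}. (\<lambda>x. f ((T ^^ j) x)) -` {0})" by (auto simp: M'_def)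
        moreover have "closed ((\<lambda>x. f ((T ^^ j) x)) -` {0})" for j
        proof -
          have "bounded_linear f" using f(1) by (simp add: cfunctional_def)
          then have "bounded_linear (\<lambda>x. f ((T ^^ j) x))"
            using bounded_linear_compose bounded_ops_UNIV_linear[OF pow] by blast
          then show ?thesis by (intro closed_vimage linear_continuous_on) auto
        qed
        ultimately show ?thesis using M(2) by (auto intro!: closed_Int)
      qed
      show "T ` M' \<subseteq> M'"
      proof
        fix z assume "z \<in> T ` M'"
        then obtain x where x: "x \<in> M'" "z = T x" by blast
        have xM: "x \<in> M" using x by (simp add: M'_def)
        have "f ((T ^^ j) z) = 0" if "j \<le> q" for j
        proof (cases "j = q")
          case True
          have "(T ^^ j) z \<in> R" unfolding R_def x True using xM by (auto simp: funpow_swap1)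
          then show ?thesis by (rule fR)
        next
          case False
          then have "f ((T ^^ Suc j) x) = 0" using that x unfolding M'_def by (simp del: funpow.simps)
          then show ?thesis using x by (simp add: funpow_swap1)
        qed
        then show "z \<in> M'" using xM M(3) x by (auto simp: M'_def)
      qed
      show "csubspace N'" unfolding N'_def by (rule complex_vector.subspace_span)
      show "closed N'" unfolding N'_def using N by (intro closed_cspan_Un_finite) auto
      show "T ` N' \<subseteq> N'"
      proof -
        have "N' \<subseteq> T -` N'" unfolding N'_def
        proof (rule complex_vector.span_minimal[OF _ csubspace_vimage[OF T complex_vector.subspace_span]])
          have "e (Suc j) \<in> cspan (N \<union> e ` {..q})" if "j \<le> q" for j
            using that complex_vector.span_zero e0[of "Suc j"]
            by (cases "j = q") (simp_all add: complex_vector.span_base)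
          then show "N \<union> e ` {..q} \<subseteq> T -` cspan (N \<union> e ` {..q})"
            using N(3) by (auto simp: T_e intro!: complex_vector.span_base)
        qed
        then show ?thesis by blast
      qed
      show "M' \<inter> N' = {0}"
      proof (intro antisym subsetI)
        fix z assume z: "z \<in> M' \<inter> N'"
        then obtain n s where ns: "z = n + s" "n \<in> cspan N" "s \<in> cspan (e ` {..q})"
          unfolding N'_def complex_vector.span_Un by blast
        have n: "n \<in> N" using ns(2) N(1) by (simp add: complex_vector.span_eq_iff[THEN iffD2])
        have "s \<in> M" using ns(3) complex_vector.span_minimal[of "e ` {..q}" M] eM M(1) by blast
        then have "z - s \<in> M" using z M(1) by (intro complex_vector.subspace_diff) (auto simp: M'_def)
        then have "n = 0" using Red_D(7)[OF red] n ns(1) by auto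
        then have "z = P z" using P_span[OF ns(3)] ns(1) by simp
        also have "P z = 0" unfolding P_def using z by (intro sum.neutral) (auto simp: M'_def)
        finally show "z \<in> {0}" by simp
      next
        fix z :: 'a assume "z \<in> {0}"
        then show "z \<in> M' \<inter> N'" using complex_vector.subspace_0[OF M'_sub] complex_vector.span_zero by (simp add: N'_def)
      qed
      show "{m + n |m n. m \<in> M' \<and> n \<in> N'} = UNIV"
      proof (intro antisym subsetI UNIV_I)
        fix x :: 'a
        obtain m n where mn: "m \<in> M" "n \<in> N" "x = m + n" using Red_D(8)[OF red, of x] by blast
        have "n \<in> N'" unfolding N'_def using mn by (intro complex_vector.span_base) blast
        then have "P m + n \<in> N'" using PN'[of m] complex_vector.span_add unfolding N'_def by blast
        moreover have "x = (m - P m) + (P m + n)" using mn by simp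
        ultimately show "x \<in> {m + n |m n. m \<in> M' \<and> n \<in> N'}" using diff_P[OF mn(1)] by blast
      qed
    qed
  qed
qed

text \<open>Induction on a finite nullity or defect, with \<open>M\<close> and \<open>N\<close>
  varying. Of \<open>N'\<close> it is recorded that a power of \<open>T\<close> carries it into
  \<open>N\<close>: in this form the result passes on both nilpotency and quasinilpotency.\<close>

theorem semi_Fredholm_decomposition:
  fixes T :: "'a::complex_banach \<Rightarrow> 'a"
  assumes T: "T \<in> bounded_ops UNIV" and "(M, N) \<in> Red T" "T \<in> Phi_plus M \<union> Phi_minus M"
  shows "\<exists>M' N' p. (M', N') \<in> Red T \<and> Kato_on M' T \<and> (T ^^ p) ` N' \<subseteq> N"
proof -
  have main: "(M, N) \<in> Red T \<Longrightarrow>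
      T \<in> Phi_plus M \<and> nullity M T = enat n \<or> T \<in> Phi_minus M \<and> defect M T = enat n \<Longrightarrow>
      \<exists>M' N' p. (M', N') \<in> Red T \<and> Kato_on M' T \<and> (T ^^ p) ` N' \<subseteq> N" for n M N
  proof (induction n arbitrary: M N rule: less_induct)
    case (less n)
    note red = less.prems(1) and fred = less.prems(2)
    note M = Red_D(1-3)[OF red]
    have pow_range: "(T ^^ k) ` M \<subseteq> M" for k by (rule funpow_image_subset[OF M(3)])
    have cl: "closed ((T ^^ k) ` M)" for k
      using fred
    proof
      assume "T \<in> Phi_plus M \<and> nullity M T = enat n"
      then show ?thesis
        using closed_power_range_finite_nullity[OF T M(2,1,3)] by (simp add: Phi_plus_def nullity_def)
    next
      assume "T \<in> Phi_minus M \<and> defect M T = enat n"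
      then have "codim_in M ((T ^^ k) ` M) < \<infinity>"
        using codim_power_finite[OF T M(3)] by (simp add: Phi_minus_def defect_def)
      then show ?thesis
        by (rule closed_range_finite_codim[OF funpow_in_bounded_ops[OF T] M(2,1) pow_range])
    qed
    show ?case
    proof (cases "Kato_on M T")
      case True
      then show ?thesis using red by (intro exI[of _ M] exI[of _ N] exI[of _ 0]) simp
    next
      case False
      then have "\<exists>k. \<exists>x\<in>ker_on M T. x \<notin> (T ^^ k) ` M"
        using cl[of 1] bounded_ops_restrict[OF T M(3)] by (auto simp: Kato_on_def)
      \<comment> \<open>Since \<open>k\<close> is least, a kernel vector outside the
        \<open>k\<close>-th range still lies in the range of \<open>T ^^ q\<close> with
        \<open>k = Suc q\<close>, so it ends a chain of \<open>Suc q\<close> vectors.\<close>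
      then obtain k where k: "\<exists>x\<in>ker_on M T. x \<notin> (T ^^ k) ` M"
        "\<And>j. j < k \<Longrightarrow> \<not> (\<exists>x\<in>ker_on M T. x \<notin> (T ^^ j) ` M)"
        using exists_least_iff[of "\<lambda>k. \<exists>x\<in>ker_on M T. x \<notin> (T ^^ k) ` M"] by blast
      then obtain x where x: "x \<in> ker_on M T" "x \<notin> (T ^^ k) ` M" by blast
      have "k \<noteq> 0" using x by (auto simp: ker_on_def)
      then obtain q where q: "k = Suc q" using not0_implies_Suc by blast
      then obtain y where y: "y \<in> M" "x = (T ^^ q) y" using k(2)[of q] x(1) by auto
      have Ty: "(T ^^ Suc q) y = 0" using x(1) y(2) by (simp add: ker_on_def)
      obtain M' N' where red': "(M', N') \<in> Red T" and M'M: "M' \<subseteq> M" and N': "(T ^^ Suc q) ` N' \<subseteq> N"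
        and TM': "\<And>m. m \<in> M \<Longrightarrow> T m \<in> M' \<Longrightarrow> T m \<in> T ` M'"
        and xM': "x \<notin> M'" and yM': "y \<notin> cspan (T ` M \<union> M')"
        using split_off_Jordan_block[OF T red cl y(1) Ty] x(2) unfolding q y(2) by metis
      note M' = Red_D(1-3)[OF red']
      have b: "T \<in> bounded_ops M'" by (rule bounded_ops_restrict[OF T M'(3)])
      have ker: "ker_on M' T \<subseteq> ker_on M T" using M'M by (auto simp: ker_on_def)
      have "\<exists>l<n. T \<in> Phi_plus M' \<and> nullity M' T = enat l \<or> T \<in> Phi_minus M' \<and> defect M' T = enat l"
        using fred
      proof
        assume *: "T \<in> Phi_plus M \<and> nullity M T = enat n"
        have "\<not> enat n \<le> nullity M' T"
        proof
          assume "enat n \<le> nullity M' T"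
          then obtain B where B: "B \<subseteq> ker_on M' T" "finite B" "\<not> cdependent B" "card B = n"
            unfolding nullity_def ecdim_ge_iff[OF csubspace_ker_on[OF T M'(1)]] by blast
          have "cspan B \<subseteq> M'" using B(1) M'(1) by (intro complex_vector.span_minimal) (auto simp: ker_on_def)
          then have "x \<notin> cspan B" using xM' by blast
          then have "\<not> cdependent (insert x B)" "x \<notin> B"
            using B(3) complex_vector.independent_insertI complex_vector.span_base by blast+
          then have "enat (Suc n) \<le> nullity M T"
            unfolding nullity_def ecdim_ge_iff[OF csubspace_ker_on[OF T M(1)]]
            using B ker x(1) by (intro exI[of _ "insert x B"]) auto
          then show False using * by simp
        qed
        then have lt: "nullity M' T < enat n" by simp
        then obtain l where l: "nullity M' T = enat l" "l < n" by (cases "nullity M' T") auto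
        \<comment> \<open>A vector of \<open>M'\<close> in the old range has a preimage in
          \<open>M'\<close>; this is how closedness of the range passes to
          \<open>M'\<close>.\<close>
        have "T ` M' = T ` M \<inter> M'" using TM' M'(3) M'M by blast
        then have "closed (T ` M')" using cl[of 1] M'(2) by (simp add: closed_Int)
        then show ?thesis using l b by (auto simp: Phi_plus_def)
      next
        assume *: "T \<in> Phi_minus M \<and> defect M T = enat n"
        note R = csubspace_image[OF T M(1)] and R' = csubspace_image[OF T M'(1)]
        have "\<not> enat n \<le> defect M' T"
        proof
          assume "enat n \<le> defect M' T"
          then obtain B where B: "B \<subseteq> M'" "finite B" "indep_mod (T ` M') B" "card B = n"
            unfolding defect_def codim_ge_iff[OF R' M'(3,1)] by blast
          \<comment> \<open>By the same property, enlarging the range from that on \<open>M'\<close>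
            to that on \<open>M\<close> creates no new relations among vectors of
            \<open>M'\<close>.\<close>
          have "indep_mod (T ` M) B"
            unfolding indep_mod_def
          proof (intro ballI notI)
            fix b assume b: "b \<in> B" "b \<in> cspan (T ` M \<union> (B - {b}))"
            then obtain r s where rs: "b = r + s" "r \<in> cspan (T ` M)" "s \<in> cspan (B - {b})"
              unfolding complex_vector.span_Un by blast
            have r: "r \<in> T ` M" using rs(2) R by (simp add: complex_vector.span_eq_iff[THEN iffD2])
            have "s \<in> M'" using rs(3) B(1) complex_vector.span_minimal[of "B - {b}" M'] M'(1) by blast
            then have "b - s \<in> M'" using b(1) B(1) M'(1) by (intro complex_vector.subspace_diff) auto
            then have "r \<in> M'" using rs(1) by simp
            then have "r \<in> T ` M'" using r TM' by blast
            then have "b \<in> cspan (T ` M' \<union> (B - {b}))"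
              unfolding rs(1)[symmetric] complex_vector.span_Un using rs complex_vector.span_base by blast
            then show False using B(3) b(1) by (simp add: indep_mod_def)
          qed
          moreover have "y \<notin> cspan (T ` M \<union> B)"
            using yM' B(1) complex_vector.span_mono[of "T ` M \<union> B" "T ` M \<union> M'"] by blast
          ultimately have "indep_mod (T ` M) (insert y B)" "y \<notin> B"
            using indep_mod_insert complex_vector.span_base by blast+
          then have "enat (Suc n) \<le> defect M T"
            unfolding defect_def codim_ge_iff[OF R M(3,1)]
            using B M'M y(1) by (intro exI[of _ "insert y B"]) auto
          then show False using * by simp
        qed
        then have "defect M' T < enat n" by simp
        then obtain l where l: "defect M' T = enat l" "l < n" by (cases "defect M' T") auto
        then show ?thesis using b by (auto simp: Phi_minus_def)
      qed
      then obtain M'' N'' p where *: "(M'', N'') \<in> Red T" "Kato_on M'' T" "(T ^^ p) ` N'' \<subseteq> N'"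
        using less.IH[OF _ red'] by blast
      have "(T ^^ (Suc q + p)) ` N'' \<subseteq> N"
      proof
        fix z assume "z \<in> (T ^^ (Suc q + p)) ` N''"
        then obtain w where "w \<in> N''" "z = (T ^^ Suc q) ((T ^^ p) w)" unfolding funpow_add by auto
        then show "z \<in> N" using *(3) N' by blast
      qed
      then show ?thesis using * by blast
    qed
  qed
  have "\<exists>n. T \<in> Phi_plus M \<and> nullity M T = enat n \<or> T \<in> Phi_minus M \<and> defect M T = enat n"
    using assms(3) by (auto simp: Phi_plus_def Phi_minus_def)
  then show ?thesis using main[OF assms(2)] by blast
qed

subsection \<open>Quasinilpotent summands\<close>

lemma norm_le_onorm_on:
  assumes S: "S \<in> bounded_ops UNIV" and x: "x \<in> N"
  shows "norm (S x) \<le> onorm_on N S * norm x"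
proof (cases "x = 0")
  case True
  then show ?thesis using bounded_ops_UNIV_simps(1)[OF S] by simp
next
  case False
  have "norm (S x) / norm x \<le> onorm_on N S"
    unfolding onorm_on_def using le_onorm[OF bounded_ops_UNIV_linear[OF S]] x
    by (intro cSUP_upper bdd_aboveI2[of _ _ "onorm S"]) auto
  then show ?thesis using False by (simp add: field_simps)
qed

lemma onorm_on_nonneg:
  assumes S: "S \<in> bounded_ops UNIV" and "0 \<in> N"
  shows "0 \<le> onorm_on N S"
proof -
  \<comment> \<open>Here \<open>0 / 0 = 0\<close>, so the zero vector contributes the value
    \<open>0\<close> to the supremum.\<close>
  have "norm (S 0) / norm (0 :: 'a) \<le> onorm_on N S"
    unfolding onorm_on_def using le_onorm[OF bounded_ops_UNIV_linear[OF S]] \<open>0 \<in> N\<close>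
    by (intro cSUP_upper bdd_aboveI2[of _ _ "onorm S"]) auto
  then show ?thesis by simp
qed

lemma onorm_on_le:
  assumes "N \<noteq> {}" "0 \<le> c" "\<And>x. x \<in> N \<Longrightarrow> norm (S x) \<le> c * norm x"
  shows "onorm_on N S \<le> c"
  unfolding onorm_on_def
proof (rule cSUP_least[OF assms(1)])
  show "norm (S x) / norm x \<le> c" if "x \<in> N" for x
    using assms(3)[OF that] assms(2) by (cases "x = 0") (auto simp: field_simps)
qed

text \<open>On \<open>N'\<close> the power \<open>T ^^ (n + p)\<close> factors through
  \<open>N\<close>, so its norm is at most a constant times that of \<open>T ^^ n\<close> on
  \<open>N\<close>. The constant and the shift by \<open>p\<close> disappear under the
  roots.\<close>

lemma quasinilpotent_transfer:
  fixes T :: "'a::complex_banach \<Rightarrow> 'a"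
  assumes T: "T \<in> bounded_ops UNIV" and N: "0 \<in> N" and N': "csubspace N'" "T ` N' \<subseteq> N'"
    and p: "(T ^^ p) ` N' \<subseteq> N" and qn: "quasinilpotent_on N T"
  shows "quasinilpotent_on N' T"
proof -
  note pow = funpow_in_bounded_ops[OF T]
  have 0: "0 \<in> N'" using N'(1) by (rule complex_vector.subspace_0)
  define c where "c = onorm (T ^^ p) + 1"
  have c: "c > 0" unfolding c_def using onorm_pos_le[OF bounded_ops_UNIV_linear[OF pow], of p] by simp
  have Tp: "norm ((T ^^ p) x) \<le> c * norm x" for x
    unfolding c_def distrib_right using onorm[OF bounded_ops_UNIV_linear[OF pow], of p x] norm_ge_zero[of x] by linarith
  have le: "onorm_on N' (T ^^ (n + p)) \<le> onorm_on N (T ^^ n) * c" for n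
  proof (rule onorm_on_le)
    show "0 \<le> onorm_on N (T ^^ n) * c" using onorm_on_nonneg[OF pow N] c by simp
    fix x assume "x \<in> N'"
    then have "norm ((T ^^ n) ((T ^^ p) x)) \<le> onorm_on N (T ^^ n) * norm ((T ^^ p) x)"
      using p by (intro norm_le_onorm_on pow) auto
    also have "\<dots> \<le> onorm_on N (T ^^ n) * (c * norm x)"
      using Tp onorm_on_nonneg[OF pow N] by (intro mult_left_mono) auto
    finally show "norm ((T ^^ (n + p)) x) \<le> onorm_on N (T ^^ n) * c * norm x"
      by (simp add: funpow_add mult.assoc)
  qed (use 0 in auto)
  have "(\<lambda>n. root n (onorm_on N' (T ^^ n))) \<longlonglongrightarrow> 0"
  proof (rule LIMSEQ_I)
    fix e :: real assume e: "e > 0"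
    define d where "d = e / 2"
    have d: "d > 0" using e by (simp add: d_def)
    \<comment> \<open>Chosen so that \<open>d ^ n * c = K * d ^ m\<close> for
      \<open>m = n + p\<close>. The roots of \<open>K\<close> tend to \<open>1\<close> and are
      eventually below \<open>2\<close>, which \<open>d = e / 2\<close> compensates.\<close>
    define K where "K = c / d ^ p"
    have K: "K > 0" using c d by (simp add: K_def)
    have "\<forall>\<^sub>F n in sequentially. root n (onorm_on N (T ^^ n)) < d"
      using qn d unfolding quasinilpotent_on_def by (intro order_tendstoD) auto
    then obtain n0 where n0: "\<And>n. n \<ge> n0 \<Longrightarrow> root n (onorm_on N (T ^^ n)) < d"
      unfolding eventually_sequentially by blast
    have "\<forall>\<^sub>F n in sequentially. root n K < 2"
      using LIMSEQ_root_const[OF K] by (intro order_tendstoD) auto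
    then obtain n1 where n1: "\<And>n. n \<ge> n1 \<Longrightarrow> root n K < 2"
      unfolding eventually_sequentially by blast
    show "\<exists>no. \<forall>n\<ge>no. norm (root n (onorm_on N' (T ^^ n)) - 0) < e"
    proof (intro exI[of _ "n0 + n1 + p + 1"] allI impI)
      fix m assume m: "m \<ge> n0 + n1 + p + 1"
      define n where "n = m - p"
      have mn: "m = n + p" "n \<ge> n0" "n > 0" "m > 0" "m \<ge> n1" using m by (auto simp: n_def)
      have "onorm_on N (T ^^ n) = root n (onorm_on N (T ^^ n)) ^ n"
        using mn onorm_on_nonneg[OF pow N] by simp
      also have "\<dots> \<le> d ^ n"
        by (intro power_mono less_imp_le[OF n0[OF mn(2)]] real_root_ge_zero onorm_on_nonneg[OF pow N])
      finally have "onorm_on N (T ^^ n) * c \<le> d ^ n * c" using c by (intro mult_right_mono) auto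
      then have "onorm_on N' (T ^^ m) \<le> d ^ n * c" using le[of n] mn(1) by simp
      also have "d ^ n * c = K * d ^ m" using d by (simp add: K_def mn(1) power_add)
      finally have "root m (onorm_on N' (T ^^ m)) \<le> root m (K * d ^ m)" using mn by (intro real_root_le_mono) auto
      also have "\<dots> = root m K * d" using mn d by (simp add: real_root_mult real_root_power_cancel)
      also have "\<dots> < 2 * d" using n1[OF mn(5)] d by (intro mult_strict_right_mono) auto
      finally have "root m (onorm_on N' (T ^^ m)) < e" by (simp add: d_def)
      moreover have "root m (onorm_on N' (T ^^ m)) \<ge> 0"
        using onorm_on_nonneg[OF pow 0] by (rule real_root_ge_zero)
      ultimately show "norm (root m (onorm_on N' (T ^^ m)) - 0) < e" by simp
    qed
  qed
  then show ?thesis using bounded_ops_restrict[OF T N'(2)] by (simp add: quasinilpotent_on_def)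
qed

lemma quasinilpotent_on_0:
  assumes "T \<in> bounded_ops UNIV"
  shows "quasinilpotent_on {0} T"
proof -
  have "onorm_on {0} S = 0" for S :: "'a \<Rightarrow> 'a" by (simp add: onorm_on_def)
  moreover have "T \<in> bounded_ops {0}"
    by (rule bounded_ops_restrict[OF assms]) (simp add: bounded_ops_UNIV_simps(1)[OF assms])
  ultimately show ?thesis by (simp add: quasinilpotent_on_def)
qed

lemma nilpotent_imp_quasinilpotent:
  fixes T :: "'a::complex_banach \<Rightarrow> 'a"
  assumes T: "T \<in> bounded_ops UNIV" and N: "csubspace N" "T ` N \<subseteq> N" and nil: "nilpotent_on N T"
  shows "quasinilpotent_on N T"
proof -
  obtain p where "\<forall>x\<in>N. (T ^^ p) x = 0" using nil by (auto simp: nilpotent_on_def)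
  then have "(T ^^ p) ` N \<subseteq> {0}" by blast
  then show ?thesis using quasinilpotent_transfer[OF T _ N _ quasinilpotent_on_0[OF T]] by simp
qed

text \<open>An eigenvector for \<mu> would force the norm of \<open>T ^^ n\<close> on
  \<open>N\<close> to be at least \<open>cmod \<mu> ^ n\<close>.\<close>

lemma quasinilpotent_shift_inj:
  fixes T :: "'a::complex_banach \<Rightarrow> 'a"
  assumes T: "T \<in> bounded_ops UNIV" and qn: "quasinilpotent_on N T" and \<mu>: "\<mu> \<noteq> 0"
    and x: "x \<in> N" "T x = \<mu> *\<^sub>C x"
  shows "x = 0"
proof (rule ccontr)
  assume "x \<noteq> 0"
  note pow = funpow_in_bounded_ops[OF T]
  have Tn: "(T ^^ n) x = \<mu> ^ n *\<^sub>C x" for n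
    by (induction n) (simp_all add: bounded_ops_UNIV_simps[OF T] x(2) mult.commute)
  have "cmod \<mu> \<le> root n (onorm_on N (T ^^ n))" if n: "n \<ge> 1" for n
  proof -
    have "cmod \<mu> ^ n * norm x \<le> onorm_on N (T ^^ n) * norm x"
      using norm_le_onorm_on[OF pow x(1), of n] by (simp add: Tn norm_scaleC norm_power)
    then have "cmod \<mu> ^ n \<le> onorm_on N (T ^^ n)" using \<open>x \<noteq> 0\<close> by simp
    then have "root n (cmod \<mu> ^ n) \<le> root n (onorm_on N (T ^^ n))" using n by (intro real_root_le_mono) auto
    then show ?thesis using n by (simp add: real_root_power_cancel)
  qed
  then have "cmod \<mu> \<le> 0" using qn unfolding quasinilpotent_on_def by (intro LIMSEQ_le_const) blast+
  then show False using \<mu> by simp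
qed

text \<open>The negative of the Neumann series with terms \<open>a n\<close> solves the equation by
  telescoping; the root test has limit \<open>0\<close>, so the series converges for every nonzero
  \<mu>.\<close>

lemma quasinilpotent_shift_surj:
  fixes T :: "'a::complex_banach \<Rightarrow> 'a"
  assumes T: "T \<in> bounded_ops UNIV" and N: "closed N" "csubspace N" "T ` N \<subseteq> N"
    and qn: "quasinilpotent_on N T" and \<mu>: "\<mu> \<noteq> 0" and y: "y \<in> N"
  shows "\<exists>x\<in>N. T x - \<mu> *\<^sub>C x = y"
proof -
  note pow = funpow_in_bounded_ops[OF T]
  have 0: "0 \<in> N" using N(2) by (rule complex_vector.subspace_0)
  define a where "a n = (1 / \<mu>) ^ Suc n *\<^sub>C (T ^^ n) y" for n
  have aN: "a n \<in> N" for n unfolding a_def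
    using funpow_image_subset[OF N(3), of n] y by (intro complex_vector.subspace_scale[OF N(2)]) blast
  define b where "b n = (1 / cmod \<mu>) ^ n * onorm_on N (T ^^ n)" for n
  have b0: "0 \<le> b n" for n unfolding b_def using onorm_on_nonneg[OF pow 0] by simp
  have "summable b"
  proof (rule root_test_convergence[of _ 0])
    have "(\<lambda>n. (1 / cmod \<mu>) * root n (onorm_on N (T ^^ n))) \<longlonglongrightarrow> (1 / cmod \<mu>) * 0"
      using qn unfolding quasinilpotent_on_def by (intro tendsto_mult tendsto_const) blast
    moreover have "\<forall>\<^sub>F n in sequentially. (1 / cmod \<mu>) * root n (onorm_on N (T ^^ n)) = root n (norm (b n))"
      using eventually_gt_at_top[of 0]
    proof eventually_elim
      case (elim n)
      have "root n (norm (b n)) = root n (b n)" using b0[of n] by simp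
      also have "\<dots> = root n ((1 / cmod \<mu>) ^ n) * root n (onorm_on N (T ^^ n))" by (simp add: b_def real_root_mult)
      also have "root n ((1 / cmod \<mu>) ^ n) = 1 / cmod \<mu>" using elim by (intro real_root_power_cancel) auto
      finally show ?case by simp
    qed
    ultimately show "(\<lambda>n. root n (norm (b n))) \<longlonglongrightarrow> 0" by (auto intro: Lim_transform_eventually)
  qed simp
  then have sb: "summable (\<lambda>n. (norm y / cmod \<mu>) * b n)" by (rule summable_mult)
  have "summable a"
  proof (rule summable_comparison_test'[OF sb, of 0])
    fix n
    have "norm (a n) = (1 / cmod \<mu>) ^ Suc n * norm ((T ^^ n) y)"
      by (simp add: a_def norm_scaleC norm_power norm_divide norm_mult)
    also have "\<dots> \<le> (1 / cmod \<mu>) ^ Suc n * (onorm_on N (T ^^ n) * norm y)"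
      using norm_le_onorm_on[OF pow y] by (intro mult_left_mono) auto
    finally show "norm (a n) \<le> (norm y / cmod \<mu>) * b n" by (simp add: b_def mult_ac)
  qed
  define x where "x = - suminf a"
  have "suminf a \<in> N"
  proof (rule closed_sequentially[OF N(1)])
    show "(\<lambda>n. \<Sum>i<n. a i) \<longlonglongrightarrow> suminf a" using \<open>summable a\<close> by (rule summable_LIMSEQ)
    show "(\<Sum>i<n. a i) \<in> N" for n using aN by (intro complex_vector.subspace_sum[OF N(2)])
  qed
  then have xN: "x \<in> N" unfolding x_def by (rule complex_vector.subspace_neg[OF N(2)])
  have step: "T (a n) - \<mu> *\<^sub>C a n = \<mu> *\<^sub>C a (Suc n) - \<mu> *\<^sub>C a n" for n
    using \<mu> by (simp add: a_def bounded_ops_UNIV_simps[OF T])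
  have "(\<lambda>n. T (a n) - \<mu> *\<^sub>C a n) sums (T (suminf a) - \<mu> *\<^sub>C suminf a)"
    using bounded_linear.sums[OF bounded_ops_UNIV_linear[OF shift_in_bounded_ops[OF T]] summable_sums[OF \<open>summable a\<close>]] .
  moreover have "(\<lambda>n. T (a n) - \<mu> *\<^sub>C a n) sums (0 - \<mu> *\<^sub>C a 0)"
  proof -
    have "(\<lambda>n. \<mu> *\<^sub>C a n) \<longlonglongrightarrow> \<mu> *\<^sub>C 0"
      using bounded_linear.tendsto[OF bounded_linear_scaleC summable_LIMSEQ_zero[OF \<open>summable a\<close>]] .
    then have "(\<lambda>n. \<mu> *\<^sub>C a n) \<longlonglongrightarrow> 0" by simp
    from telescope_sums[OF this] show ?thesis unfolding step .
  qed
  ultimately have "T (suminf a) - \<mu> *\<^sub>C suminf a = 0 - \<mu> *\<^sub>C a 0" by (rule sums_unique2)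
  also have "\<mu> *\<^sub>C a 0 = y" using \<mu> by (simp add: a_def)
  finally have "T x - \<mu> *\<^sub>C x = y"
    using bounded_ops_UNIV_simps(3)[OF shift_in_bounded_ops[OF T, of \<mu>], of 0 "suminf a"]
      bounded_ops_UNIV_simps(1)[OF T] by (simp add: x_def)
  then show ?thesis using xN by blast
qed

subsection \<open>The classes and the theorem\<close>

lemma ecdim_eq_0_iff:
  assumes V: "csubspace V"
  shows "ecdim V = 0 \<longleftrightarrow> V = {0}"
proof
  assume *: "ecdim V = 0"
  have "x = 0" if "x \<in> V" for x
  proof (rule ccontr)
    assume "x \<noteq> 0"
    then have "enat 1 \<le> ecdim V" unfolding ecdim_ge_iff[OF V] using that by (intro exI[of _ "{x}"]) auto
    then show False using * by (simp add: one_enat_def zero_enat_def)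
  qed
  then show "V = {0}" using complex_vector.subspace_0[OF V] by blast
next
  assume *: "V = {0}"
  show "ecdim V = 0"
  proof (rule ccontr)
    assume "ecdim V \<noteq> 0"
    then have "enat 1 \<le> ecdim V" by (cases "ecdim V") (auto simp: zero_enat_def)
    then obtain B where B: "B \<subseteq> V" "\<not> cdependent B" "card B = 1" unfolding ecdim_ge_iff[OF V] by blast
    then have "B = {0}" using * by (auto simp: card_1_singleton_iff)
    then show False using B(2) by simp
  qed
qed

lemma codim_in_eq_0_iff:
  assumes R: "csubspace R" "R \<subseteq> Y"
  shows "codim_in Y R = 0 \<longleftrightarrow> R = Y"
proof
  assume "codim_in Y R = 0"
  then have "codim_in Y R < enat 1" by (simp add: zero_enat_def)
  then obtain F where "finite F" "Y \<subseteq> cspan (R \<union> F)" "card F < 1" unfolding codim_less_iff by blast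
  then have "Y \<subseteq> cspan R" by simp
  then show "R = Y" using R by (simp add: complex_vector.span_eq_iff[THEN iffD2] subset_antisym)
next
  assume "R = Y"
  then have "codim_in Y R < enat 1"
    unfolding codim_less_iff using complex_vector.span_base by (intro exI[of _ "{}"]) auto
  then show "codim_in Y R = 0" by (cases "codim_in Y R") (auto simp: zero_enat_def)
qed

lemma ascent_finite_iff: "ascent Y S < \<infinity> \<longleftrightarrow> (\<exists>n. ker_on Y (S ^^ n) = ker_on Y (S ^^ Suc n))"
  unfolding ascent_def Inf_less_iff by auto

lemma descent_finite_iff: "descent Y S < \<infinity> \<longleftrightarrow> (\<exists>n. (S ^^ n) ` Y = (S ^^ Suc n) ` Y)"
  unfolding descent_def Inf_less_iff by auto

text \<open>\<open>S\<close> is bijective on \<open>N\<close>, so its kernel lies in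
  \<open>M\<close>, and a complement of the range within \<open>M\<close> also complements the range
  in the whole space.\<close>

lemma Red_nullity_defect:
  fixes T S :: "'a::complex_banach \<Rightarrow> 'a"
  assumes S: "S \<in> bounded_ops UNIV" and red: "(M, N) \<in> Red T"
    and SM: "S ` M \<subseteq> M" and SN: "S ` N = N" "\<And>x. x \<in> N \<Longrightarrow> S x = 0 \<Longrightarrow> x = 0"
  shows "nullity UNIV S = nullity M S" "defect UNIV S = defect M S"
proof -
  note R = Red_D[OF red]
  note S_simps = bounded_ops_UNIV_simps[OF S]
  have "x \<in> M" if x: "S x = 0" for x
  proof -
    obtain m n where mn: "m \<in> M" "n \<in> N" "x = m + n" using R(8)[of x] by blast
    have "S m + S n = 0" using x mn(3) by (simp add: S_simps)
    then have "S n = - S m" by (simp add: eq_neg_iff_add_eq_0 add.commute)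
    moreover have "- S m \<in> M" using SM mn(1) by (intro complex_vector.subspace_neg[OF R(1)]) blast
    ultimately have "S n \<in> M" by simp
    moreover have "S n \<in> N" using SN(1) mn(2) by blast
    ultimately have "S n \<in> M \<inter> N" by blast
    then have "n = 0" using R(7) SN(2) mn(2) by blast
    then show ?thesis using mn by simp
  qed
  then show "nullity UNIV S = nullity M S" by (auto simp: nullity_def ker_on_def intro: arg_cong[where f = ecdim])
  note RM = csubspace_image[OF S R(1)]
  have U: "csubspace (range S)" by (rule csubspace_image[OF S complex_vector.subspace_UNIV])
  obtain W where W: "csubspace W" "S ` M \<inter> W = {0}" "M = {r + w |r w. r \<in> S ` M \<and> w \<in> W}"
    using complement_extends[OF RM SM R(1), of "{}"] by (auto simp: indep_mod_def)
  have WM: "W \<subseteq> M" using W(3) complex_vector.subspace_0[OF RM] by force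
  have "range S \<inter> W = {0}"
  proof (intro antisym subsetI)
    fix z assume z: "z \<in> range S \<inter> W"
    then obtain x where x: "z = S x" by blast
    obtain m n where mn: "m \<in> M" "n \<in> N" "x = m + n" using R(8)[of x] by blast
    have "S n = z - S m" using x mn(3) by (simp add: S_simps)
    moreover have "z - S m \<in> M" using z WM SM mn(1) by (intro complex_vector.subspace_diff[OF R(1)]) auto
    ultimately have "S n \<in> M" by simp
    moreover have "S n \<in> N" using SN(1) mn(2) by blast
    ultimately have "S n \<in> M \<inter> N" by blast
    then have "z = S m" using R(7) \<open>S n = z - S m\<close> by auto
    then show "z \<in> {0}" using W(2) z mn(1) by blast
  next
    fix z :: 'a assume "z \<in> {0}"
    then show "z \<in> range S \<inter> W" using complex_vector.subspace_0[OF W(1)] complex_vector.subspace_0[OF U] by simp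
  qed
  moreover have "UNIV = {r + w |r w. r \<in> range S \<and> w \<in> W}"
  proof (intro antisym subsetI UNIV_I)
    fix x :: 'a
    obtain m n where mn: "m \<in> M" "n \<in> N" "x = m + n" using R(8)[of x] by blast
    obtain m' w where "m = S m' + w" "w \<in> W" using mn(1) W(3) by blast
    moreover obtain n' where "n = S n'" using mn(2) SN(1) by blast
    ultimately have "x = S (m' + n') + w" "w \<in> W" using mn(3) by (simp_all add: S_simps)
    then show "x \<in> {r + w |r w. r \<in> range S \<and> w \<in> W}" by blast
  qed
  ultimately have "codim_in UNIV (range S) = ecdim W" by (rule codim_in_eq_ecdim_complement[OF U W(1)])
  then show "defect UNIV S = defect M S"
    unfolding defect_def codim_in_eq_ecdim_complement[OF RM W] .
qed

lemma invertible_opsI: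
  fixes T :: "'a::complex_banach \<Rightarrow> 'a"
  assumes T: "T \<in> bounded_ops UNIV" and M: "closed M" "csubspace M" "T ` M = M" "ker_on M T = {0}"
  shows "T \<in> invertible_ops M"
proof -
  note T_simps = bounded_ops_UNIV_simps[OF T]
  have inj: "inj_on T M"
  proof (rule inj_onI)
    fix x y assume xy: "x \<in> M" "y \<in> M" "T x = T y"
    then have "x - y \<in> ker_on M T" using M(2) by (simp add: ker_on_def T_simps complex_vector.subspace_diff)
    then show "x = y" using M(4) by simp
  qed
  define U where "U = inv_into M T"
  have UM: "U y \<in> M" and TU: "T (U y) = y" if "y \<in> M" for y
    using that M(3) by (auto simp: U_def inv_into_into f_inv_into_f)
  have UT: "U (T x) = x" if "x \<in> M" for x using that inj by (simp add: U_def)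
  obtain C where C: "C > 0" "\<And>y. y \<in> M \<Longrightarrow> \<exists>x\<in>M. T x = y \<and> norm x \<le> C * norm y"
    using open_mapping_subspace[OF bounded_ops_UNIV_linear[OF T] M(1) csubspace_imp_subspace[OF M(2)]] M(1)
    unfolding M(3) by blast
  have "U \<in> bounded_ops M"
    unfolding bounded_ops_def
  proof (intro CollectI conjI ballI allI)
    show "U ` M \<subseteq> M" using UM by blast
    show "U (x + y) = U x + U y" if "x \<in> M" "y \<in> M" for x y
      using UT[of "U x + U y"] that UM TU complex_vector.subspace_add[OF M(2)] by (simp add: T_simps)
    show "U (c *\<^sub>C x) = c *\<^sub>C U x" if "x \<in> M" for c x
      using UT[of "c *\<^sub>C U x"] that UM TU complex_vector.subspace_scale[OF M(2)] by (simp add: T_simps)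
    have "norm (U y) \<le> C * norm y" if y: "y \<in> M" for y
    proof -
      obtain x where "x \<in> M" "T x = y" "norm x \<le> C * norm y" using C(2)[OF y] by blast
      then show ?thesis using UT by auto
    qed
    then show "\<exists>K. \<forall>x\<in>M. norm (U x) \<le> K * norm x" by blast
  qed
  then show ?thesis
    unfolding invertible_ops_def using TU UT bounded_ops_restrict[OF T] M(3) by blast
qed

lemma bounded_below_opsI:
  fixes T :: "'a::complex_banach \<Rightarrow> 'a"
  assumes T: "T \<in> bounded_ops UNIV" and M: "closed M" "csubspace M" "T ` M \<subseteq> M" "closed (T ` M)"
    and ker: "ker_on M T = {0}"
  shows "T \<in> bounded_below_ops M"
proof -
  obtain C where C: "C > 0" "\<And>y. y \<in> T ` M \<Longrightarrow> \<exists>x\<in>M. T x = y \<and> norm x \<le> C * norm y"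
    using open_mapping_subspace[OF bounded_ops_UNIV_linear[OF T] M(1) csubspace_imp_subspace[OF M(2)] M(4)] by blast
  have "1 / C * norm x \<le> norm (T x)" if x: "x \<in> M" for x
  proof -
    obtain v where v: "v \<in> M" "T v = T x" "norm v \<le> C * norm (T x)" using C(2) x by blast
    have "v - x \<in> ker_on M T"
      using v x M(2) by (simp add: ker_on_def bounded_ops_UNIV_simps[OF T] complex_vector.subspace_diff)
    then have "v = x" using ker by simp
    then show ?thesis using v(3) C(1) by (simp add: field_simps)
  qed
  then show ?thesis unfolding bounded_below_ops_def
    using bounded_ops_restrict[OF T M(3)] C(1) by (intro CollectI conjI exI[of _ "1 / C"]) auto
qed

lemma index_between_1_12_cases:
  fixes i :: nat
  assumes "1 \<le> i" "i \<le> 12"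
  shows "i = 1 \<or> i = 2 \<or> i = 3 \<or> i = 4 \<or> i = 5 \<or> i = 6 \<or> i = 7 \<or> i = 8 \<or> i = 9 \<or> i = 10 \<or> i = 11 \<or> i = 12"
  using assms by presburger

lemma R_class_simps:
  "R_class (Suc 0) Y = Phi_plus Y" "R_class 2 Y = Phi_minus Y" "R_class 3 Y = Phi Y"
  "R_class 4 Y = W_plus Y" "R_class 5 Y = W_minus Y" "R_class 6 Y = Weyl Y"
  "R_class 7 Y = B_plus Y" "R_class 8 Y = B_minus Y" "R_class 9 Y = Browder Y"
  "R_class 10 Y = bounded_below_ops Y" "R_class 11 Y = surjective_ops Y" "R_class 12 Y = invertible_ops Y"
  by (simp_all add: R_class_def)

lemma R_class_semi_Fredholm:
  fixes T :: "'a::complex_banach \<Rightarrow> 'a"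
  assumes T: "T \<in> bounded_ops UNIV" and M: "closed M" "csubspace M" "T ` M \<subseteq> M"
    and i: "1 \<le> i" "i \<le> 12" and R: "T \<in> R_class i M"
  shows "T \<in> Phi_plus M \<union> Phi_minus M"
proof -
  note b = bounded_ops_restrict[OF T M(3)]
  have surj: "T \<in> Phi_minus M" if "T ` M = M"
    using b that codim_in_eq_0_iff[OF csubspace_image[OF T M(2)] M(3)]
    by (simp add: Phi_minus_def defect_def enat_0_iff)
  have "T \<in> Phi_plus M" if below: "T \<in> bounded_below_ops M"
  proof -
    obtain c where c: "c > 0" "\<And>x. x \<in> M \<Longrightarrow> c * norm x \<le> norm (T x)"
      using below by (auto simp: bounded_below_ops_def)
    have "closed (T ` M)"
    proof (rule closed_range_if_bounded_preimages[OF bounded_ops_UNIV_linear[OF T] M(1) csubspace_imp_subspace[OF M(2)]])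
      show "0 \<le> 1 / c" using c by simp
      show "\<exists>v\<in>M. T v = T x \<and> norm v \<le> 1 / c * norm (T x)" if "x \<in> M" for x
        using c(1) c(2)[OF that] that by (intro bexI[of _ x]) (auto simp: field_simps)
    qed
    moreover have "ker_on M T = {0}"
      using c complex_vector.subspace_0[OF M(2)] bounded_ops_UNIV_simps(1)[OF T]
      by (force simp: ker_on_def mult_le_0_iff)
    then have "nullity M T = 0" unfolding nullity_def using ecdim_eq_0_iff[OF csubspace_ker_on[OF T M(2)]] by simp
    ultimately show ?thesis using b by (simp add: Phi_plus_def enat_0_iff)
  qed
  moreover have "T ` M = M" if inv: "T \<in> invertible_ops M"
  proof -
    obtain U where U: "U \<in> bounded_ops M" "\<And>x. x \<in> M \<Longrightarrow> T (U x) = x" using inv by (auto simp: invertible_ops_def)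
    then have "U x \<in> M" if "x \<in> M" for x using that unfolding bounded_ops_def by blast
    then have "x \<in> T ` M" if "x \<in> M" for x using that U(2) by (metis imageI)
    then show ?thesis using M(3) by blast
  qed
  moreover have "T ` M = M" if "T \<in> surjective_ops M" using that by (simp add: surjective_ops_def)
  ultimately show ?thesis
    using index_between_1_12_cases[OF i] R surj
    by (auto simp: R_class_simps Phi_def Phi_minus_def W_plus_def W_minus_def Weyl_def B_plus_def B_minus_def Browder_def)
qed

text \<open>\<open>S\<close> is \<open>T - \<mu>\<close> for a point near \<open>0\<close> outside
  the spectrum; \<mu> is nonzero because \<open>T\<close> is not in the class, so \<open>S\<close>
  is bijective on \<open>N\<close>. Hence nullity, defect and index agree for \<open>S\<close> on
  the whole space and \<open>T\<close> on \<open>M\<close>. Ascent and descent are not determined by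
  these numbers and get their own arguments.\<close>

lemma Kato_part_in_R_class:
  fixes T :: "'a::complex_banach \<Rightarrow> 'a"
  assumes T: "T \<in> bounded_ops UNIV" and i: "1 \<le> i" "i \<le> 12"
    and fr: "0 \<in> frontier (spectrum_R i T)" and nR: "T \<notin> R_class i UNIV"
    and red: "(M, N) \<in> Red T" and kato: "Kato_on M T" and qn: "quasinilpotent_on N T"
  shows "T \<in> R_class i M"
proof -
  note M = Red_D(2,1,3)[OF red] and N = Red_D(5,4,6)[OF red]
  interpret kato_operator T M using T M kato by unfold_locales
  obtain \<epsilon> where e: "\<epsilon> > 0"
    and nul: "\<And>\<mu>. cmod \<mu> < \<epsilon> \<Longrightarrow> nullity M (\<lambda>x. T x - \<mu> *\<^sub>C x) = nullity M T"
    and dfc: "\<And>\<mu>. cmod \<mu> < \<epsilon> \<Longrightarrow> defect M (\<lambda>x. T x - \<mu> *\<^sub>C x) = defect M T"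
    and pre: "\<And>\<mu> x. cmod \<mu> < \<epsilon> \<Longrightarrow> x \<in> M \<Longrightarrow> T x - \<mu> *\<^sub>C x \<in> core \<Longrightarrow> x \<in> core"
    and onto: "\<And>\<mu>. cmod \<mu> < \<epsilon> \<Longrightarrow> (\<lambda>x. T x - \<mu> *\<^sub>C x) ` core = core"
    by (rule punctured_neighbourhood) (rule that; blast)
  have "0 \<in> closure (- spectrum_R i T)" using fr by (simp add: frontier_closures)
  then obtain \<mu> where "\<mu> \<notin> spectrum_R i T" "dist \<mu> 0 < \<epsilon>" using e by (auto simp: closure_approachable)
  then have \<mu>: "cmod \<mu> < \<epsilon>" by simp
  define S where "S = (\<lambda>x. T x - \<mu> *\<^sub>C x)"
  have S: "S \<in> bounded_ops UNIV" unfolding S_def by (rule shift_in_bounded_ops[OF T])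
  have SR: "S \<in> R_class i UNIV" using \<open>\<mu> \<notin> spectrum_R i T\<close> by (simp add: spectrum_R_def S_def)
  have "\<mu> \<noteq> 0" using SR nR by (auto simp: S_def)
  have S_inv: "S ` Z \<subseteq> Z" if "csubspace Z" "T ` Z \<subseteq> Z" for Z
    using that by (auto simp: S_def intro!: complex_vector.subspace_diff complex_vector.subspace_scale)
  have SM: "S ` M \<subseteq> M" by (rule S_inv[OF M(2,3)])
  have SN: "S ` N = N"
  proof
    show "S ` N \<subseteq> N" by (rule S_inv[OF N(2,3)])
    show "N \<subseteq> S ` N" using quasinilpotent_shift_surj[OF T N qn \<open>\<mu> \<noteq> 0\<close>] unfolding S_def by blast
  qed
  have SN0: "x = 0" if "x \<in> N" "S x = 0" for x
    using quasinilpotent_shift_inj[OF T qn \<open>\<mu> \<noteq> 0\<close> that(1)] that(2) by (simp add: S_def)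
  have nullity: "nullity M T = nullity UNIV S" and defect: "defect M T = defect UNIV S"
    using nul[OF \<mu>] dfc[OF \<mu>] Red_nullity_defect[OF S red SM SN SN0] by (simp_all flip: S_def)
  have index: "index_on M T = index_on UNIV S" by (simp add: index_on_def nullity defect)
  have cl: "closed (T ` M)" using kato by (simp add: Kato_on_def)
  have b: "T \<in> bounded_ops M" by (rule bounded_ops_restrict[OF T M(3)])
  have Score: "S ` core = core" using onto[OF \<mu>] by (simp add: S_def)
  have Spre: "x \<in> core" if "x \<in> M" "S x \<in> core" for x using pre[OF \<mu> that(1)] that(2) by (simp add: S_def)
  have core0: "0 \<in> core" by (rule complex_vector.subspace_0[OF csubspace_core])
  have ker0: "ker_on M T = {0}" if "nullity UNIV S = 0"
    using that nullity ecdim_eq_0_iff[OF csubspace_ker_on[OF T M(2)]] by (simp add: nullity_def)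
  have TM: "T ` M = M" if "defect UNIV S = 0"
    using that defect codim_in_eq_0_iff[OF csubspace_image[OF T M(2)] M(3)] by (simp add: defect_def)
  \<comment> \<open>\<open>S ^^ n\<close> maps the core onto itself, so a kernel vector of
    \<open>S\<close> in \<open>M\<close> has the form \<open>(S ^^ n) y\<close> with
    \<open>y\<close> in the kernel of \<open>S ^^ Suc n\<close>, hence of \<open>S ^^ n\<close>, and
    is zero. So the nullity vanishes, and \<open>T\<close> has ascent \<open>0\<close> on
    \<open>M\<close>.\<close>
  have asc: "ascent M T < \<infinity>" if fin: "ascent UNIV S < \<infinity>"
  proof -
    obtain n where n: "ker_on UNIV (S ^^ n) = ker_on UNIV (S ^^ Suc n)"
      using fin unfolding ascent_finite_iff by blast
    have "x = 0" if x: "x \<in> M" "S x = 0" for x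
    proof -
      have "x \<in> core" using Spre[OF x(1)] x(2) core0 by simp
      moreover have "(S ^^ n) ` core = core"
      proof (induction n)
        case (Suc n)
        have "(S ^^ Suc n) ` core = S ` ((S ^^ n) ` core)" by (simp add: image_comp)
        then show ?case using Suc Score by simp
      qed simp
      ultimately obtain y where y: "x = (S ^^ n) y" by blast
      then have "y \<in> ker_on UNIV (S ^^ Suc n)" using x(2) by (simp add: ker_on_def)
      then show "x = 0" unfolding n[symmetric] y by (simp add: ker_on_def)
    qed
    then have "ker_on M S = {0}"
      using complex_vector.subspace_0[OF M(2)] bounded_ops_UNIV_simps(1)[OF S] by (auto simp: ker_on_def)
    then have "nullity M S = 0"
      using ecdim_eq_0_iff[OF csubspace_ker_on[OF S M(2)]] by (simp add: nullity_def)
    then have "nullity UNIV S = 0" using nul[OF \<mu>] nullity by (simp add: S_def)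
    then have "ker_on M T = {0}" by (rule ker0)
    then have "ker_on M (T ^^ 0) = ker_on M (T ^^ Suc 0)"
      using complex_vector.subspace_0[OF M(2)] by (auto simp: ker_on_def)
    then show ?thesis unfolding ascent_finite_iff by blast
  qed
  \<comment> \<open>For \<open>x\<close> in \<open>M\<close> write
    \<open>(S ^^ n) x = (S ^^ Suc n) y\<close> and let \<open>m\<close> be the component of
    \<open>y\<close> in \<open>M\<close>. As the sum is direct, \<open>S ^^ n\<close> annihilates
    \<open>x - S m\<close>, which therefore lies in the core and so in the range. Thus
    \<open>S\<close> is onto \<open>M\<close>, and the defect vanishes.\<close>
  have dsc: "descent M T < \<infinity>" if fin: "descent UNIV S < \<infinity>"
  proof -
    obtain n where n: "(S ^^ n) ` UNIV = (S ^^ Suc n) ` UNIV" using fin unfolding descent_finite_iff by blast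
    note pow_simps = bounded_ops_UNIV_simps[OF funpow_in_bounded_ops[OF S]]
    have Spow_pre: "z \<in> core" if "z \<in> M" "(S ^^ k) z \<in> core" for k z
      using that
    proof (induction k arbitrary: z)
      case (Suc k)
      then have "S z \<in> core" using Suc.IH[of "S z"] SM by (auto simp: funpow_swap1)
      then show ?case using Spre Suc.prems(1) by blast
    qed simp
    have "x \<in> S ` M" if x: "x \<in> M" for x
    proof -
      obtain y where y: "(S ^^ n) x = (S ^^ Suc n) y" using n by blast
      obtain m k where mk: "m \<in> M" "k \<in> N" "y = m + k" using Red_D(8)[OF red, of y] by blast
      have Sm: "S m \<in> M" using SM mk(1) by blast
      have "(S ^^ Suc n) m = (S ^^ n) (S m)" by (simp add: funpow_swap1)
      then have "(S ^^ n) (x - S m) = (S ^^ Suc n) k"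
        using y mk(3) by (simp add: pow_simps(3) pow_simps(2)[of "Suc n"] del: funpow.simps)
      moreover have "(S ^^ n) (x - S m) \<in> M"
        using funpow_image_subset[OF SM, of n] x Sm complex_vector.subspace_diff[OF M(2)] by blast
      moreover have "(S ^^ Suc n) k \<in> N"
        using funpow_image_subset[of S N "Suc n"] SN mk(2) by blast
      ultimately have "(S ^^ n) (x - S m) = 0" using Red_D(7)[OF red] by auto
      then have "x - S m \<in> core"
        using Spow_pre x Sm core0 complex_vector.subspace_diff[OF M(2)] by metis
      then obtain k' where "k' \<in> core" "S k' = x - S m" using Score by (metis imageE)
      then have "x = S (k' + m)" "k' + m \<in> M"
        using core_subset mk(1) complex_vector.subspace_add[OF M(2)] by (auto simp: bounded_ops_UNIV_simps[OF S])
      then show ?thesis by blast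
    qed
    then have "S ` M = M" using SM by blast
    then have "defect M S = 0"
      using codim_in_eq_0_iff[OF csubspace_image[OF S M(2)] SM] by (simp add: defect_def)
    then have "defect UNIV S = 0" using dfc[OF \<mu>] defect by (simp add: S_def)
    then have "(T ^^ 0) ` M = (T ^^ Suc 0) ` M" using TM by simp
    then show ?thesis unfolding descent_finite_iff by blast
  qed
  have U: "csubspace (UNIV :: 'a set)" by (rule complex_vector.subspace_UNIV)
  have nullS: "nullity UNIV S = 0" if "\<And>x. S x = 0 \<Longrightarrow> x = 0"
  proof -
    have "ker_on UNIV S = {0}" using that bounded_ops_UNIV_simps(1)[OF S] by (auto simp: ker_on_def)
    then show ?thesis using ecdim_eq_0_iff[OF csubspace_ker_on[OF S U]] by (simp add: nullity_def)
  qed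
  have dfcS: "defect UNIV S = 0" if "range S = UNIV"
    using that codim_in_eq_0_iff[OF csubspace_image[OF S U]] by (simp add: defect_def)
  have below: "T \<in> bounded_below_ops M" if *: "S \<in> bounded_below_ops UNIV"
  proof -
    obtain c where c: "c > 0" "\<And>x. c * norm x \<le> norm (S x)" using * by (auto simp: bounded_below_ops_def)
    have "x = 0" if "S x = 0" for x using c(1) c(2)[of x] that by (simp add: mult_le_0_iff)
    from ker0[OF nullS[OF this]] show ?thesis by (rule bounded_below_opsI[OF T M cl])
  qed
  have surj: "T \<in> surjective_ops M" if *: "S \<in> surjective_ops UNIV"
    using TM dfcS * b by (simp add: surjective_ops_def)
  have inv: "T \<in> invertible_ops M" if *: "S \<in> invertible_ops UNIV"
  proof -
    obtain V where V: "\<And>x. V (S x) = x" "\<And>x. S (V x) = x" using * by (auto simp: invertible_ops_def)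
    have "range S = UNIV" using V(2) by (rule surjI)
    moreover have "x = 0" if "S x = 0" for x using V(1)[of x] V(1)[of 0] that bounded_ops_UNIV_simps(1)[OF S] by simp
    ultimately show ?thesis using TM dfcS ker0 nullS by (intro invertible_opsI[OF T M(1,2)]) auto
  qed
  show ?thesis
    using index_between_1_12_cases[OF i] SR b cl asc dsc below surj inv nullity defect index
    by (auto simp: R_class_simps Phi_plus_def Phi_minus_def Phi_def W_plus_def W_minus_def Weyl_def
        B_plus_def B_minus_def Browder_def)
qed

theorem corollary3p9:
  fixes T :: "'a::complex_banach \<Rightarrow> 'a" and i :: nat
  assumes "ecdim (UNIV :: 'a set) = \<infinity>"
    and "T \<in> bounded_ops UNIV"
    and "1 \<le> i" and "i \<le> 12"
    and "0 \<in> frontier (spectrum_R i T)"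
  shows "(generalized_Kato_decomposition T \<longleftrightarrow> T \<in> gDR i) \<and> (Kato_type T \<longleftrightarrow> T \<in> DR i)"
proof -
  note T = assms(2) and i = assms(3,4) and fr = assms(5)
  have trivial: "(UNIV, {0}) \<in> Red T" "quasinilpotent_on {0} T" "nilpotent_on {0} T"
    using quasinilpotent_on_0[OF T] bounded_ops_UNIV_simps(1)[OF T]
    by (auto simp: Red_def nilpotent_on_def quasinilpotent_on_def complex_vector.subspace_single_0
        intro!: exI[of _ 0])
  have decomposition: "\<exists>M' N' p. (M', N') \<in> Red T \<and> Kato_on M' T \<and> (T ^^ p) ` N' \<subseteq> N"
    if "(M, N) \<in> Red T" "T \<in> R_class i M" for M N
    using semi_Fredholm_decomposition[OF T that(1)] R_class_semi_Fredholm[OF T Red_D(2,1,3)[OF that(1)] i that(2)]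
    by blast
  have "T \<in> gDR i" if "generalized_Kato_decomposition T"
  proof (cases "T \<in> R_class i UNIV")
    case True
    then show ?thesis using trivial T unfolding gDR_def by blast
  next
    case False
    obtain M N where "(M, N) \<in> Red T" "Kato_on M T" "quasinilpotent_on N T"
      using \<open>generalized_Kato_decomposition T\<close> unfolding generalized_Kato_decomposition_def by blast
    then show ?thesis using Kato_part_in_R_class[OF T i fr False] T unfolding gDR_def by blast
  qed
  moreover have "generalized_Kato_decomposition T" if gdr: "T \<in> gDR i"
  proof -
    obtain M N where red: "(M, N) \<in> Red T" and R: "T \<in> R_class i M" and qn: "quasinilpotent_on N T"
      using gdr unfolding gDR_def by blast
    obtain M' N' p where *: "(M', N') \<in> Red T" "Kato_on M' T" "(T ^^ p) ` N' \<subseteq> N"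
      using decomposition[OF red R] by blast
    have "quasinilpotent_on N' T"
      using quasinilpotent_transfer[OF T complex_vector.subspace_0[OF Red_D(4)[OF red]] Red_D(4,6)[OF *(1)] *(3) qn] .
    then show ?thesis using * unfolding generalized_Kato_decomposition_def by blast
  qed
  moreover have "T \<in> DR i" if "Kato_type T"
  proof (cases "T \<in> R_class i UNIV")
    case True
    then show ?thesis using trivial T unfolding DR_def by blast
  next
    case False
    obtain M N where *: "(M, N) \<in> Red T" "Kato_on M T" "nilpotent_on N T"
      using \<open>Kato_type T\<close> unfolding Kato_type_def by blast
    have "quasinilpotent_on N T" by (rule nilpotent_imp_quasinilpotent[OF T Red_D(4,6)[OF *(1)] *(3)])
    then show ?thesis using Kato_part_in_R_class[OF T i fr False *(1,2)] * T unfolding DR_def by blast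
  qed
  moreover have "Kato_type T" if dr: "T \<in> DR i"
  proof -
    obtain M N where red: "(M, N) \<in> Red T" and R: "T \<in> R_class i M" and nil: "nilpotent_on N T"
      using dr unfolding DR_def by blast
    obtain M' N' p where *: "(M', N') \<in> Red T" "Kato_on M' T" "(T ^^ p) ` N' \<subseteq> N"
      using decomposition[OF red R] by blast
    obtain n where n: "\<And>x. x \<in> N \<Longrightarrow> (T ^^ n) x = 0" using nil by (auto simp: nilpotent_on_def)
    have "(T ^^ (n + p)) x = 0" if "x \<in> N'" for x using that *(3) n by (auto simp: funpow_add)
    then have "nilpotent_on N' T"
      unfolding nilpotent_on_def using bounded_ops_restrict[OF T Red_D(6)[OF *(1)]] by blast
    then show ?thesis using * unfolding Kato_type_def by blast
  qed
  ultimately show ?thesis by blast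
qed

end
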